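(* Algorithm SUKP-FPTAS described in the context runs in polynomial time and thus is an FPTAS for the stochastic unbounded min-knapsack problem. More specifically, it has time complexity \[O\left(\frac{n\log^6 W}{\epsilon^3}+\frac{n^3\log W}{\epsilon^4}\right).\]
   Context: Problem. Fix integers $n\ge 1$, $W\ge 2$ and $\epsilon\in(0,1)$. There are $n$ item types; type $i$ has a deterministic cost $c_i>0$ and a random weight $X_i$ with a known distribution whose support is contained in $\{1,\dots,W\}$ (standing assumption). Infinitely many items of each type, all weights independent; items inserted one at a time with weight revealed upon insertion, until total weight is at least $W$; the goal is the minimum expected total cost $OPT_W$, where $OPT_w=0$ for $w\le0$ and $OPT_w=\min_j\big(c_j+\sum_{k=1}^{W}\Pr[X_j=k]\,OPT_{w-k}\big)$ for $1\le w\le W$. The distributions are accessed through an oracle which, given $i$ and $j$, returns $D_i(j)=\Pr[X_i\le j]$; each oracle call and each arithmetic operation counts as unit time. An FPTAS is an algorithm returning a value within a factor $(1\pm\epsilon)$ of $OPT_W$ in time polynomial in $n$, $\log W$ and $1/\epsilon$. Distribution arrays. $\mathrm{Dist}(X)=(\Pr[X\ge 1],\dots,\Pr[X\ge W])$; for a non-increasing array $D=(D_1,\dots,D_W)$ with $D_1\le1$, $D_W\ge 0$, $\mathrm{Var}(D)$ is a random variable with values in $\{0,\dots,W\}$ and $\Pr[\mathrm{Var}(D)\ge j]=D_j$. The $(\zeta,\eta)$-approximate array of $A=(a_1,\dots,a_W)$ has entries $(1+\eta)^{\lceil\log_{1+\eta}a_j\rceil}$ if $a_j>(1+\eta)^{-\zeta}$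 and $(1+\eta)^{-\zeta}$ otherwise. Parameters. $d_i(j)=\Pr[X_i=j]$, $\bar E[X_i]=\sum_{j=1}^{W}d_i(j)2^{\lfloor\log_2 j\rfloor}$, $T=\frac W2\min_i\frac{c_i}{\bar E[X_i]}$, $\theta=\frac{\epsilon}{10n}$, $\delta=\frac{\epsilon^2}{100n}$, $\eta=\frac{\epsilon}{10\log_2W}$, $\zeta=\log_{1+\eta}\frac W\eta$; $e_p=1$ if $c_p\ge\theta T$, otherwise $e_p=2^{k_p}$ for an integer $k_p$ with $e_pc_p\in[\theta T,2\theta T]$. Subroutine DP (input: $n$ types with costs $c'_k$, weights $X'_k$, $d'_k(j)=\Pr[X'_k=j]$): $f_0=0$; for $i=1,\dots,\lceil1/\delta\rceil+1$: $g_w=j\delta T$ if $f_{j-1}<w\le f_j$ for some $1\le j\le i-1$, $g_w=i\delta T$ if $w>f_{i-1}$; $f_i=\max\{w'\in\{0,\dots,W\}:\exists k,\ c'_k+\sum_{j=1}^{w'-1}d'_k(w'-j)g_j\le i\delta T\}$, found by binary search over $w'$; if $f_i\ge W$ output $i\delta T$. Algorithm SUKP-FPTAS: compute $T$; for each type $p$, let $B_1=\mathrm{Var}$ of the $(\zeta,\eta)$-approximate array of $\mathrm{Dist}(X_p)$ (obtained from the oracle), and for $i=1,\dots,\log_2e_p$ let $B'_{2^i}$ be the sum of two independent copies of $B_{2^{i-1}}$ and $B_{2^i}=\mathrm{Var}$ of the $(\zeta,\eta)$-approximate array of $\mathrm{Dist}(B'_{2^i})$; set $Y_p=B_{e_p}$;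 run Subroutine DP on the new types with costs $c_pe_p$ and weights $Y_p$ and return its output.
   Formalization: The limit ⌈1/δ⌉+1 on DP rounds is too small (n=1, c=1, X=1, small ε: no output), so it is replaced by ⌈K/δ⌉+1; the FPTAS claim is for K≥6, while the time bound and the (1±ε) guarantee for any returned value hold for all K≥1, including K=1. *)

theory Defs
  imports "HOL-Probability.Probability_Mass_Function" "HOL-Library.Monad_Syntax"
begin

section \<open>The stochastic unbounded min-knapsack problem\<close>

text \<open>The item types are \<open>0, \<dots>, n - 1\<close>; type \<open>i\<close> has cost \<open>c i\<close> and weight distribution \<open>X i\<close>.\<close>

definition min_sukp :: "nat \<Rightarrow> nat \<Rightarrow> (nat \<Rightarrow> real) \<Rightarrow> (nat \<Rightarrow> nat pmf) \<Rightarrow> bool" where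
  "min_sukp n W c X \<longleftrightarrow>
     1 \<le> n \<and> 2 \<le> W \<and> (\<forall>i<n. 0 < c i \<and> set_pmf (X i) \<subseteq> {1..W})"

text \<open>Subtraction on \<^typ>\<open>nat\<close> is truncated, so \<open>w - k = 0\<close> for \<open>k \<ge> w\<close>: this is the convention
  that the optimum is \<open>0\<close> for all non-positive remaining weights.\<close>

fun sukp_opt :: "nat \<Rightarrow> nat \<Rightarrow> (nat \<Rightarrow> real) \<Rightarrow> (nat \<Rightarrow> nat pmf) \<Rightarrow> nat \<Rightarrow> real" where
  "sukp_opt n W c X w =
     (if w = 0 then 0
      else Min ((\<lambda>i. c i + (\<Sum>k=1..W. pmf (X i) k * sukp_opt n W c X (w - k))) ` {..<n}))"

declare sukp_opt.simps [simp del]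

definition cdf_oracle :: "(nat \<Rightarrow> nat pmf) \<Rightarrow> nat \<Rightarrow> nat \<Rightarrow> real" where
  "cdf_oracle X i j = measure_pmf.prob (X i) {..j}"


section \<open>Distribution arrays\<close>

text \<open>An array \<open>(a\<^sub>1, \<dots>, a\<^sub>W)\<close> is a function on \<^typ>\<open>nat\<close>, of which only the values
  at \<open>1, \<dots>, W\<close> matter.\<close>

definition Dist :: "nat pmf \<Rightarrow> nat \<Rightarrow> real" where
  "Dist X j = measure_pmf.prob X {j..}"

definition Var :: "nat \<Rightarrow> (nat \<Rightarrow> real) \<Rightarrow> nat pmf" where
  "Var W D = (THE q. set_pmf q \<subseteq> {0..W} \<and> (\<forall>j\<in>{1..W}. measure_pmf.prob q {j..} = D j))"

definition approx_entry :: "real \<Rightarrow> real \<Rightarrow> real \<Rightarrow> real" where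
  "approx_entry \<zeta> \<eta> a =
     (if a > (1 + \<eta>) powr (-\<zeta>) then (1 + \<eta>) powi \<lceil>log (1 + \<eta>) a\<rceil> else (1 + \<eta>) powr (-\<zeta>))"

definition approx_array :: "real \<Rightarrow> real \<Rightarrow> (nat \<Rightarrow> real) \<Rightarrow> nat \<Rightarrow> real" where
  "approx_array \<zeta> \<eta> A j = approx_entry \<zeta> \<eta> (A j)"

text \<open>\<open>block W \<zeta> \<eta> X i\<close> is the variable \<open>B\<close> with index \<open>2\<^sup>i\<close>.\<close>

primrec block :: "nat \<Rightarrow> real \<Rightarrow> real \<Rightarrow> nat pmf \<Rightarrow> nat \<Rightarrow> nat pmf" where
  "block W \<zeta> \<eta> X 0 = Var W (approx_array \<zeta> \<eta> (Dist X))"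
| "block W \<zeta> \<eta> X (Suc i) =
     (let B = block W \<zeta> \<eta> X i;
          B' = map_pmf (\<lambda>(a, b). a + b) (pair_pmf B B)
      in Var W (approx_array \<zeta> \<eta> (Dist B')))"


section \<open>Parameters\<close>

definition rounded_mean :: "nat \<Rightarrow> nat pmf \<Rightarrow> real" where
  "rounded_mean W X = (\<Sum>j=1..W. pmf X j * 2 powi \<lfloor>log 2 (real j)\<rfloor>)"

definition T_par :: "nat \<Rightarrow> nat \<Rightarrow> (nat \<Rightarrow> real) \<Rightarrow> (nat \<Rightarrow> nat pmf) \<Rightarrow> real" where
  "T_par n W c X = real W / 2 * Min ((\<lambda>i. c i / rounded_mean W (X i)) ` {..<n})"

definition theta_par :: "nat \<Rightarrow> real \<Rightarrow> real" where
  "theta_par n \<epsilon> = \<epsilon> / (10 * real n)"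

definition delta_par :: "nat \<Rightarrow> real \<Rightarrow> real" where
  "delta_par n \<epsilon> = \<epsilon>\<^sup>2 / (100 * real n)"

definition eta_par :: "nat \<Rightarrow> real \<Rightarrow> real" where
  "eta_par W \<epsilon> = \<epsilon> / (10 * log 2 (real W))"

definition zeta_par :: "nat \<Rightarrow> real \<Rightarrow> real" where
  "zeta_par W \<epsilon> = log (1 + eta_par W \<epsilon>) (real W / eta_par W \<epsilon>)"

text \<open>The exponent \<open>k\<^sub>p\<close>, so that \<open>e\<^sub>p = 2 ^ k\<^sub>p\<close>; the arguments are \<open>\<theta> T\<close> and \<open>c\<^sub>p\<close>.  It is only
  ambiguous if some \<open>2 ^ k * c\<^sub>p\<close> equals \<open>\<theta> T\<close>, and then the smaller exponent is taken.\<close>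

definition block_exponent :: "real \<Rightarrow> real \<Rightarrow> nat" where
  "block_exponent t c = (if c \<ge> t then 0 else (LEAST k. 2 ^ k * c \<in> {t..2 * t}))"


section \<open>Subroutine DP\<close>

text \<open>\<open>u\<close> stands for \<open>\<delta> T\<close>, and \<open>f j\<close> is the value \<open>f\<^sub>j\<close> of an earlier round \<open>j < i\<close>.\<close>

definition dp_g :: "real \<Rightarrow> (nat \<Rightarrow> nat) \<Rightarrow> nat \<Rightarrow> nat \<Rightarrow> real" where
  "dp_g u f i w =
     (if w > f (i - 1) then real i * u
      else real (THE j. j \<in> {1..i - 1} \<and> f (j - 1) < w \<and> w \<le> f j) * u)"

text \<open>The set of admissible \<open>w'\<close> is empty as long as \<open>i u\<close> is below all costs; its
  maximum is then read as \<open>0\<close>.\<close>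

definition dp_next :: "nat \<Rightarrow> nat \<Rightarrow> (nat \<Rightarrow> real) \<Rightarrow> (nat \<Rightarrow> nat pmf) \<Rightarrow> real
    \<Rightarrow> (nat \<Rightarrow> nat) \<Rightarrow> nat \<Rightarrow> nat" where
  "dp_next n W c Y u f i =
     Max (insert 0 {w' \<in> {0..W}. \<exists>k<n.
        c k + (\<Sum>j=1..w' - 1. pmf (Y k) (w' - j) * dp_g u f i j) \<le> real i * u})"

text \<open>\<open>dp_hist \<dots> i\<close> is the function \<open>f\<close> restricted to \<open>0, \<dots>, i\<close>.\<close>

primrec dp_hist :: "nat \<Rightarrow> nat \<Rightarrow> (nat \<Rightarrow> real) \<Rightarrow> (nat \<Rightarrow> nat pmf) \<Rightarrow> real
    \<Rightarrow> nat \<Rightarrow> (nat \<Rightarrow> nat)" where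
  "dp_hist n W c Y u 0 = (\<lambda>_. 0)"
| "dp_hist n W c Y u (Suc i) =
     (let f = dp_hist n W c Y u i in f(Suc i := dp_next n W c Y u f (Suc i)))"

text \<open>\<open>N\<close> is the number of rounds; \<^const>\<open>None\<close> means that no round produced an output.\<close>

definition dp_output :: "nat \<Rightarrow> nat \<Rightarrow> (nat \<Rightarrow> real) \<Rightarrow> (nat \<Rightarrow> nat pmf) \<Rightarrow> real
    \<Rightarrow> nat \<Rightarrow> real option" where
  "dp_output n W c Y u N =
     (let done = (\<lambda>i. i \<in> {1..N} \<and> dp_hist n W c Y u i i \<ge> W)
      in if \<exists>i. done i then Some (real (LEAST i. done i) * u) else None)"


section \<open>Algorithm SUKP-FPTAS on full arrays\<close>

text \<open>\<open>K\<close> scales the limit \<open>\<lceil>K / \<delta>\<rceil> + 1\<close> on the number of rounds of Subroutine DP.  With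
  \<open>K = 1\<close> the rounds only reach values up to about \<open>T\<close>, whereas the optimum lies
  between \<open>T\<close> and \<open>4 T\<close>, so that in general a larger constant is needed for an output to exist.\<close>

definition dp_rounds :: "real \<Rightarrow> nat \<Rightarrow> real \<Rightarrow> nat" where
  "dp_rounds K n \<epsilon> = nat \<lceil>K / delta_par n \<epsilon>\<rceil> + 1"

definition sukp_alg :: "real \<Rightarrow> nat \<Rightarrow> nat \<Rightarrow> (nat \<Rightarrow> real) \<Rightarrow> (nat \<Rightarrow> nat pmf) \<Rightarrow> real
    \<Rightarrow> real option" where
  "sukp_alg K n W c X \<epsilon> =
     (let T = T_par n W c X;
          \<eta> = eta_par W \<epsilon>;
          \<zeta> = zeta_par W \<epsilon>;
          k = (\<lambda>p. block_exponent (theta_par n \<epsilon> * T) (c p));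
          Y = (\<lambda>p. block W \<zeta> \<eta> (X p) (k p))
      in dp_output n W (\<lambda>p. c p * 2 ^ k p) Y (delta_par n \<epsilon> * T) (dp_rounds K n \<epsilon>))"


section \<open>Cost model\<close>

text \<open>A value together with the number of unit-time operations spent to compute it.\<close>

datatype 'a tm = TM (val: 'a) (cost: nat)

definition bind_tm :: "'a tm \<Rightarrow> ('a \<Rightarrow> 'b tm) \<Rightarrow> 'b tm" where
  "bind_tm m f = TM (val (f (val m))) (cost m + cost (f (val m)))"

adhoc_overloading Monad_Syntax.bind \<rightleftharpoons> bind_tm

text \<open>This rule lets the termination proofs below use the value of \<open>m\<close>.\<close>

lemma bind_tm_cong [fundef_cong]:
  "m = m' \<Longrightarrow> (\<And>x. x = val m' \<Longrightarrow> f x = f' x) \<Longrightarrow> bind_tm m f = bind_tm m' f'"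
  by (simp add: bind_tm_def)

text \<open>\<open>charge k x\<close> returns \<open>x\<close> at cost \<open>k\<close>.  In every use below, \<open>k\<close> is at least the number of
  oracle calls, arithmetic operations on integers and reals
  (\<open>+\<close>, \<open>-\<close>, \<open>*\<close>, \<open>/\<close>, \<open>div\<close>, comparison, minimum, powers, logarithms, rounding) and list
  cells visited or created in evaluating the expression \<open>x\<close>, and \<open>k \<ge> 1\<close>.\<close>

definition charge :: "nat \<Rightarrow> 'a \<Rightarrow> 'a tm" where
  "charge k x = TM x k"

lemma val_charge [simp]: "val (charge k x) = x"
  by (simp add: charge_def)

lemma val_bind_tm [simp]: "val (bind_tm m f) = val (f (val m))"
  by (simp add: bind_tm_def)

definition query :: "(nat \<Rightarrow> nat \<Rightarrow> real) \<Rightarrow> nat \<Rightarrow> nat \<Rightarrow> real tm" where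
  "query D i j = charge 1 (D i j)"

primrec sum_tm :: "(nat \<Rightarrow> real tm) \<Rightarrow> nat \<Rightarrow> real tm" where
  "sum_tm f 0 = charge 1 0"
| "sum_tm f (Suc k) = do { s \<leftarrow> sum_tm f k; x \<leftarrow> f k; charge 2 (s + x) }"

text \<open>Minimum of \<open>f 0, \<dots>, f k\<close>.\<close>

primrec min_tm :: "(nat \<Rightarrow> real tm) \<Rightarrow> nat \<Rightarrow> real tm" where
  "min_tm f 0 = f 0"
| "min_tm f (Suc k) = do { m \<leftarrow> min_tm f k; x \<leftarrow> f (Suc k); charge 2 (min m x) }"

primrec map_tm :: "('a \<Rightarrow> 'b tm) \<Rightarrow> 'a list \<Rightarrow> 'b list tm" where
  "map_tm f [] = charge 1 []"
| "map_tm f (x # xs) = do { y \<leftarrow> f x; ys \<leftarrow> map_tm f xs; charge 2 (y # ys) }"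

text \<open>Binary search for the greatest \<open>m\<close> with \<open>lo \<le> m < hi\<close> and \<open>P m\<close>, where \<open>P\<close> is downward
  closed; \<open>P lo\<close> is taken for granted and not evaluated.\<close>

function bsearch_tm :: "(nat \<Rightarrow> bool tm) \<Rightarrow> nat \<Rightarrow> nat \<Rightarrow> nat tm" where
  "bsearch_tm P lo hi =
     (if hi \<le> lo + 1 then charge 2 lo
      else do {
        m \<leftarrow> charge 4 ((lo + hi) div 2);
        b \<leftarrow> P m;
        if b then bsearch_tm P m hi else bsearch_tm P lo m })"
  by pat_completeness auto
termination
  by (relation "Wellfounded.measure (\<lambda>(P, lo, hi). hi - lo)") auto

declare bsearch_tm.simps [simp del]

lemma bsearch_tm_ge: "lo \<le> val (bsearch_tm P lo hi)"
proof (induction P lo hi rule: bsearch_tm.induct)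
  case (1 P lo hi)
  show ?case
  proof (cases "hi \<le> lo + 1")
    case True
    then show ?thesis by (simp add: bsearch_tm.simps [of P lo hi])
  next
    case False
    define m where "m = (lo + hi) div 2"
    have "lo \<le> m" using False by (simp add: m_def)
    moreover have "m \<le> val (bsearch_tm P m hi)" if "val (P m)"
      using "1.IH"(1)[OF False, of m "val (P m)"] that by (simp add: m_def)
    moreover have "lo \<le> val (bsearch_tm P lo m)" if "\<not> val (P m)"
      using "1.IH"(2)[OF False, of m "val (P m)"] that by (simp add: m_def)
    ultimately show ?thesis
      using False by (auto simp: bsearch_tm.simps [of P lo hi] m_def [symmetric])
  qed
qed


section \<open>Timed implementation of Algorithm SUKP-FPTAS\<close>

text \<open>In what follows \<open>D\<close> is the oracle.  Since \<open>2 powi \<lfloor>log 2 j\<rfloor> = 2 ^ k\<close> for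
  \<open>2 ^ k \<le> j < 2 ^ (k + 1)\<close>, the rounded mean needs two oracle calls for each such \<open>k\<close>.\<close>

definition rounded_mean_tm :: "nat \<Rightarrow> (nat \<Rightarrow> nat \<Rightarrow> real) \<Rightarrow> nat \<Rightarrow> real tm" where
  "rounded_mean_tm W D i = do {
     m \<leftarrow> charge 3 (nat \<lfloor>log 2 (real W)\<rfloor> + 1);
     sum_tm (\<lambda>k. do {
       b \<leftarrow> charge 4 (min (2 ^ (k + 1) - 1) W);
       a \<leftarrow> charge 2 (2 ^ k - 1);
       y \<leftarrow> query D i b;
       x \<leftarrow> query D i a;
       charge 3 (2 ^ k * (y - x)) }) m }"

text \<open>A non-increasing array on \<open>1, \<dots>, W\<close> is represented by the list of its plateaus: the list
  \<open>[(b\<^sub>1, v\<^sub>1), \<dots>, (b\<^sub>m, v\<^sub>m)]\<close> with \<open>b\<^sub>1 < \<dots> < b\<^sub>m = W\<close> has the entry \<open>v\<^sub>r\<close> at every \<open>j\<close> with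
  \<open>b\<^bsub>r-1\<^esub> < j \<le> b\<^sub>r\<close>, where \<open>b\<^sub>0 = 0\<close>.

  \<open>compress_tm W \<zeta> \<eta> a j\<close> computes the part at \<open>j, \<dots>, W\<close> of the \<open>(\<zeta>, \<eta>)\<close>-approximate array of the
  array with entries computed by \<open>a\<close>; the end of each plateau is found by binary search.\<close>

definition approx_entry_tm :: "real \<Rightarrow> real \<Rightarrow> real \<Rightarrow> real tm" where
  "approx_entry_tm \<zeta> \<eta> a = charge 11 (approx_entry \<zeta> \<eta> a)"

function compress_tm :: "nat \<Rightarrow> real \<Rightarrow> real \<Rightarrow> (nat \<Rightarrow> real tm) \<Rightarrow> nat \<Rightarrow> (nat \<times> real) list tm" where
  "compress_tm W \<zeta> \<eta> a j =
     (if W < j then charge 2 []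
      else do {
        x \<leftarrow> a j;
        v \<leftarrow> approx_entry_tm \<zeta> \<eta> x;
        b \<leftarrow> bsearch_tm (\<lambda>m. do {
               y \<leftarrow> a m;
               u \<leftarrow> approx_entry_tm \<zeta> \<eta> y;
               charge 1 (u = v) }) j (W + 1);
        ps \<leftarrow> compress_tm W \<zeta> \<eta> a (b + 1);
        charge 4 ((b, v) # ps) })"
  by pat_completeness auto
termination
  by (relation "Wellfounded.measure (\<lambda>(W, \<zeta>, \<eta>, a, j). W + 1 - j)")
     (auto simp: Suc_diff_le intro!: le_less_trans [OF diff_le_mono2 [OF bsearch_tm_ge]])

declare compress_tm.simps [simp del]

text \<open>The atoms of the distribution with tail array given by a plateau list.  The atom at \<open>0\<close> is
  omitted, as it has mass \<open>0\<close> in the algorithm (all arrays have first entry \<open>1\<close>).\<close>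

fun atoms_tm :: "(nat \<times> real) list \<Rightarrow> (nat \<times> real) list tm" where
  "atoms_tm [] = charge 1 []"
| "atoms_tm [(b, v)] = charge 2 [(b, v)]"
| "atoms_tm ((b, v) # (b', v') # ps) = do {
     as \<leftarrow> atoms_tm ((b', v') # ps);
     charge 4 ((b, v - v') # as) }"

text \<open>\<open>expect_tm m as g\<close> is the expectation of \<open>G (m - Y)\<close>, where \<open>Y\<close> has the atoms \<open>as\<close>, in
  increasing order, and \<open>G\<close> is the step function given by the list \<open>g = [(b\<^sub>1, v\<^sub>1), \<dots>, (b\<^sub>m, v\<^sub>m)]\<close>
  with \<open>b\<^sub>1 \<ge> \<dots> \<ge> b\<^sub>m = 0\<close>: \<open>G z = v\<^sub>r\<close> for \<open>b\<^bsub>r+1\<^esub> < z \<le> b\<^sub>r\<close>, and \<open>G z = v\<^sub>m\<close> for \<open>z \<le> 0\<close>.  As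
  \<open>m - Y\<close> decreases along \<open>as\<close>, both lists are traversed only once.\<close>

fun expect_tm :: "nat \<Rightarrow> (nat \<times> real) list \<Rightarrow> (nat \<times> real) list \<Rightarrow> real tm" where
  "expect_tm m ((x, p) # as) ((b, v) # (b', v') # g) =
     do {
       skip \<leftarrow> charge 6 (m \<le> x + b');
       if skip then expect_tm m ((x, p) # as) ((b', v') # g)
       else do {
         s \<leftarrow> expect_tm m as ((b, v) # (b', v') # g);
         charge 2 (p * v + s) } }"
| "expect_tm m ((x, p) # as) [(b, v)] = do {
     s \<leftarrow> expect_tm m as [(b, v)];
     charge 4 (p * v + s) }"
| "expect_tm m _ _ = charge 1 0"

text \<open>One doubling step: if \<open>B, B'\<close> are independent with tail array \<open>ps\<close>, then
  \<open>Pr[B + B' \<ge> m]\<close> is the expectation of \<open>G (m - B)\<close> for \<open>G z = Pr[B' \<ge> z]\<close>, with \<open>G z = 1\<close> for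
  \<open>z \<le> 0\<close>.\<close>

definition double_tm :: "nat \<Rightarrow> real \<Rightarrow> real \<Rightarrow> (nat \<times> real) list \<Rightarrow> (nat \<times> real) list tm" where
  "double_tm W \<zeta> \<eta> ps = do {
     as \<leftarrow> atoms_tm ps;
     g \<leftarrow> charge (length ps + 1) (rev ((0, 1) # ps));
     compress_tm W \<zeta> \<eta> (\<lambda>m. expect_tm m as g) 1 }"

text \<open>The plateau list of the tail array of \<^const>\<open>block\<close>, for item type \<open>p\<close>.\<close>

primrec block_tm :: "nat \<Rightarrow> real \<Rightarrow> real \<Rightarrow> (nat \<Rightarrow> nat \<Rightarrow> real) \<Rightarrow> nat \<Rightarrow> nat
    \<Rightarrow> (nat \<times> real) list tm" where
  "block_tm W \<zeta> \<eta> D p 0 =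
     compress_tm W \<zeta> \<eta> (\<lambda>j. do { x \<leftarrow> query D p (j - 1); charge 2 (1 - x) }) 1"
| "block_tm W \<zeta> \<eta> D p (Suc i) = do {
     ps \<leftarrow> block_tm W \<zeta> \<eta> D p i;
     qs \<leftarrow> double_tm W \<zeta> \<eta> ps;
     charge 1 qs }"

text \<open>Is there an item type, among those with costs and atoms \<open>ts\<close>, that can be inserted at
  remaining weight \<open>m\<close> within budget \<open>v\<close>?\<close>

fun feasible_tm :: "real \<Rightarrow> nat \<Rightarrow> (nat \<times> real) list \<Rightarrow> (real \<times> (nat \<times> real) list) list
    \<Rightarrow> bool tm" where
  "feasible_tm v m g [] = charge 1 False"
| "feasible_tm v m g ((c, as) # ts) = do {
     s \<leftarrow> expect_tm m as g;
     b \<leftarrow> charge 3 (c + s \<le> v);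
     if b then charge 1 True else feasible_tm v m g ts }"

text \<open>Round \<open>i\<close> of Subroutine DP when \<open>r\<close> rounds are left, with
  \<open>fs = [(f\<^bsub>i-1\<^esub>, (i - 1) u), \<dots>, (f\<^sub>1, u), (f\<^sub>0, 0)]\<close>.\<close>

primrec dp_tm :: "nat \<Rightarrow> (real \<times> (nat \<times> real) list) list \<Rightarrow> real \<Rightarrow> nat \<Rightarrow> nat
    \<Rightarrow> (nat \<times> real) list \<Rightarrow> real option tm" where
  "dp_tm W ts u 0 i fs = charge 1 None"
| "dp_tm W ts u (Suc r) i fs = do {
     v \<leftarrow> charge 1 (real i * u);
     g \<leftarrow> charge 1 ((W, v) # fs);
     f \<leftarrow> bsearch_tm (\<lambda>m. feasible_tm v m g ts) 0 (W + 1);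
     stop \<leftarrow> charge 1 (W \<le> f);
     if stop then charge 1 (Some v)
     else do {
       fs' \<leftarrow> charge 1 ((f, v) # fs);
       i' \<leftarrow> charge 2 (Suc i);
       dp_tm W ts u r i' fs' } }"

text \<open>Here \<open>nat \<lceil>log 2 (\<theta> T / c p)\<rceil>\<close> is the least \<open>k\<close> with \<open>2 ^ k * c p \<ge> \<theta> T\<close>.\<close>

definition sukp_alg_tm :: "real \<Rightarrow> nat \<Rightarrow> nat \<Rightarrow> (nat \<Rightarrow> real) \<Rightarrow> (nat \<Rightarrow> nat \<Rightarrow> real) \<Rightarrow> real
    \<Rightarrow> real option tm" where
  "sukp_alg_tm K n W c D \<epsilon> = do {
     l \<leftarrow> charge 1 (n - 1);
     q \<leftarrow> min_tm (\<lambda>i. do { e \<leftarrow> rounded_mean_tm W D i; charge 2 (c i / e) }) l;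
     T \<leftarrow> charge 2 (real W / 2 * q);
     \<theta> \<leftarrow> charge 2 (theta_par n \<epsilon>);
     \<delta> \<leftarrow> charge 3 (delta_par n \<epsilon>);
     \<eta> \<leftarrow> charge 3 (eta_par W \<epsilon>);
     \<zeta> \<leftarrow> charge 9 (zeta_par W \<epsilon>);
     is \<leftarrow> charge (n + 1) [0..<n];
     ts \<leftarrow> map_tm (\<lambda>p. do {
             k \<leftarrow> charge 6 (nat \<lceil>log 2 (\<theta> * T / c p)\<rceil>);
             ps \<leftarrow> block_tm W \<zeta> \<eta> D p k;
             as \<leftarrow> atoms_tm ps;
             charge 3 (c p * 2 ^ k, as) }) is;
     u \<leftarrow> charge 1 (\<delta> * T);
     N \<leftarrow> charge 6 (dp_rounds K n \<epsilon>);
     fs \<leftarrow> charge 1 [(0, 0)];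
     dp_tm W ts u N 1 fs }"


section \<open>Fully polynomial-time approximation schemes\<close>

text \<open>The arguments of an algorithm are \<open>n\<close>, \<open>W\<close>, the costs, the distribution oracle and \<open>\<epsilon>\<close>.  As
  \<open>n\<close>, \<open>log 2 W\<close> and \<open>1 / \<epsilon>\<close> are all at least \<open>1\<close>, a function is bounded by a polynomial in them
  iff it is bounded by a constant times a monomial.\<close>

definition is_fptas :: "(nat \<Rightarrow> nat \<Rightarrow> (nat \<Rightarrow> real) \<Rightarrow> (nat \<Rightarrow> nat \<Rightarrow> real) \<Rightarrow> real \<Rightarrow> real option tm)
    \<Rightarrow> bool" where
  "is_fptas alg \<longleftrightarrow>
     (\<forall>n W c X \<epsilon>. min_sukp n W c X \<and> 0 < \<epsilon> \<and> \<epsilon> < 1 \<longrightarrow>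
        (\<exists>v. val (alg n W c (cdf_oracle X) \<epsilon>) = Some v \<and>
           (1 - \<epsilon>) * sukp_opt n W c X W \<le> v \<and> v \<le> (1 + \<epsilon>) * sukp_opt n W c X W)) \<and>
     (\<exists>C d1 d2 d3. \<forall>n W c X \<epsilon>. min_sukp n W c X \<and> 0 < \<epsilon> \<and> \<epsilon> < 1 \<longrightarrow>
        real (cost (alg n W c (cdf_oracle X) \<epsilon>))
          \<le> C * real n ^ d1 * log 2 (real W) ^ d2 * (1 / \<epsilon>) ^ d3)"

end

theory Submission
  imports Defs
begin

text \<open>By summation by parts, the expected optimum after an insertion is the current optimum minus a
  non-negative combination of the tail probabilities of the weight.  Hence a relative error \<open>\<eta>\<close> and
  an additive error \<open>\<eta> / W\<close> in all tails change the optimum by at most a factor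
  \<open>(1 + \<eta>) / (1 - \<eta>)\<close>, which is incurred once for each of the at most \<open>log 2 W\<close> doublings.
  Buying items of type \<open>p\<close> in pairs costs at most \<open>c p\<close> more in total, because one item can be kept
  in reserve; this adds up to \<open>2 n \<theta> T\<close>.  Once every cost is at least \<open>\<theta> T\<close>,
  rounding the value function up to multiples of \<open>\<delta> T\<close> loses a factor \<open>1 + \<delta> / \<theta>\<close>.

  A rounded array takes \<open>O(\<zeta>)\<close> distinct values, so expectations are computed in linear time in
  \<open>\<zeta>\<close> and the number of DP rounds; \<open>log (1 / \<epsilon>)\<close> is absorbed by \<open>1 / sqrt \<epsilon>\<close>, and the mixed term
  of the running time by the arithmetic-geometric mean inequality.\<close>


section \<open>Expected cost after an insertion\<close>

text \<open>Comparisons of optima are verifications rather than transformations of policies: a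
  function that satisfies one side of the optimality equation bounds the optimum on that side
  (\<open>sukp_opt_greatest\<close>, \<open>sukp_opt_least\<close>). The two halves of the guarantee
  need different inductions. A factor must not be paid once per type, so the lower bound doubles all
  types together, level by level; each rounding keeps at least (1 - \<eta>) / (1 + \<eta>) \<ge> 1 -
  2 \<eta>, and \<eta> * log 2 W = \<epsilon> / 10 keeps the product above 1 - \<epsilon>. The upper
  bound loses only additively, so there the doublings are undone one type at a time, and their extra
  costs form a geometric sum. The optimum is at most 4 T, and everything together raises the value
  to be reached by at most 3 / 2; hence K \<ge> 6 for an output to exist. With \<epsilon> = 1 / s^2
  the half-integral powers of 1 / \<epsilon> become integral powers of s; in particular \<zeta> =
  O((log 2 W)^2 * s^3).\<close>

definition expect_rest :: "nat pmf \<Rightarrow> (nat \<Rightarrow> real) \<Rightarrow> nat \<Rightarrow> real" where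
  "expect_rest p h w = measure_pmf.expectation p (\<lambda>k. h (w - k))"

definition indep_sum :: "nat pmf \<Rightarrow> nat pmf \<Rightarrow> nat pmf" where
  "indep_sum p q = map_pmf (\<lambda>(a, b). a + b) (pair_pmf p q)"

text \<open>Truncated subtraction leaves only the values \<open>h 0\<close>, ...,
  \<open>h w\<close>, so the integrand is bounded.\<close>

lemma integrable_expect_rest:
  fixes h :: "nat \<Rightarrow> real"
  shows "integrable (measure_pmf p) (\<lambda>k. h (w - k))"
proof (rule measure_pmf.integrable_const_bound)
  show "AE k in measure_pmf p. norm (h (w - k)) \<le> (\<Sum>x\<le>w. \<bar>h x\<bar>)"
    by (rule AE_I2) (auto intro!: member_le_sum)
qed auto

lemma expect_rest_mono:
  assumes "\<And>k. k \<in> set_pmf p \<Longrightarrow> h (w - k) \<le> h' (w - k)"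
  shows "expect_rest p h w \<le> expect_rest p h' w"
  unfolding expect_rest_def
  by (intro integral_mono_AE integrable_expect_rest) (use assms in \<open>auto simp: AE_measure_pmf_iff\<close>)

text \<open>A positive weight strictly decreases the remaining capacity; this is what makes strong
  induction on \<open>w\<close> work below.\<close>

lemma expect_rest_mono_less:
  assumes "0 \<notin> set_pmf p" "1 \<le> w" "\<And>x. x < w \<Longrightarrow> h x \<le> h' x"
  shows "expect_rest p h w \<le> expect_rest p h' w"
proof (rule expect_rest_mono)
  fix k assume "k \<in> set_pmf p"
  then have "k \<noteq> 0" using assms(1) by metis
  then show "h (w - k) \<le> h' (w - k)" using assms(2) by (intro assms(3)) auto
qed

lemma expect_rest_add_const: "expect_rest p (\<lambda>x. h x + a) w = expect_rest p h w + a"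
  unfolding expect_rest_def by (subst Bochner_Integration.integral_add) (auto simp: integrable_expect_rest)

lemma expect_rest_cmult: "expect_rest p (\<lambda>x. a * h x) w = a * expect_rest p h w"
  by (simp add: expect_rest_def)

lemma expect_rest_const: "expect_rest p (\<lambda>_. a) w = a"
  by (simp add: expect_rest_def)

lemma expect_rest_0: "expect_rest p h 0 = h 0"
  by (simp add: expect_rest_def)

lemma telescope_diff:
  fixes h :: "nat \<Rightarrow> real"
  assumes "a \<le> b"
  shows "(\<Sum>x=a..<b. h (Suc x) - h x) = h b - h a"
  using assms by (induction b rule: dec_induct) auto

text \<open>Summation by parts: the expectation depends on the weight distribution only through its
  tail array, and monotonically so if \<open>h\<close> is non-decreasing.\<close>

lemma expect_rest_tail: "expect_rest p h w = h w - (\<Sum>x<w. (h (Suc x) - h x) * Dist p (w - x))"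
proof -
  \<comment> \<open>\<open>h w - h (w - k)\<close> telescopes over \<open>x\<close> from
    \<open>w - k\<close> to \<open>w - 1\<close>, and \<open>w - k \<le> x\<close> is the tail event
    \<open>w - x \<le> k\<close>.\<close>
  have *: "h (w - k) = h w - (\<Sum>x<w. (h (Suc x) - h x) * indicator {w - x..} k)" for k
  proof -
    have "(\<Sum>x<w. (h (Suc x) - h x) * indicator {w - x..} k) = (\<Sum>x=w-k..<w. h (Suc x) - h x)"
      by (rule sum.mono_neutral_cong_right) (auto simp: indicator_def)
    then show ?thesis by (simp add: telescope_diff)
  qed
  have int: "integrable (measure_pmf p) (\<lambda>k. (h (Suc x) - h x) * indicator {w - x..} k)" for x
    by (intro integrable_mult_right measure_pmf.integrable_const_bound[where B = 1])
      (auto simp: indicator_def)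
  have "expect_rest p h w = measure_pmf.expectation p
      (\<lambda>k. h w - (\<Sum>x<w. (h (Suc x) - h x) * indicator {w - x..} k))"
    unfolding expect_rest_def by (subst *) rule
  also have "\<dots> = h w - (\<Sum>x<w. (h (Suc x) - h x) * Dist p (w - x))"
    by (subst Bochner_Integration.integral_diff)
       (auto simp: Bochner_Integration.integral_sum[OF int] Dist_def
             simp del: sum_mult_indicator
             intro!: Bochner_Integration.integrable_sum int)
  finally show ?thesis .
qed

text \<open>The increments of \<open>h\<close> are the non-negative coefficients of the tails in
  \<open>expect_rest_tail\<close>: a stochastically heavier item leaves less to pay.\<close>

lemma expect_rest_antimono_tail:
  assumes "mono_on {..w} h" "\<And>j. j \<in> {1..w} \<Longrightarrow> Dist p j \<le> Dist q j"
  shows "expect_rest q h w \<le> expect_rest p h w"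
proof -
  have "(\<Sum>x<w. (h (Suc x) - h x) * Dist p (w - x)) \<le> (\<Sum>x<w. (h (Suc x) - h x) * Dist q (w - x))"
    using assms(2) monotone_onD[OF assms(1)] by (intro sum_mono mult_left_mono) auto
  then show ?thesis by (simp add: expect_rest_tail)
qed

text \<open>\<open>w - (a + b) = (w - a) - b\<close> survives truncation, so a pair may be inserted
  one item after the other.\<close>

lemma expect_rest_indep_sum:
  assumes "finite (set_pmf p)" "finite (set_pmf q)"
  shows "expect_rest (indep_sum p q) h w = expect_rest p (expect_rest q h) w"
proof -
  have "expect_rest (indep_sum p q) h w
      = measure_pmf.expectation (p \<bind> (\<lambda>a. map_pmf (\<lambda>b. a + b) q)) (\<lambda>k. h (w - k))"
    by (simp add: expect_rest_def indep_sum_def pair_pmf_def map_bind_pmf map_pmf_def [symmetric]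
        bind_return_pmf bind_assoc_pmf) (simp add: map_pmf_def bind_assoc_pmf bind_return_pmf)
  also have "\<dots> = (\<Sum>a\<in>set_pmf p. pmf p a * expect_rest q h (w - a))"
    using assms by (subst pmf_expectation_bind[of "set_pmf p"]) (auto simp: expect_rest_def)
  also have "\<dots> = expect_rest p (expect_rest q h) w"
    unfolding expect_rest_def [of p]
    using assms by (subst integral_measure_pmf_real[of "set_pmf p"]) (auto simp: mult.commute)
  finally show ?thesis .
qed

text \<open>Needed to postpone the use of an item held in reserve.\<close>

lemma expect_rest_commute:
  assumes "finite (set_pmf p)" "finite (set_pmf q)"
  shows "expect_rest p (expect_rest q h) w = expect_rest q (expect_rest p h) w"
proof -
  have "indep_sum p q = indep_sum q p"
    unfolding indep_sum_def
    by (subst pair_commute_pmf) (simp add: pmf.map_comp o_def case_prod_unfold add.commute)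
  then show ?thesis using assms by (metis expect_rest_indep_sum)
qed

lemma set_indep_sum: "set_pmf (indep_sum p q) = {a + b | a b. a \<in> set_pmf p \<and> b \<in> set_pmf q}"
  by (auto simp: indep_sum_def image_def)

section \<open>The optimality equation\<close>

text \<open>Weights may exceed \<open>W\<close> here, because the unrounded sum of two blocks
  does.\<close>

definition item_family :: "nat \<Rightarrow> (nat \<Rightarrow> real) \<Rightarrow> (nat \<Rightarrow> nat pmf) \<Rightarrow> bool" where
  "item_family n c X \<longleftrightarrow> 1 \<le> n \<and> (\<forall>i<n. 0 < c i \<and> 0 \<notin> set_pmf (X i) \<and> finite (set_pmf (X i)))"

lemma sukp_opt_0 [simp]: "sukp_opt n W c X 0 = 0"
  by (simp add: sukp_opt.simps)

text \<open>The recursion of \<open>sukp_opt\<close> sums over {1..W} only. Nothing is lost: 0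
  carries no mass, and every \<open>k \<ge> w\<close> leads to \<open>h 0 = 0\<close>.\<close>

lemma expect_rest_sum:
  assumes "h 0 = 0" "0 \<notin> set_pmf p" "w \<le> W"
  shows "(\<Sum>k=1..W. pmf p k * h (w - k)) = expect_rest p h w"
proof -
  have "k \<in> {1..W}" if "k \<in> set_pmf p" "h (w - k) \<noteq> 0" for k
  proof -
    have "k \<noteq> 0" using assms(2) that by metis
    moreover have "\<not> w \<le> k" using that(2) assms(1) by (auto)
    ultimately show ?thesis using assms(3) by auto
  qed
  then show ?thesis
    unfolding expect_rest_def by (subst integral_measure_pmf_real[of "{1..W}"]) (auto simp: mult.commute)
qed

context
  fixes n W :: nat and c :: "nat \<Rightarrow> real" and X :: "nat \<Rightarrow> nat pmf"
  assumes fam: "item_family n c X"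
begin

lemma sukp_opt_eq:
  assumes "1 \<le> w" "w \<le> W"
  shows "sukp_opt n W c X w = Min ((\<lambda>i. c i + expect_rest (X i) (sukp_opt n W c X) w) ` {..<n})"
proof -
  have "(\<Sum>k=1..W. pmf (X i) k * sukp_opt n W c X (w - k)) = expect_rest (X i) (sukp_opt n W c X) w"
    if "i < n" for i
    using fam that assms by (intro expect_rest_sum) (auto simp: item_family_def)
  then show ?thesis
    using assms by (subst sukp_opt.simps) (auto intro!: arg_cong[where f = Min])
qed

lemma sukp_opt_le:
  assumes "1 \<le> w" "w \<le> W" "i < n"
  shows "sukp_opt n W c X w \<le> c i + expect_rest (X i) (sukp_opt n W c X) w"
  unfolding sukp_opt_eq[OF assms(1,2)] using assms by (intro Min_le) auto

lemma sukp_opt_attained: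
  assumes "1 \<le> w" "w \<le> W"
  obtains i where "i < n" "sukp_opt n W c X w = c i + expect_rest (X i) (sukp_opt n W c X) w"
proof -
  have "Min ((\<lambda>i. c i + expect_rest (X i) (sukp_opt n W c X) w) ` {..<n})
      \<in> (\<lambda>i. c i + expect_rest (X i) (sukp_opt n W c X) w) ` {..<n}"
    using fam by (intro Min_in) (auto simp: item_family_def lessThan_empty_iff)
  then show ?thesis
    using that unfolding sukp_opt_eq[OF assms, symmetric] by auto
qed

text \<open>Comparison principle for subsolutions: the item that attains the optimum is also
  available to \<open>U\<close>, and all later values concern smaller capacities, where induction
  applies.\<close>

lemma sukp_opt_greatest:
  assumes "U 0 \<le> 0" "\<And>w i. 1 \<le> w \<Longrightarrow> w \<le> W \<Longrightarrow> i < n \<Longrightarrow> U w \<le> c i + expect_rest (X i) U w"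
  shows "w \<le> W \<Longrightarrow> U w \<le> sukp_opt n W c X w"
proof (induction w rule: less_induct)
  case (less w)
  show ?case
  proof (cases "w = 0")
    case False
    then obtain i where i: "i < n" "sukp_opt n W c X w = c i + expect_rest (X i) (sukp_opt n W c X) w"
      using sukp_opt_attained[of w] less.prems by (metis One_nat_def Suc_leI gr0I)
    have "U w \<le> c i + expect_rest (X i) U w" using assms(2)[of w i] False less.prems i by simp
    also have "expect_rest (X i) U w \<le> expect_rest (X i) (sukp_opt n W c X) w"
      using fam i False less by (intro expect_rest_mono_less) (auto simp: item_family_def)
    finally show ?thesis using i by simp
  qed (use assms in simp)
qed

text \<open>Dual principle for supersolutions. The item chosen for each \<open>w\<close> amounts to
  a stationary policy whose cost \<open>U\<close> dominates.\<close>

lemma sukp_opt_least: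
  assumes "0 \<le> U 0" "\<And>w. 1 \<le> w \<Longrightarrow> w \<le> W \<Longrightarrow> \<exists>i<n. c i + expect_rest (X i) U w \<le> U w"
  shows "w \<le> W \<Longrightarrow> sukp_opt n W c X w \<le> U w"
proof (induction w rule: less_induct)
  case (less w)
  show ?case
  proof (cases "w = 0")
    case False
    then obtain i where i: "i < n" "c i + expect_rest (X i) U w \<le> U w"
      using assms(2)[of w] less.prems by auto
    have "sukp_opt n W c X w \<le> c i + expect_rest (X i) (sukp_opt n W c X) w"
      using False less.prems i by (intro sukp_opt_le) auto
    also have "expect_rest (X i) (sukp_opt n W c X) w \<le> expect_rest (X i) U w"
      using fam i False less by (intro expect_rest_mono_less) (auto simp: item_family_def)
    finally show ?thesis using i by simp
  qed (use assms in simp)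
qed

lemma sukp_opt_nonneg: "w \<le> W \<Longrightarrow> 0 \<le> sukp_opt n W c X w"
  using sukp_opt_greatest[of "\<lambda>_. 0"] fam by (force simp: item_family_def expect_rest_const)

lemma sukp_opt_pos:
  assumes "1 \<le> w" "w \<le> W"
  shows "0 < sukp_opt n W c X w"
proof -
  obtain i where i: "i < n" "sukp_opt n W c X w = c i + expect_rest (X i) (sukp_opt n W c X) w"
    using sukp_opt_attained assms by metis
  have "expect_rest (X i) (\<lambda>_. 0) w \<le> expect_rest (X i) (sukp_opt n W c X) w"
    using assms by (intro expect_rest_mono sukp_opt_nonneg) auto
  then show ?thesis using i fam by (simp add: expect_rest_const item_family_def add_pos_nonneg)
qed

lemma sukp_opt_mono: "mono_on {..W} (sukp_opt n W c X)"
proof -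
  have step: "sukp_opt n W c X (w - 1) \<le> sukp_opt n W c X w" if "w \<le> W" for w
  proof (rule sukp_opt_greatest[OF _ _ that])
    fix w i assume w: "1 \<le> w" "w \<le> W" "i < n"
    have expect_rest: "expect_rest (X i) (\<lambda>w. sukp_opt n W c X (w - 1)) w = expect_rest (X i) (sukp_opt n W c X) (w - 1)"
      by (simp add: expect_rest_def diff_commute)
    show "sukp_opt n W c X (w - 1) \<le> c i + expect_rest (X i) (\<lambda>w. sukp_opt n W c X (w - 1)) w"
    proof (cases "w = 1")
      case True
      then show ?thesis using fam w expect_rest by (simp add: expect_rest_0 item_family_def less_imp_le)
    next
      case False
      then show ?thesis unfolding expect_rest using w by (intro sukp_opt_le) auto
    qed
  qed auto
  have "sukp_opt n W c X v \<le> sukp_opt n W c X w" if "v \<le> w" "w \<le> W" for v w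
    using that
  proof (induction w rule: dec_induct)
    case (step k)
    then show ?case using \<open>\<And>w. w \<le> W \<Longrightarrow> _\<close>[of "Suc k"] by simp
  qed auto
  then show ?thesis by (auto intro!: monotone_onI)
qed

text \<open>Every item weighs at least 1, so \<open>w\<close> copies of one type always suffice.
  This turns additive tail errors into a multiple of \<open>c i\<close>.\<close>

lemma sukp_opt_le_mult:
  assumes "i < n" "w \<le> W"
  shows "sukp_opt n W c X w \<le> real w * c i"
proof (rule sukp_opt_least[OF _ _ assms(2)])
  fix w assume w: "1 \<le> w" "w \<le> W"
  have pos: "0 < c i" using fam assms by (simp add: item_family_def)
  have "expect_rest (X i) (\<lambda>w. real w * c i) w \<le> expect_rest (X i) (\<lambda>_. real (w - 1) * c i) w"
    using fam assms w pos by (intro expect_rest_mono_less) (auto simp: item_family_def)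
  then show "\<exists>j<n. c j + expect_rest (X j) (\<lambda>w. real w * c i) w \<le> real w * c i"
    using assms w by (intro exI[of _ i]) (simp add: expect_rest_const algebra_simps of_nat_diff)
qed auto

end

section \<open>Comparing optima\<close>

text \<open>An additive error \<open>\<eta> / W\<close> in the tail probabilities changes the expected cost of the
  remaining capacity by at most \<open>\<eta> / W\<close> times an optimum, which is at most \<open>W c i\<close>.\<close>

lemma sukp_opt_tail_scaling:
  assumes X: "item_family n c X" and Y: "item_family n c Y"
    and tail: "\<And>i j. i < n \<Longrightarrow> j \<in> {1..W} \<Longrightarrow> Dist (Y i) j \<le> (1 + \<eta>) * Dist (X i) j + \<eta> / real W"
    and eta: "0 < \<eta>" "\<eta> < 1" and w: "w \<le> W"
  shows "sukp_opt n W c X w \<le> (1 + \<eta>) / (1 - \<eta>) * sukp_opt n W c Y w"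
proof (rule sukp_opt_least[OF X _ _ w])
  fix w assume w: "1 \<le> w" "w \<le> W"
  let ?V = "sukp_opt n W c Y"
  obtain i where i: "i < n" "?V w = c i + expect_rest (Y i) ?V w"
    using sukp_opt_attained[OF Y] w by metis
  define S where "S p = (\<Sum>x<w. (?V (Suc x) - ?V x) * Dist p (w - x))" for p
  have expect_rest: "expect_rest p ?V w = ?V w - S p" for p by (simp add: expect_rest_tail S_def)
  have "S (Y i) \<le> (\<Sum>x<w. (?V (Suc x) - ?V x) * ((1 + \<eta>) * Dist (X i) (w - x) + \<eta> / real W))"
    unfolding S_def using w i monotone_onD[OF sukp_opt_mono[OF Y]]
    by (intro sum_mono mult_left_mono tail) auto
  also have "\<dots> = (1 + \<eta>) * S (X i) + (\<Sum>x<w. ?V (Suc x) - ?V x) * (\<eta> / real W)"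
    by (simp add: S_def sum_distrib_left sum_distrib_right distrib_left sum.distrib mult_ac)
  also have "(\<Sum>x<w. ?V (Suc x) - ?V x) = ?V w" by (subst sum_lessThan_telescope) simp
  also have "?V w * (\<eta> / real W) \<le> (real w * c i) * (\<eta> / real W)"
    using sukp_opt_le_mult[OF Y i(1) w(2)] eta by (intro mult_right_mono) auto
  also have "\<dots> \<le> \<eta> * c i"
    using w eta Y i by (simp add: item_family_def field_simps)
  \<comment> \<open>The optimality equation at the minimizing item says
    \<open>S (Y i) = c i\<close>: its cost equals the expected drop of the value. Only this drop has
    to be transferred to \<open>X i\<close>.\<close>
  finally have "(1 - \<eta>) * c i \<le> (1 + \<eta>) * S (X i)"
    using i expect_rest[of "Y i"] by (simp add: algebra_simps)
  then have "c i \<le> (1 + \<eta>) / (1 - \<eta>) * S (X i)"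
    using eta by (simp add: field_simps)
  then show "\<exists>i<n. c i + expect_rest (X i) (\<lambda>w. (1 + \<eta>) / (1 - \<eta>) * ?V w) w \<le> (1 + \<eta>) / (1 - \<eta>) * ?V w"
    using i by (intro exI[of _ i]) (simp only: expect_rest_cmult expect_rest, simp add: algebra_simps)
qed simp

text \<open>A pair can be imitated by two single purchases. The one-item inequality is needed at 0
  as well, since the second item of a pair is paid for even when the first has filled the
  knapsack.\<close>

lemma sukp_opt_le_pairs:
  assumes X: "item_family n c X" and Y: "item_family n d Y"
    and YX: "\<And>i. i < n \<Longrightarrow> d i = c i \<and> Y i = X i \<or> d i = 2 * c i \<and> Y i = indep_sum (X i) (X i)"
    and w: "w \<le> W"
  shows "sukp_opt n W c X w \<le> sukp_opt n W d Y w"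
proof (rule sukp_opt_greatest[OF Y _ _ w])
  fix w i assume w: "1 \<le> w" "w \<le> W" "i < n"
  let ?U = "sukp_opt n W c X"
  have le: "?U x \<le> c i + expect_rest (X i) ?U x" if "x \<le> w" for x
    using sukp_opt_le[OF X, of x W i] X w that
    by (cases "x = 0") (auto simp: expect_rest_0 item_family_def less_imp_le)
  show "?U w \<le> d i + expect_rest (Y i) ?U w"
  proof (cases "d i = c i \<and> Y i = X i")
    case False
    then have d: "d i = 2 * c i" "Y i = indep_sum (X i) (X i)" using YX w by blast+
    have "?U w \<le> c i + expect_rest (X i) ?U w" by (simp add: le)
    also have "expect_rest (X i) ?U w \<le> expect_rest (X i) (\<lambda>x. expect_rest (X i) ?U x + c i) w"
      by (intro expect_rest_mono) (use le in \<open>simp add: add.commute\<close>)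
    also have "\<dots> = expect_rest (X i) (expect_rest (X i) ?U) w + c i" by (rule expect_rest_add_const)
    also have "expect_rest (X i) (expect_rest (X i) ?U) w = expect_rest (Y i) ?U w"
      using X w d by (simp add: expect_rest_indep_sum item_family_def)
    finally show ?thesis using d by simp
  qed (use le in auto)
qed simp

text \<open>A policy for the single items is simulated with the pairs of type \<open>p\<close> by keeping the unused
  item of the last pair in reserve.  The second claim is the bound for a full reserve.\<close>

lemma sukp_opt_pairs_le:
  assumes X: "item_family n c X" and Y: "item_family n (c(p := 2 * c p)) (X(p := Z))"
    and p: "p < n"
    and tail: "\<And>j. j \<in> {1..W} \<Longrightarrow> Dist (indep_sum (X p) (X p)) j \<le> Dist Z j"
    and w: "w \<le> W"
  shows "sukp_opt n W (c(p := 2 * c p)) (X(p := Z)) w \<le> sukp_opt n W c X w + c p"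
proof -
  let ?O = "sukp_opt n W c X" and ?V = "sukp_opt n W (c(p := 2 * c p)) (X(p := Z))"
  have fin: "finite (set_pmf (X i))" "0 \<notin> set_pmf (X i)" "0 < c i" if "i < n" for i
    using X that by (auto simp: item_family_def)
  have "?V w \<le> ?O w + c p \<and> expect_rest (X p) ?V w \<le> ?O w" using w
  proof (induction w rule: less_induct)
    case (less w)
    show ?case
    proof (cases "w = 0")
      case True
      then show ?thesis using fin[OF p] by (simp add: expect_rest_0)
    next
      case False
      then obtain j where j: "j < n" "?O w = c j + expect_rest (X j) ?O w"
        using sukp_opt_attained[OF X, of w W] less.prems by (metis One_nat_def Suc_leI gr0I)
      have IH1: "?V x \<le> ?O x + c p" and IH2: "expect_rest (X p) ?V x \<le> ?O x" if "x < w" for x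
        using less.IH[of x] less.prems that by (simp_all del: fun_upd_apply)
      have V: "?V x \<le> c i + expect_rest (X i) ?V x" if "x \<le> w" "i < n" "i \<noteq> p" for x i
        using sukp_opt_le[OF Y, of x W i] fin[of i] less.prems that
        by (cases "x = 0") (auto simp: expect_rest_0 less_imp_le)
      have 1: "?V w \<le> ?O w + c p"
      proof (cases "j = p")
        case True
        \<comment> \<open>Empty reserve: a pair is bought. One \<open>c p\<close> is matched by the
          optimum, the other is the slack; after the first item the reserve is full and the second
          induction hypothesis applies.\<close>
        have "?V w \<le> 2 * c p + expect_rest Z ?V w"
          using sukp_opt_le[OF Y, of w W p] False less.prems p by simp
        also have "expect_rest Z ?V w \<le> expect_rest (indep_sum (X p) (X p)) ?V w"
          using less.prems tail
          by (intro expect_rest_antimono_tail monotone_on_subset[OF sukp_opt_mono[OF Y]]) auto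
        also have "\<dots> = expect_rest (X p) (expect_rest (X p) ?V) w" by (simp add: expect_rest_indep_sum fin p)
        also have "\<dots> \<le> expect_rest (X p) ?O w"
          using False IH2 fin p by (intro expect_rest_mono_less) auto
        finally show ?thesis using j True by (simp del: fun_upd_apply)
      next
        case np: False
        have "?V w \<le> c j + expect_rest (X j) ?V w" using V[of w j] j np by simp
        also have "expect_rest (X j) ?V w \<le> expect_rest (X j) (\<lambda>x. ?O x + c p) w"
          using False IH1 fin j by (intro expect_rest_mono_less) auto
        finally show ?thesis using j by (simp add: expect_rest_add_const)
      qed
      have 2: "expect_rest (X p) ?V w \<le> ?O w"
      proof (cases "j = p")
        case True
        \<comment> \<open>Full reserve: the item is already paid for, so the \<open>c p\<close>
          saved restores the slack of the first claim.\<close>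
        have "expect_rest (X p) ?V w \<le> expect_rest (X p) (\<lambda>x. ?O x + c p) w"
          using False IH1 fin p by (intro expect_rest_mono_less) auto
        then show ?thesis using j True by (simp add: expect_rest_add_const)
      next
        case np: False
        \<comment> \<open>The reserved item is drawn first here; commuting it past the item of type
          \<open>j\<close> leaves it in reserve at a smaller capacity.\<close>
        have "expect_rest (X p) ?V w \<le> expect_rest (X p) (\<lambda>x. expect_rest (X j) ?V x + c j) w"
          by (intro expect_rest_mono) (use V[of _ j] j np in \<open>simp add: add.commute\<close>)
        also have "\<dots> = expect_rest (X j) (expect_rest (X p) ?V) w + c j"
          using fin j p by (simp add: expect_rest_add_const expect_rest_commute)
        also have "expect_rest (X j) (expect_rest (X p) ?V) w \<le> expect_rest (X j) ?O w"
          using False IH2 fin j by (intro expect_rest_mono_less) auto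
        finally show ?thesis using j by simp
      qed
      from 1 2 show ?thesis by (rule conjI)
    qed
  qed
  then show ?thesis by (rule conjunct1)
qed

section \<open>Bounds on the optimum\<close>

lemma integrable_pmf_bounded_support:
  fixes f :: "nat \<Rightarrow> real"
  assumes "set_pmf p \<subseteq> {1..W}"
  shows "integrable (measure_pmf p) f"
  using finite_subset[OF assms] by (intro integrable_measure_pmf_finite) auto

text \<open>If every type costs at least \<open>r\<close> per unit of expected weight, the line of
  slope \<open>r\<close> is a subsolution: truncating an overshoot at 0 only raises it.\<close>

lemma sukp_opt_ge_linear:
  assumes X: "item_family n c X" and supp: "\<And>i. i < n \<Longrightarrow> set_pmf (X i) \<subseteq> {1..W}"
    and r: "0 \<le> r" "\<And>i. i < n \<Longrightarrow> r * measure_pmf.expectation (X i) real \<le> c i" and w: "w \<le> W"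
  shows "r * real w \<le> sukp_opt n W c X w"
proof (rule sukp_opt_greatest[OF X _ _ w])
  fix w i assume w: "1 \<le> w" "w \<le> W" "i < n"
  note int = integrable_pmf_bounded_support[OF supp[OF w(3)]]
  have "measure_pmf.expectation (X i) (\<lambda>k. r * real w - r * real k) \<le> expect_rest (X i) (\<lambda>w. r * real w) w"
    unfolding expect_rest_def
    by (intro integral_mono int) (use r(1) in \<open>auto simp flip: right_diff_distrib intro!: mult_left_mono\<close>)
  also have "measure_pmf.expectation (X i) (\<lambda>k. r * real w - r * real k)
      = r * real w - r * measure_pmf.expectation (X i) real"
    by (subst Bochner_Integration.integral_diff) (auto intro: int)
  finally show "r * real w \<le> c i + expect_rest (X i) (\<lambda>w. r * real w) w" using r(2)[OF w(3)] by simp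
qed simp

text \<open>The last item overshoots by less than \<open>W\<close>.\<close>

lemma sukp_opt_le_linear:
  assumes X: "item_family n c X" and i: "i < n" and supp: "set_pmf (X i) \<subseteq> {1..W}"
    and r: "0 \<le> r" "c i \<le> r * measure_pmf.expectation (X i) real" and w: "1 \<le> w" "w \<le> W"
  shows "sukp_opt n W c X w \<le> r * (real w + real W)"
proof -
  \<comment> \<open>Before completion the offset \<open>r * W\<close> is kept as a deposit. Dropping
    it at 0 is harmless because the last weight is at most \<open>W\<close>.\<close>
  define U where "U w = (if w = 0 then 0 else r * (real w + real W))" for w
  note int = integrable_pmf_bounded_support[OF supp]
  have "sukp_opt n W c X w \<le> U w"
  proof (rule sukp_opt_least[OF X _ _ w(2)])
    fix w assume w: "1 \<le> w" "w \<le> W"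
    have "U (w - k) \<le> r * (real w + real W) - r * real k" if "k \<in> set_pmf (X i)" for k
    proof -
      have k: "k \<le> W" using supp that by auto
      show ?thesis
      proof (cases "k < w")
        case True
        then show ?thesis by (simp add: U_def of_nat_diff algebra_simps)
      next
        case False
        have "r * real k \<le> r * (real w + real W)" using k r by (intro mult_left_mono) auto
        then show ?thesis using False by (simp add: U_def)
      qed
    qed
    then have "expect_rest (X i) U w \<le> measure_pmf.expectation (X i) (\<lambda>k. r * (real w + real W) - r * real k)"
      unfolding expect_rest_def by (intro integral_mono_AE int) (auto simp: AE_measure_pmf_iff)
    also have "\<dots> = r * (real w + real W) - r * measure_pmf.expectation (X i) real"
      by (subst Bochner_Integration.integral_diff) (auto intro: int)
    finally show "\<exists>i<n. c i + expect_rest (X i) U w \<le> U w"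
      using i r w by (intro exI[of _ i]) (simp add: U_def)
  qed (simp add: U_def)
  then show ?thesis using w by (simp add: U_def)
qed

lemma powi_floor_log_bounds:
  assumes "1 \<le> j"
  shows "2 powi \<lfloor>log 2 (real j)\<rfloor> \<le> real j" "real j \<le> 2 * 2 powi \<lfloor>log 2 (real j)\<rfloor>"
    "1 \<le> (2 :: real) powi \<lfloor>log 2 (real j)\<rfloor>"
proof -
  have j: "2 powr (log 2 (real j)) = real j" using assms by simp
  have e: "(2 :: real) powi \<lfloor>log 2 (real j)\<rfloor> = 2 powr \<lfloor>log 2 (real j)\<rfloor>"
    by (simp add: powr_real_of_int')
  show "2 powi \<lfloor>log 2 (real j)\<rfloor> \<le> real j"
    unfolding e by (subst j[symmetric], intro powr_mono) auto
  have "real j \<le> 2 powr (\<lfloor>log 2 (real j)\<rfloor> + 1)"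
    by (subst j[symmetric], intro powr_mono) (auto intro: less_imp_le)
  then show "real j \<le> 2 * 2 powi \<lfloor>log 2 (real j)\<rfloor>" unfolding e by (simp add: powr_add)
  show "1 \<le> (2 :: real) powi \<lfloor>log 2 (real j)\<rfloor>"
    unfolding e using assms by (intro ge_one_powr_ge_zero) auto
qed

lemma rounded_mean_bounds:
  assumes "set_pmf p \<subseteq> {1..W}"
  shows "rounded_mean W p \<le> measure_pmf.expectation p real"
    "measure_pmf.expectation p real \<le> 2 * rounded_mean W p" "1 \<le> rounded_mean W p"
proof -
  have E: "measure_pmf.expectation p real = (\<Sum>j=1..W. pmf p j * real j)"
    using assms by (subst integral_measure_pmf_real[of "{1..W}"]) (auto simp: mult.commute)
  have 1: "(\<Sum>j=1..W. pmf p j) = 1" using assms by (intro sum_pmf_eq_1) auto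
  show "rounded_mean W p \<le> measure_pmf.expectation p real"
    unfolding E rounded_mean_def by (intro sum_mono mult_left_mono powi_floor_log_bounds) auto
  show "measure_pmf.expectation p real \<le> 2 * rounded_mean W p"
    unfolding E rounded_mean_def sum_distrib_left
    by (intro sum_mono) (subst mult.left_commute, intro mult_left_mono powi_floor_log_bounds, auto)
  have "(\<Sum>j=1..W. pmf p j * 1) \<le> rounded_mean W p"
    unfolding rounded_mean_def by (intro sum_mono mult_left_mono powi_floor_log_bounds) auto
  then show "1 \<le> rounded_mean W p" using 1 by simp
qed

lemma min_sukp_item_family: "min_sukp n W c X \<Longrightarrow> item_family n c X"
  unfolding min_sukp_def item_family_def
  by (metis atLeastAtMost_iff finite_atLeastAtMost finite_subset not_one_le_zero subsetD)

text \<open>The factor 4 is 2 * 2. The rounded mean is within a factor 2 of the true mean, so the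
  best price per unit weight lies between \<open>r / 2\<close> and \<open>r\<close>; the overshoot
  at most doubles the weight to be paid for. The last claim, from a rounded mean of at least 1,
  later bounds the exponents.\<close>

lemma T_par_bounds:
  assumes "min_sukp n W c X"
  shows "0 < T_par n W c X" "T_par n W c X \<le> sukp_opt n W c X W"
    "sukp_opt n W c X W \<le> 4 * T_par n W c X" "\<And>i. i < n \<Longrightarrow> T_par n W c X \<le> real W / 2 * c i"
proof -
  define r where "r = Min ((\<lambda>i. c i / rounded_mean W (X i)) ` {..<n})"
  have T: "T_par n W c X = real W / 2 * r" by (simp add: T_par_def r_def)
  have n: "1 \<le> n" and W: "2 \<le> W" and c: "\<And>i. i < n \<Longrightarrow> 0 < c i"
    and supp: "\<And>i. i < n \<Longrightarrow> set_pmf (X i) \<subseteq> {1..W}"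
    using assms by (auto simp: min_sukp_def)
  note fam = min_sukp_item_family[OF assms]
  note rm = rounded_mean_bounds[OF supp]
  have "r \<in> (\<lambda>i. c i / rounded_mean W (X i)) ` {..<n}"
    unfolding r_def using n by (intro Min_in) (auto simp: lessThan_empty_iff)
  then obtain i where i: "i < n" "r = c i / rounded_mean W (X i)" by auto
  have r: "r \<le> c i / rounded_mean W (X i)" if "i < n" for i
    unfolding r_def using that by (intro Min_le) auto
  have rpos: "0 < r" using i c[OF i(1)] rm(3)[OF i(1)] by simp
  show "0 < T_par n W c X" using rpos W by (simp add: T)
  have "r / 2 * measure_pmf.expectation (X i) real \<le> c i" if "i < n" for i
  proof -
    have "r / 2 * measure_pmf.expectation (X i) real \<le> r / 2 * (2 * rounded_mean W (X i))"
      using rm(2)[OF that] rpos by (intro mult_left_mono) auto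
    also have "\<dots> \<le> c i" using r[OF that] rm(3)[OF that] by (simp add: field_simps)
    finally show ?thesis .
  qed
  then have "r / 2 * real W \<le> sukp_opt n W c X W"
    using rpos by (intro sukp_opt_ge_linear[OF fam supp]) auto
  then show "T_par n W c X \<le> sukp_opt n W c X W" by (simp add: T algebra_simps)
  have "c i = r * rounded_mean W (X i)" using i rm(3)[OF i(1)] by simp
  also have "\<dots> \<le> r * measure_pmf.expectation (X i) real"
    using rm(1)[OF i(1)] rpos by (intro mult_left_mono) auto
  finally have "sukp_opt n W c X W \<le> r * (real W + real W)"
    using rpos W by (intro sukp_opt_le_linear[OF fam i(1) supp[OF i(1)]]) auto
  then show "sukp_opt n W c X W \<le> 4 * T_par n W c X" by (simp add: T algebra_simps)
  show "T_par n W c X \<le> real W / 2 * c i" if "i < n" for i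
  proof -
    have "r \<le> c i / rounded_mean W (X i)" by (rule r[OF that])
    also have "\<dots> \<le> c i / 1" using rm(3)[OF that] c[OF that] by (intro divide_left_mono) auto
    finally show ?thesis by (simp add: T mult_left_mono)
  qed
qed

text \<open>The first claim links the specification to the expression evaluated by the timed
  algorithm. The third bounds the extra cost c + 2 c + ... + 2^(k-1) c of all doublings of one type,
  including the case of none.\<close>

lemma block_exponent_bounds:
  assumes "0 < t" "0 < c"
  shows "block_exponent t c = nat \<lceil>log 2 (t / c)\<rceil>"
    and "t \<le> c * 2 ^ block_exponent t c"
    and "c * (2 ^ block_exponent t c - 1) \<le> 2 * t"
    and "0 < block_exponent t c \<Longrightarrow> c * 2 ^ block_exponent t c \<le> 2 * t"
proof -
  have ub: "c * 2 ^ k \<ge> t \<longleftrightarrow> log 2 (t / c) \<le> real k" for k :: nat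
    using assms by (simp add: log_le_iff powr_realpow field_simps)
  have 1: "block_exponent t c = nat \<lceil>log 2 (t / c)\<rceil> \<and> t \<le> c * 2 ^ block_exponent t c \<and>
      (0 < block_exponent t c \<longrightarrow> c * 2 ^ block_exponent t c \<le> 2 * t)"
  proof (cases "t \<le> c")
    case True
    then show ?thesis using ub[of 0] by (simp add: block_exponent_def)
  next
    case False
    define k where "k = nat \<lceil>log 2 (t / c)\<rceil>"
    have pos: "0 < log 2 (t / c)" using False assms by simp
    have k1: "log 2 (t / c) \<le> real k" unfolding k_def by (rule real_nat_ceiling_ge)
    have k2: "real k < log 2 (t / c) + 1" unfolding k_def using pos by linarith
    have kp: "0 < k" using k1 pos by linarith
    have lo: "t \<le> c * 2 ^ k" using ub k1 by simp
    have "\<not> t \<le> c * 2 ^ (k - 1)" unfolding ub using k2 kp by (simp add: of_nat_diff)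
    moreover have "(2 :: real) ^ k = 2 * 2 ^ (k - 1)" using kp by (cases k) auto
    ultimately have hi: "c * 2 ^ k \<le> 2 * t" by simp
    have "(LEAST k. 2 ^ k * c \<in> {t..2 * t}) = k"
    proof (rule Least_equality)
      show "2 ^ k * c \<in> {t..2 * t}" using lo hi by (simp add: mult.commute)
      fix j assume "2 ^ j * c \<in> {t..2 * t}"
      then have "log 2 (t / c) \<le> real j" using ub[of j] by (simp add: mult.commute)
      then show "k \<le> j" unfolding k_def by linarith
    qed
    then have "block_exponent t c = k" using False by (simp add: block_exponent_def)
    then show ?thesis using lo hi by (simp add: k_def)
  qed
  then show "block_exponent t c = nat \<lceil>log 2 (t / c)\<rceil>" "t \<le> c * 2 ^ block_exponent t c"
    "0 < block_exponent t c \<Longrightarrow> c * 2 ^ block_exponent t c \<le> 2 * t" by auto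
  then show "c * (2 ^ block_exponent t c - 1) \<le> 2 * t"
    using assms by (cases "block_exponent t c = 0") (auto simp: right_diff_distrib)
qed

section \<open>Distribution arrays\<close>

lemma Dist_0 [simp]: "Dist p 0 = 1"
  by (simp add: Dist_def)

lemma Dist_le_1: "Dist p j \<le> 1" and Dist_nonneg: "0 \<le> Dist p j"
  by (simp_all add: Dist_def)

lemma Dist_antimono: "i \<le> j \<Longrightarrow> Dist p j \<le> Dist p i"
  unfolding Dist_def by (intro measure_pmf.finite_measure_mono) auto

lemma Dist_eq_1: "set_pmf p \<subseteq> {j..} \<Longrightarrow> Dist p j = 1"
  unfolding Dist_def by (subst measure_pmf.prob_eq_1) (auto simp: AE_measure_pmf_iff)

lemma Dist_eq_0: "set_pmf p \<subseteq> {..<j} \<Longrightarrow> Dist p j = 0"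
  unfolding Dist_def measure_pmf_zero_iff by auto

lemma pmf_eq_Dist: "pmf p k = Dist p k - Dist p (Suc k)"
proof -
  have "measure_pmf.prob p ({k..} - {Suc k..}) = Dist p k - Dist p (Suc k)"
    unfolding Dist_def by (intro measure_pmf.finite_measure_Diff) auto
  also have "{k..} - {Suc k..} = {k}" by auto
  finally show ?thesis by (simp add: measure_pmf_single)
qed

text \<open>\<open>Var\<close> is a definite description, so existence and uniqueness are both
  required. The atoms are the differences of the array extended by 1 at index 0 and by 0 beyond
  \<open>W\<close>; conversely, tails determine atoms by \<open>pmf_eq_Dist\<close>.\<close>

lemma Var_correct:
  assumes W: "1 \<le> W" and anti: "\<And>i j. 1 \<le> i \<Longrightarrow> i \<le> j \<Longrightarrow> j \<le> W \<Longrightarrow> D j \<le> D i"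
    and D: "D 1 \<le> 1" "0 \<le> D W"
  shows "set_pmf (Var W D) \<subseteq> {0..W}" "\<And>j. j \<in> {1..W} \<Longrightarrow> Dist (Var W D) j = D j"
proof -
  define E where "E j = (if j = 0 then 1 else if j \<le> W then D j else 0)" for j
  define f where "f k = E k - E (Suc k)" for k
  have anti1: "E (Suc k) \<le> E k" for k
    using D W anti[of 1 1] anti[of k "Suc k"] anti[of k W]
    by (cases "k = 0"; cases "k = W") (auto simp: E_def)
  have sum: "(\<Sum>k=j..W. f k) = E j" if "j \<le> Suc W" for j
    using that
  proof (induction j rule: inc_induct)
    case (step k)
    then show ?case by (simp add: sum.atLeast_Suc_atMost f_def)
  qed (simp add: E_def)
  have f0: "f k = 0" if "W < k" for k using that by (simp add: f_def E_def)
  have fnn: "0 \<le> f k" for k using anti1 by (simp add: f_def)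
  have "(\<integral>\<^sup>+k. ennreal (f k) \<partial>count_space UNIV) = (\<Sum>k\<le>W. ennreal (f k))"
    using f0 by (intro nn_integral_count_space'[of "{..W}"]) (auto simp: not_le)
  also have "\<dots> = ennreal (\<Sum>k=0..W. f k)"
    by (simp add: fnn sum_ennreal atMost_atLeast0)
  also have "\<dots> = 1" using sum[of 0] by (simp add: E_def)
  finally have nn: "(\<integral>\<^sup>+k. ennreal (f k) \<partial>count_space UNIV) = 1" .
  define q where "q = embed_pmf f"
  have pmf_q: "pmf q k = f k" for k unfolding q_def by (intro pmf_embed_pmf fnn nn)
  have supp: "set_pmf q \<subseteq> {0..W}" by (auto simp: set_pmf_iff pmf_q not_less [symmetric] f0)
  have tail: "measure_pmf.prob q {j..} = D j" if "j \<in> {1..W}" for j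
  proof -
    have "measure_pmf.prob q {j..} = measure_pmf.prob q {j..W}"
      using supp by (intro measure_prob_cong_0) (auto simp: pmf_q f0)
    also have "\<dots> = E j" using that sum[of j] by (simp add: measure_measure_pmf_finite pmf_q)
    finally show ?thesis using that by (simp add: E_def)
  qed
  have uniq: "r = q" if r: "set_pmf r \<subseteq> {0..W}" "\<forall>j\<in>{1..W}. measure_pmf.prob r {j..} = D j" for r
  proof -
    have "Dist r j = Dist q j" for j
    proof -
      consider "j = 0" | "j \<in> {1..W}" | "W < j" by force
      then show ?thesis
      proof cases
        case 3
        then have "{0..W} \<subseteq> {..<j}" by auto
        then have "Dist r j = 0" "Dist q j = 0"
          using r(1) supp by (meson Dist_eq_0 subset_trans)+
        then show ?thesis by simp
      qed (use r tail in \<open>auto simp: Dist_def\<close>)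
    qed
    then show ?thesis by (intro pmf_eqI) (simp add: pmf_eq_Dist)
  qed
  have "Var W D = q"
    unfolding Var_def
  proof (rule the_equality)
    show "set_pmf q \<subseteq> {0..W} \<and> (\<forall>j\<in>{1..W}. measure_pmf.prob q {j..} = D j)"
      using supp tail by blast
  qed (use uniq in blast)
  then show "set_pmf (Var W D) \<subseteq> {0..W}" "\<And>j. j \<in> {1..W} \<Longrightarrow> Dist (Var W D) j = D j"
    using supp tail by (auto simp: Dist_def)
qed

section \<open>Rounding of entries and of distribution arrays\<close>

context
  fixes \<eta> \<zeta> :: real
  assumes eta: "0 < \<eta>" and zeta: "0 \<le> \<zeta>"
begin

lemma approx_floor_bounds: "0 < (1 + \<eta>) powr (-\<zeta>)" "(1 + \<eta>) powr (-\<zeta>) \<le> 1"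
  using eta zeta powr_mono[of "-\<zeta>" 0 "1 + \<eta>"] by auto

lemma approx_entry_powr:
  "approx_entry \<zeta> \<eta> a =
     (if a > (1 + \<eta>) powr (-\<zeta>) then (1 + \<eta>) powr \<lceil>log (1 + \<eta>) a\<rceil> else (1 + \<eta>) powr (-\<zeta>))"
  using eta by (simp add: approx_entry_def powr_real_of_int')

lemma log_gt_neg_zeta: "a > (1 + \<eta>) powr (-\<zeta>) \<Longrightarrow> -\<zeta> < log (1 + \<eta>) a"
  using eta by (subst less_log_iff) (auto intro: less_trans[OF approx_floor_bounds(1)])

lemma le_approx_entry: "a \<le> approx_entry \<zeta> \<eta> a"
proof (cases "a > (1 + \<eta>) powr (-\<zeta>)")
  case True
  then have a: "0 < a" using approx_floor_bounds by linarith
  have "a = (1 + \<eta>) powr (log (1 + \<eta>) a)" using a eta by simp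
  also have "\<dots> \<le> (1 + \<eta>) powr \<lceil>log (1 + \<eta>) a\<rceil>" using eta by (intro powr_mono) auto
  finally show ?thesis using True by (simp add: approx_entry_powr)
qed (simp add: approx_entry_powr)

lemma approx_entry_le:
  assumes "0 \<le> a"
  shows "approx_entry \<zeta> \<eta> a \<le> (1 + \<eta>) * a + (1 + \<eta>) powr (-\<zeta>)"
proof (cases "a > (1 + \<eta>) powr (-\<zeta>)")
  case True
  then have a: "0 < a" using approx_floor_bounds by linarith
  have "(1 + \<eta>) powr \<lceil>log (1 + \<eta>) a\<rceil> \<le> (1 + \<eta>) powr (1 + log (1 + \<eta>) a)"
    using eta by (intro powr_mono) linarith+
  also have "\<dots> = (1 + \<eta>) * a" using a eta by (simp add: powr_add)
  finally show ?thesis using True by (simp add: approx_entry_powr add_increasing2)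
qed (use assms eta in \<open>simp add: approx_entry_powr\<close>)

lemma approx_entry_mono:
  assumes "a \<le> b"
  shows "approx_entry \<zeta> \<eta> a \<le> approx_entry \<zeta> \<eta> b"
proof (cases "a > (1 + \<eta>) powr (-\<zeta>)")
  case True
  then have a: "0 < a" using approx_floor_bounds by linarith
  then have "log (1 + \<eta>) a \<le> log (1 + \<eta>) b" using assms eta by simp
  then have "(1 + \<eta>) powr \<lceil>log (1 + \<eta>) a\<rceil> \<le> (1 + \<eta>) powr \<lceil>log (1 + \<eta>) b\<rceil>"
    using eta by (intro powr_mono) (auto intro: ceiling_mono)
  then show ?thesis using True assms by (simp add: approx_entry_powr)
next
  case False
  then show ?thesis using le_approx_entry[of b] by (auto simp: approx_entry_powr split: if_splits)
qed

lemma approx_entry_1: "approx_entry \<zeta> \<eta> 1 = 1"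
  using approx_floor_bounds by (auto simp: approx_entry_def)

lemma approx_entry_pos: "0 < approx_entry \<zeta> \<eta> a"
  using eta by (simp add: approx_entry_powr)

text \<open>Apart from the floor, the values are powers of 1 + \<eta> with integer exponents between
  -\<zeta> and 0. This count limits the length of every plateau list.\<close>

lemma approx_entry_values:
  "finite (approx_entry \<zeta> \<eta> ` {..1})" "real (card (approx_entry \<zeta> \<eta> ` {..1})) \<le> \<zeta> + 2"
proof -
  define V where "V = insert ((1 + \<eta>) powr (-\<zeta>)) ((\<lambda>i. (1 + \<eta>) powi i) ` {\<lceil>-\<zeta>\<rceil>..0})"
  have sub: "approx_entry \<zeta> \<eta> ` {..1} \<subseteq> V"
  proof safe
    fix a :: real assume a: "a \<le> 1"
    show "approx_entry \<zeta> \<eta> a \<in> V"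
    proof (cases "a > (1 + \<eta>) powr (-\<zeta>)")
      case True
      then have "0 < a" using approx_floor_bounds by linarith
      then have "log (1 + \<eta>) a \<le> 0" using a eta by (subst log_le_iff) auto
      then have "\<lceil>log (1 + \<eta>) a\<rceil> \<in> {\<lceil>-\<zeta>\<rceil>..0}"
        using log_gt_neg_zeta[OF True] by (auto intro!: ceiling_mono)
      then show ?thesis using True by (simp add: V_def approx_entry_def)
    qed (simp add: V_def approx_entry_def)
  qed
  have fin: "finite V" by (simp add: V_def)
  show "finite (approx_entry \<zeta> \<eta> ` {..1})" using finite_subset[OF sub fin] .
  have "card (approx_entry \<zeta> \<eta> ` {..1}) \<le> card V" by (rule card_mono[OF fin sub])
  also have "\<dots> \<le> Suc (card ((\<lambda>i. (1 + \<eta>) powi i) ` {\<lceil>-\<zeta>\<rceil>..0}))"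
    unfolding V_def by (rule card_insert_le_m1) auto
  also have "\<dots> \<le> Suc (card {\<lceil>-\<zeta>\<rceil>..0})"
    unfolding Suc_le_mono by (rule card_image_le) simp
  finally have "card (approx_entry \<zeta> \<eta> ` {..1}) \<le> Suc (nat (1 - \<lceil>-\<zeta>\<rceil>))" by simp
  then show "real (card (approx_entry \<zeta> \<eta> ` {..1})) \<le> \<zeta> + 2"
    using zeta by (simp add: ceiling_minus) linarith
qed

text \<open>Positive weights have first tail entry 1, a fixed point of the rounding, so rounding
  creates no atom at 0 and blocks remain legitimate items.\<close>

lemma Var_approx_array:
  assumes "1 \<le> W" "set_pmf p \<subseteq> {1..}"
  shows "set_pmf (Var W (approx_array \<zeta> \<eta> (Dist p))) \<subseteq> {1..W}"
    "\<And>j. j \<in> {1..W} \<Longrightarrow>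
       Dist (Var W (approx_array \<zeta> \<eta> (Dist p))) j = approx_entry \<zeta> \<eta> (Dist p j)"
proof -
  let ?q = "Var W (approx_array \<zeta> \<eta> (Dist p))"
  have D1: "Dist p 1 = 1" using assms by (intro Dist_eq_1) auto
  have *: "set_pmf ?q \<subseteq> {0..W}" "\<And>j. j \<in> {1..W} \<Longrightarrow> Dist ?q j = approx_entry \<zeta> \<eta> (Dist p j)"
    using Var_correct[OF assms(1), of "approx_array \<zeta> \<eta> (Dist p)"] D1
    by (simp_all add: approx_array_def approx_entry_1 approx_entry_pos less_imp_le
        approx_entry_mono Dist_antimono)
  show "Dist ?q j = approx_entry \<zeta> \<eta> (Dist p j)" if "j \<in> {1..W}" for j by (rule *(2)[OF that])
  have "pmf ?q 0 = 0" using *(2)[of 1] assms D1 by (simp add: pmf_eq_Dist approx_entry_1)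
  then have "set_pmf ?q \<subseteq> {0..W} - {0}" using *(1) by (simp add: set_pmf_iff subset_Diff_insert)
  also have "{0..W} - {0} = {1..W}" by auto
  finally show "set_pmf ?q \<subseteq> {1..W}" .
qed

lemma block_Suc: "block W \<zeta> \<eta> p (Suc i) =
    Var W (approx_array \<zeta> \<eta> (Dist (indep_sum (block W \<zeta> \<eta> p i) (block W \<zeta> \<eta> p i))))"
  by (simp add: Let_def indep_sum_def)

lemma set_block:
  assumes "1 \<le> W" "set_pmf p \<subseteq> {1..W}"
  shows "set_pmf (block W \<zeta> \<eta> p i) \<subseteq> {1..W}"
proof (induction i)
  case 0
  show ?case unfolding block.simps(1) by (rule Var_approx_array) (use assms in auto)
next
  case (Suc i)
  show ?case unfolding block_Suc
    by (rule Var_approx_array) (use assms Suc in \<open>force simp: set_indep_sum\<close>)+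
qed

lemma Dist_block_0:
  assumes "1 \<le> W" "set_pmf p \<subseteq> {1..W}" "j \<in> {1..W}"
  shows "Dist (block W \<zeta> \<eta> p 0) j = approx_entry \<zeta> \<eta> (Dist p j)"
  unfolding block.simps(1) by (rule Var_approx_array) (use assms in auto)

lemma set_indep_sum_block:
  assumes "1 \<le> W" "set_pmf p \<subseteq> {1..W}"
  shows "set_pmf (indep_sum (block W \<zeta> \<eta> p i) (block W \<zeta> \<eta> p i)) \<subseteq> {1..}"
  using set_block[OF assms, of i] by (force simp: set_indep_sum)

lemma Dist_block_Suc:
  assumes "1 \<le> W" "set_pmf p \<subseteq> {1..W}" "j \<in> {1..W}"
  shows "Dist (block W \<zeta> \<eta> p (Suc i)) j =
    approx_entry \<zeta> \<eta> (Dist (indep_sum (block W \<zeta> \<eta> p i) (block W \<zeta> \<eta> p i)) j)"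
  unfolding block_Suc by (rule Var_approx_array) (use assms set_indep_sum_block in auto)

end

section \<open>Subroutine DP\<close>

lemma expect_rest_mono_arg:
  assumes "mono h" "v \<le> w"
  shows "expect_rest p h v \<le> expect_rest p h w"
  unfolding expect_rest_def by (intro integral_mono integrable_expect_rest monoD[OF assms(1)]) (use assms(2) in auto)

text \<open>The rank of the entry \<open>g\<^sub>w\<close> of round \<open>i\<close> in units of \<open>u = \<delta> T\<close>.\<close>

definition rank :: "(nat \<Rightarrow> nat) \<Rightarrow> nat \<Rightarrow> nat \<Rightarrow> nat" where
  "rank f i w = card {j. j < i \<and> f j < w}"

lemma rank_0 [simp]: "rank f i 0 = 0"
  by (simp add: rank_def)

lemma rank_mono: "v \<le> w \<Longrightarrow> rank f i v \<le> rank f i w"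
  unfolding rank_def by (intro card_mono) auto

lemma rank_le: "rank f i w \<le> i"
proof -
  have "rank f i w \<le> card {..<i}" unfolding rank_def by (intro card_mono) auto
  then show ?thesis by simp
qed

lemma rank_Suc: "w \<le> f i \<Longrightarrow> rank f (Suc i) w = rank f i w"
  unfolding rank_def by (rule arg_cong[where f = card]) (auto simp: less_Suc_eq)

text \<open>A Galois connection between \<open>rank\<close> and a non-decreasing \<open>f\<close>;
  through it the thresholds are used instead of the definite description in
  \<open>dp_g\<close>.\<close>

lemma rank_le_iff:
  assumes mono: "\<And>j k. j \<le> k \<Longrightarrow> k < i \<Longrightarrow> f j \<le> f k" and l: "l < i"
  shows "rank f i w \<le> l \<longleftrightarrow> w \<le> f l"
proof
  assume "w \<le> f l"
  have "j < l" if "j < i" "f j < w" for j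
    using mono[of l j] that \<open>w \<le> f l\<close> by (cases "j < l") auto
  then have "{j. j < i \<and> f j < w} \<subseteq> {..<l}" by auto
  then have "rank f i w \<le> card {..<l}" unfolding rank_def by (intro card_mono) auto
  then show "rank f i w \<le> l" by simp
next
  show "w \<le> f l" if "rank f i w \<le> l"
  proof (rule ccontr)
    assume "\<not> w \<le> f l"
    then have "j < i \<and> f j < w" if "j \<le> l" for j using mono[OF that l] that l by auto
    then have "{..l} \<subseteq> {j. j < i \<and> f j < w}" by auto
    then have "card {..l} \<le> rank f i w" unfolding rank_def by (intro card_mono) auto
    then show False using that by simp
  qed
qed

text \<open>The intervals between consecutive thresholds are disjoint, and the index of the one
  containing \<open>w\<close> is the number of thresholds below \<open>w\<close>. Above all of them
  the count is \<open>i\<close>, which is the other branch of \<open>dp_g\<close>.\<close>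

lemma dp_g_eq_rank:
  assumes mono: "\<And>j k. j \<le> k \<Longrightarrow> k < i \<Longrightarrow> f j \<le> f k" and "f 0 = 0" "1 \<le> i" "1 \<le> w"
  shows "dp_g u f i w = real (rank f i w) * u"
proof (cases "f (i - 1) < w")
  case True
  have "\<not> rank f i w \<le> i - 1"
    using rank_le_iff[of i f "i - 1" w, OF mono] True assms by simp
  then have "rank f i w = i" using rank_le[of f i w] by simp
  then show ?thesis using True by (simp add: dp_g_def)
next
  case False
  define l where "l = rank f i w"
  have l: "l \<le> i - 1" unfolding l_def using rank_le_iff[of i f "i - 1" w, OF mono] False assms by simp
  have l0: "l \<noteq> 0" unfolding l_def using rank_le_iff[of i f 0 w, OF mono] assms by simp
  have iff: "l \<le> j \<longleftrightarrow> w \<le> f j" if "j < i" for j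
    unfolding l_def by (rule rank_le_iff[OF mono that])
  have "(THE j. j \<in> {1..i - 1} \<and> f (j - 1) < w \<and> w \<le> f j) = l"
  proof (rule the_equality)
    have "l - 1 < i" "l < i" using l l0 assms by auto
    then have "\<not> w \<le> f (l - 1)" "w \<le> f l" using iff[of "l - 1"] iff[of l] l0 by auto
    then show "l \<in> {1..i - 1} \<and> f (l - 1) < w \<and> w \<le> f l" using l l0 by auto
  next
    fix j assume j: "j \<in> {1..i - 1} \<and> f (j - 1) < w \<and> w \<le> f j"
    then have "j < i" "j - 1 < i" by auto
    then show "j = l" using iff[of j] iff[of "j - 1"] j by auto
  qed
  then show ?thesis using False by (simp add: dp_g_def l_def)
qed

section \<open>Soundness and completeness of the thresholds\<close>

context
  fixes n W :: nat and c :: "nat \<Rightarrow> real" and Y :: "nat \<Rightarrow> nat pmf" and u :: real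
  assumes fam: "item_family n c Y" and u: "0 < u"
begin

definition dp_f :: "nat \<Rightarrow> nat" where
  "dp_f i = dp_hist n W c Y u i i"

definition dp_admissible :: "nat \<Rightarrow> nat \<Rightarrow> bool" where
  "dp_admissible i w \<longleftrightarrow> (\<exists>k<n. c k + expect_rest (Y k) (\<lambda>x. real (rank dp_f i x) * u) w \<le> real i * u)"

lemma dp_f_0 [simp]: "dp_f 0 = 0"
  by (simp add: dp_f_def)

lemma dp_hist_eq: "j \<le> i \<Longrightarrow> dp_hist n W c Y u i j = dp_f j"
  by (induction i) (auto simp: Let_def dp_f_def le_Suc_eq)

lemma dp_sum_eq_expect_rest:
  assumes "i < n" "\<And>x. 1 \<le> x \<Longrightarrow> h x = h' x" "h' 0 = 0"
  shows "(\<Sum>j=1..w - 1. pmf (Y i) (w - j) * h j) = expect_rest (Y i) h' w"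
proof (cases "w = 0")
  case False
  have "(\<Sum>j=1..w - 1. pmf (Y i) (w - j) * h j) = (\<Sum>k=1..w - 1. pmf (Y i) k * h' (w - k))"
    by (rule sum.reindex_bij_witness[of _ "\<lambda>k. w - k" "\<lambda>k. w - k"]) (use assms(2) in auto)
  also have "\<dots> = (\<Sum>k=1..w. pmf (Y i) k * h' (w - k))"
    using False assms(3) by (cases w) auto
  also have "\<dots> = expect_rest (Y i) h' w"
    using fam assms by (intro expect_rest_sum) (auto simp: item_family_def)
  finally show ?thesis .
qed (simp add: expect_rest_0 assms)

text \<open>Monotonicity of the earlier thresholds is a hypothesis because its own proof,
  \<open>dp_f_step\<close>, uses this description of the next threshold.\<close>

lemma dp_f_Suc_aux:
  assumes "\<And>j k. j \<le> k \<Longrightarrow> k < Suc i \<Longrightarrow> dp_f j \<le> dp_f k"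
  shows "dp_f (Suc i) = Max (insert 0 {w \<in> {0..W}. dp_admissible (Suc i) w})"
proof -
  have "dp_g u (dp_hist n W c Y u i) (Suc i) x = real (rank dp_f (Suc i) x) * u" if "1 \<le> x" for x
  proof -
    have "rank (dp_hist n W c Y u i) (Suc i) x = rank dp_f (Suc i) x"
      unfolding rank_def by (rule arg_cong[where f = card]) (auto simp: dp_hist_eq)
    then show ?thesis
      using assms that by (subst dp_g_eq_rank) (auto simp: dp_hist_eq)
  qed
  then have "(\<Sum>j=1..w - 1. pmf (Y k) (w - j) * dp_g u (dp_hist n W c Y u i) (Suc i) j)
      = expect_rest (Y k) (\<lambda>x. real (rank dp_f (Suc i) x) * u) w" if "k < n" for k w
    using that by (intro dp_sum_eq_expect_rest) auto
  then show ?thesis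
    by (auto simp: dp_f_def [of "Suc i"] Let_def dp_next_def dp_admissible_def
        intro!: arg_cong[where f = Max] arg_cong[where f = "insert 0"] simp del: One_nat_def)
qed

text \<open>Below \<open>dp_f i\<close> the ranks of rounds \<open>i\<close> and
  \<open>Suc i\<close> agree, since the new threshold is not counted there. Hence the item
  admissible at \<open>dp_f i\<close> stays admissible under the larger budget.\<close>

lemma dp_f_step: "dp_f i \<le> dp_f (Suc i)"
proof (induction i rule: less_induct)
  case (less i)
  have mono: "dp_f j \<le> dp_f k" if "j \<le> k" "k < Suc i" for j k
    using that
  proof (induction k rule: dec_induct)
    case (step m)
    then show ?case using less[of m] by simp
  qed simp
  show ?case
  proof (cases i)
    case (Suc i')
    have eq: "dp_f i = Max (insert 0 {w \<in> {0..W}. dp_admissible i w})"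
      unfolding Suc using mono by (intro dp_f_Suc_aux) (simp add: Suc)
    have "dp_f i \<in> insert 0 {w \<in> {0..W}. dp_admissible i w}"
      unfolding eq by (intro Max_in) auto
    then consider "dp_f i = 0" | "dp_f i \<noteq> 0" "dp_f i \<le> W" "dp_admissible i (dp_f i)" by auto
    then show ?thesis
    proof cases
      case 2
      then obtain k where k: "k < n"
        "c k + expect_rest (Y k) (\<lambda>x. real (rank dp_f i x) * u) (dp_f i) \<le> real i * u"
        by (auto simp: dp_admissible_def)
      have "expect_rest (Y k) (\<lambda>x. real (rank dp_f (Suc i) x) * u) (dp_f i)
          \<le> expect_rest (Y k) (\<lambda>x. real (rank dp_f i x) * u) (dp_f i)"
        using fam k 2 by (intro expect_rest_mono_less) (auto simp: item_family_def rank_Suc)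
      then have "c k + expect_rest (Y k) (\<lambda>x. real (rank dp_f (Suc i) x) * u) (dp_f i) \<le> real (Suc i) * u"
        using k u by (simp add: algebra_simps)
      then have "dp_admissible (Suc i) (dp_f i)" using k by (auto simp: dp_admissible_def)
      moreover have "dp_f (Suc i) = Max (insert 0 {w \<in> {0..W}. dp_admissible (Suc i) w})"
        using mono by (rule dp_f_Suc_aux)
      ultimately show ?thesis using 2 by (auto intro: Max_ge)
    qed simp
  qed simp
qed

lemma dp_f_mono: "i \<le> j \<Longrightarrow> dp_f i \<le> dp_f j"
  using dp_f_step by (rule lift_Suc_mono_le)

lemma dp_f_eq: "1 \<le> i \<Longrightarrow> dp_f i = Max (insert 0 {w \<in> {0..W}. dp_admissible i w})"
  using dp_f_Suc_aux[of "i - 1"] dp_f_mono by (cases i) auto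

text \<open>Downward closure is what justifies binary search for the threshold.\<close>

lemma dp_admissible_antimono:
  assumes "dp_admissible i w" "v \<le> w"
  shows "dp_admissible i v"
proof -
  have "mono (\<lambda>x. real (rank dp_f i x) * u)"
    using u by (intro monoI) (simp add: rank_mono)
  from expect_rest_mono_arg[OF this assms(2)] show ?thesis
    using assms(1) unfolding dp_admissible_def by (meson add_left_mono order_trans)
qed

lemma le_dp_f_iff:
  assumes "1 \<le> i" "1 \<le> w" "w \<le> W"
  shows "w \<le> dp_f i \<longleftrightarrow> dp_admissible i w"
proof
  assume w: "w \<le> dp_f i"
  have "dp_f i \<in> insert 0 {w \<in> {0..W}. dp_admissible i w}"
    unfolding dp_f_eq[OF assms(1)] by (intro Max_in) auto
  then have "dp_admissible i (dp_f i)" using w assms by auto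
  then show "dp_admissible i w" using w by (rule dp_admissible_antimono)
next
  assume "dp_admissible i w"
  then show "w \<le> dp_f i"
    unfolding dp_f_eq[OF assms(1)] using assms by (intro Max_ge) auto
qed

text \<open>Two nested inductions are needed: a remaining weight may have rank \<open>i\<close>
  itself, and then the bound is required for the same round at a smaller \<open>w\<close>.\<close>

lemma dp_f_sound:
  assumes "w \<le> W" "w \<le> dp_f i"
  shows "sukp_opt n W c Y w \<le> real i * u"
  using assms
proof (induction i arbitrary: w rule: less_induct)
  case (less i)
  note outer = less.IH
  from less.prems show ?case
  proof (induction w rule: less_induct)
    case (less w)
    show ?case
    proof (cases "w = 0")
      case False
      then have i: "1 \<le> i" using less.prems by (cases i) auto
      then obtain k where k: "k < n" "c k + expect_rest (Y k) (\<lambda>x. real (rank dp_f i x) * u) w \<le> real i * u"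
        using less.prems False le_dp_f_iff[of i w] by (auto simp: dp_admissible_def Suc_le_eq)
      have le: "sukp_opt n W c Y x \<le> real (rank dp_f i x) * u" if "x < w" for x
      proof (cases "rank dp_f i x < i")
        case True
        then have "x \<le> dp_f (rank dp_f i x)"
          using rank_le_iff[of i dp_f "rank dp_f i x" x] dp_f_mono by simp
        then show ?thesis using outer[OF True, of x] less.prems that by simp
      next
        case False
        then have "rank dp_f i x = i" using rank_le[of dp_f i x] by simp
        then show ?thesis using less.IH[OF that] less.prems that by simp
      qed
      have "sukp_opt n W c Y w \<le> c k + expect_rest (Y k) (sukp_opt n W c Y) w"
        using False less.prems k by (intro sukp_opt_le[OF fam]) auto
      also have "expect_rest (Y k) (sukp_opt n W c Y) w \<le> expect_rest (Y k) (\<lambda>x. real (rank dp_f i x) * u) w"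
        using fam k False le by (intro expect_rest_mono_less) (auto simp: item_family_def)
      finally show ?thesis using k by simp
    qed (use u in simp)
  qed
qed

text \<open>Rounding up to multiples of \<open>u\<close> costs at most \<open>u \<le> \<gamma> c\<^sub>k\<close> per insertion.\<close>

lemma dp_f_complete:
  assumes gamma: "\<And>k. k < n \<Longrightarrow> u \<le> \<gamma> * c k" and "w \<le> W"
    and "(1 + \<gamma>) * sukp_opt n W c Y w \<le> real i * u"
  shows "w \<le> dp_f i"
  using assms(2,3)
proof (induction w arbitrary: i rule: less_induct)
  case (less w)
  have gpos: "0 < \<gamma>"
  proof -
    have "0 < \<gamma> * c 0" "0 < c 0" using gamma[of 0] u fam by (auto simp: item_family_def intro: less_le_trans)
    then show ?thesis by (simp add: zero_less_mult_iff)
  qed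
  show ?case
  proof (cases "w = 0")
    case False
    then have w: "1 \<le> w" by simp
    obtain k where k: "k < n" "sukp_opt n W c Y w = c k + expect_rest (Y k) (sukp_opt n W c Y) w"
      using sukp_opt_attained[OF fam w less.prems(1)] by metis
    have "0 < (1 + \<gamma>) * sukp_opt n W c Y w"
      using sukp_opt_pos[OF fam w less.prems(1)] gpos by simp
    then have i: "1 \<le> i" using less.prems(2) by (cases i) auto
    have le: "real (rank dp_f i x) * u \<le> (1 + \<gamma>) * sukp_opt n W c Y x + u" if x: "x < w" for x
    proof -
      \<comment> \<open>The first round by which induction places \<open>x\<close> below the
        threshold; the ceiling is the source of the additional \<open>u\<close>.\<close>
      define l where "l = nat \<lceil>(1 + \<gamma>) * sukp_opt n W c Y x / u\<rceil>"
      have nn: "0 \<le> (1 + \<gamma>) * sukp_opt n W c Y x / u"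
        using sukp_opt_nonneg[OF fam, of x W] x less.prems gpos u by simp
      have "(1 + \<gamma>) * sukp_opt n W c Y x / u \<le> real l"
        unfolding l_def by (rule real_nat_ceiling_ge)
      then have "x \<le> dp_f l"
        using u less.IH[OF x, of l] x less.prems by (simp add: field_simps)
      then have "rank dp_f i x \<le> l"
        using rank_le_iff[of i dp_f l x] dp_f_mono rank_le[of dp_f i x] by (cases "l < i") auto
      moreover have "real l \<le> (1 + \<gamma>) * sukp_opt n W c Y x / u + 1"
        unfolding l_def using nn by linarith
      ultimately have "real (rank dp_f i x) \<le> (1 + \<gamma>) * sukp_opt n W c Y x / u + 1" by linarith
      then have "real (rank dp_f i x) * u \<le> ((1 + \<gamma>) * sukp_opt n W c Y x / u + 1) * u"
        using u by (intro mult_right_mono) auto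
      also have "\<dots> = (1 + \<gamma>) * sukp_opt n W c Y x + u" using u by (simp add: field_simps)
      finally show ?thesis .
    qed
    have "expect_rest (Y k) (\<lambda>x. real (rank dp_f i x) * u) w
        \<le> expect_rest (Y k) (\<lambda>x. (1 + \<gamma>) * sukp_opt n W c Y x + u) w"
      using fam k w le by (intro expect_rest_mono_less) (auto simp: item_family_def)
    then have "c k + expect_rest (Y k) (\<lambda>x. real (rank dp_f i x) * u) w
        \<le> c k + ((1 + \<gamma>) * expect_rest (Y k) (sukp_opt n W c Y) w + \<gamma> * c k)"
      using gamma[OF k(1)] by (simp add: expect_rest_add_const expect_rest_cmult)
    also have "\<dots> = (1 + \<gamma>) * sukp_opt n W c Y w" using k by (simp add: algebra_simps)
    finally have "dp_admissible i w"
      using less.prems k unfolding dp_admissible_def by (intro exI[of _ k]) auto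
    then show ?thesis using le_dp_f_iff i w less.prems by simp
  qed simp
qed

text \<open>The lower bound is soundness. For the upper bound, a value too large by more than
  \<open>u\<close> would by completeness have let the preceding round stop already.\<close>

lemma dp_output_bounds:
  assumes gamma: "\<And>k. k < n \<Longrightarrow> u \<le> \<gamma> * c k" and W: "1 \<le> W"
    and out: "dp_output n W c Y u N = Some v"
  shows "sukp_opt n W c Y W \<le> v" "v \<le> (1 + \<gamma>) * sukp_opt n W c Y W + u"
proof -
  let ?done = "\<lambda>i. i \<in> {1..N} \<and> dp_hist n W c Y u i i \<ge> W"
  define i where "i = (LEAST i. ?done i)"
  have ex: "\<exists>i. ?done i" and v: "v = real i * u"
    using out by (auto simp: dp_output_def Let_def i_def split: if_splits)
  have i: "?done i" using LeastI_ex[OF ex] by (simp add: i_def)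
  have "W \<le> dp_f i" using i by (simp add: dp_f_def)
  then show "sukp_opt n W c Y W \<le> v" unfolding v by (intro dp_f_sound) auto
  show "v \<le> (1 + \<gamma>) * sukp_opt n W c Y W + u"
  proof (rule ccontr)
    assume "\<not> v \<le> (1 + \<gamma>) * sukp_opt n W c Y W + u"
    then have le: "(1 + \<gamma>) * sukp_opt n W c Y W \<le> real (i - 1) * u"
      using i by (simp add: v of_nat_diff algebra_simps)
    have "W \<le> dp_f (i - 1)" by (rule dp_f_complete[OF gamma _ le]) auto
    moreover have "i - 1 \<noteq> 0" using calculation W by (metis dp_f_0 not_one_le_zero le_zero_eq)
    ultimately have "?done (i - 1)" using i by (auto simp: dp_f_def)
    then have "i \<le> i - 1" unfolding i_def by (rule Least_le)
    then show False using i by auto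
  qed
qed

lemma dp_output_exists:
  assumes gamma: "\<And>k. k < n \<Longrightarrow> u \<le> \<gamma> * c k" and W: "1 \<le> W"
    and N: "(1 + \<gamma>) * sukp_opt n W c Y W \<le> real N * u"
  shows "\<exists>v. dp_output n W c Y u N = Some v"
proof -
  have "W \<le> dp_f N" by (rule dp_f_complete[OF gamma _ N]) auto
  moreover have "N \<noteq> 0" using calculation W by (metis dp_f_0 not_one_le_zero le_zero_eq)
  ultimately have "\<exists>i. i \<in> {1..N} \<and> dp_hist n W c Y u i i \<ge> W"
    by (intro exI[of _ N]) (auto simp: dp_f_def)
  then show ?thesis by (simp add: dp_output_def Let_def)
qed

end

section \<open>The approximation guarantee\<close>

text \<open>\<zeta> is chosen so that the floor of the rounding is exactly the additive tail error
  \<eta> / W tolerated by \<open>sukp_opt_tail_scaling\<close>.\<close>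

locale block_params =
  fixes n W :: nat and c :: "nat \<Rightarrow> real" and X :: "nat \<Rightarrow> nat pmf" and \<eta> \<zeta> :: real
  assumes inst: "min_sukp n W c X"
    and eta: "0 < \<eta>" "\<eta> < 1" and zeta: "0 \<le> \<zeta>" and floor_value: "(1 + \<eta>) powr (-\<zeta>) = \<eta> / real W"
begin

lemma W_pos: "1 \<le> W" and supp: "p < n \<Longrightarrow> set_pmf (X p) \<subseteq> {1..W}" and c_pos: "p < n \<Longrightarrow> 0 < c p"
  using inst by (auto simp: min_sukp_def)

lemma fam: "item_family n c X"
  by (rule min_sukp_item_family[OF inst])

definition opt_blocks :: "(nat \<Rightarrow> nat) \<Rightarrow> nat \<Rightarrow> real" where
  "opt_blocks k = sukp_opt n W (\<lambda>p. c p * 2 ^ k p) (\<lambda>p. block W \<zeta> \<eta> (X p) (k p))"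

lemma set_block': "p < n \<Longrightarrow> set_pmf (block W \<zeta> \<eta> (X p) i) \<subseteq> {1..W}"
  using set_block[OF eta(1) zeta W_pos supp] .

lemma finite_block: "p < n \<Longrightarrow> finite (set_pmf (block W \<zeta> \<eta> (X p) i))"
  using set_block' finite_subset by blast

lemma zero_notin_block: "p < n \<Longrightarrow> 0 \<notin> set_pmf (block W \<zeta> \<eta> (X p) i)"
  using set_block'[of p i] by auto

lemma fam_blocks: "item_family n (\<lambda>p. c p * 2 ^ k p) (\<lambda>p. block W \<zeta> \<eta> (X p) (k p))"
  using fam finite_block zero_notin_block unfolding item_family_def by simp

lemma Dist_block_0_le:
  assumes "p < n" "j \<in> {1..W}"
  shows "Dist (block W \<zeta> \<eta> (X p) 0) j \<le> (1 + \<eta>) * Dist (X p) j + \<eta> / real W"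
  using approx_entry_le[OF eta(1) zeta Dist_nonneg] Dist_block_0[OF eta(1) zeta W_pos supp[OF assms(1)] assms(2)]
  by (simp add: floor_value)

lemma Dist_block_Suc_le:
  assumes "p < n" "j \<in> {1..W}"
  shows "Dist (block W \<zeta> \<eta> (X p) (Suc i)) j
    \<le> (1 + \<eta>) * Dist (indep_sum (block W \<zeta> \<eta> (X p) i) (block W \<zeta> \<eta> (X p) i)) j + \<eta> / real W"
  using approx_entry_le[OF eta(1) zeta Dist_nonneg] Dist_block_Suc[OF eta(1) zeta W_pos supp[OF assms(1)] assms(2)]
  by (simp add: floor_value)

text \<open>Capping the exponents at \<open>m\<close> doubles all types simultaneously, so the
  factor is paid per level and not per type; types that have reached their exponent just stay. The
  exponent \<open>Suc m\<close> includes the initial rounding.\<close>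

lemma opt_le_opt_blocks:
  assumes "w \<le> W"
  shows "sukp_opt n W c X w \<le> ((1 + \<eta>) / (1 - \<eta>)) ^ Suc m * opt_blocks (\<lambda>p. min m (k p)) w"
proof (induction m)
  case 0
  have "sukp_opt n W c X w \<le> (1 + \<eta>) / (1 - \<eta>) * sukp_opt n W c (\<lambda>p. block W \<zeta> \<eta> (X p) 0) w"
    using fam_blocks[of "\<lambda>_. 0"] by (intro sukp_opt_tail_scaling fam Dist_block_0_le eta assms) auto
  then show ?case by (simp add: opt_blocks_def)
next
  case (Suc m)
  define B where "B p = block W \<zeta> \<eta> (X p) (min m (k p))" for p
  define d where "d p = c p * 2 ^ min (Suc m) (k p)" for p
  \<comment> \<open>Exact sums, not yet rounded: passing to them is free of loss, and only the
    subsequent rounding costs a factor.\<close>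
  define Z where "Z p = (if m < k p then indep_sum (B p) (B p) else B p)" for p
  have famZ: "item_family n d Z"
    using fam finite_block zero_notin_block
    by (auto simp: item_family_def d_def Z_def B_def set_indep_sum finite_image_set2)
  have famB: "item_family n d (\<lambda>p. block W \<zeta> \<eta> (X p) (min (Suc m) (k p)))"
    unfolding d_def by (rule fam_blocks)
  have "opt_blocks (\<lambda>p. min m (k p)) w \<le> sukp_opt n W d Z w"
    unfolding opt_blocks_def B_def [symmetric]
  proof (rule sukp_opt_le_pairs[OF _ famZ _ assms])
    show "item_family n (\<lambda>p. c p * 2 ^ min m (k p)) B"
      unfolding B_def by (rule fam_blocks)
  qed (auto simp: d_def Z_def min_def)
  also have "\<dots> \<le> (1 + \<eta>) / (1 - \<eta>) * sukp_opt n W d (\<lambda>p. block W \<zeta> \<eta> (X p) (min (Suc m) (k p))) w"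
  proof (rule sukp_opt_tail_scaling[OF famZ famB _ eta assms])
    fix p j assume p: "p < n" "j \<in> {1..W}"
    show "Dist (block W \<zeta> \<eta> (X p) (min (Suc m) (k p))) j \<le> (1 + \<eta>) * Dist (Z p) j + \<eta> / real W"
    proof (cases "m < k p")
      case True
      then have "min (Suc m) (k p) = Suc m" "min m (k p) = m" by auto
      then show ?thesis using Dist_block_Suc_le[OF p, of m] True by (simp add: Z_def B_def)
    next
      case False
      then have "min (Suc m) (k p) = min m (k p)" by auto
      then have "Dist (block W \<zeta> \<eta> (X p) (min (Suc m) (k p))) j = Dist (Z p) j"
        using False by (simp add: Z_def B_def)
      moreover have "Dist (Z p) j \<le> (1 + \<eta>) * Dist (Z p) j + \<eta> / real W"
        using eta Dist_nonneg[of "Z p" j] by (simp add: distrib_right)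
      ultimately show ?thesis by simp
    qed
  qed
  also have "sukp_opt n W d (\<lambda>p. block W \<zeta> \<eta> (X p) (min (Suc m) (k p))) w
      = opt_blocks (\<lambda>p. min (Suc m) (k p)) w"
    by (simp add: opt_blocks_def d_def [abs_def])
  finally have "opt_blocks (\<lambda>p. min m (k p)) w
      \<le> (1 + \<eta>) / (1 - \<eta>) * opt_blocks (\<lambda>p. min (Suc m) (k p)) w" .
  then have "((1 + \<eta>) / (1 - \<eta>)) ^ Suc m * opt_blocks (\<lambda>p. min m (k p)) w
      \<le> ((1 + \<eta>) / (1 - \<eta>)) ^ Suc m * ((1 + \<eta>) / (1 - \<eta>) * opt_blocks (\<lambda>p. min (Suc m) (k p)) w)"
    using eta by (intro mult_left_mono) auto
  with Suc.IH show ?case by (simp add: mult_ac)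
qed

text \<open>Induction on the total number of doublings, undoing one doubling of one type each time.
  In the base case only the initial rounding is left, which makes items heavier and therefore cannot
  raise the optimum.\<close>

lemma opt_blocks_le:
  assumes "w \<le> W"
  shows "opt_blocks k w \<le> sukp_opt n W c X w + (\<Sum>p<n. c p * (2 ^ k p - 1))"
proof (induction "\<Sum>p<n. k p" arbitrary: k)
  case 0
  then have k0: "k p = 0" if "p < n" for p using that by simp
  have "opt_blocks k w \<le> sukp_opt n W c X w"
  proof (rule sukp_opt_greatest[OF fam _ _ assms])
    fix w i assume w: "1 \<le> w" "w \<le> W" "i < n"
    have "opt_blocks k w \<le> c i * 2 ^ k i + expect_rest (block W \<zeta> \<eta> (X i) (k i)) (opt_blocks k) w"
      unfolding opt_blocks_def using w by (intro sukp_opt_le[OF fam_blocks])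
    also have "expect_rest (block W \<zeta> \<eta> (X i) (k i)) (opt_blocks k) w \<le> expect_rest (X i) (opt_blocks k) w"
    proof (rule expect_rest_antimono_tail)
      show "mono_on {..w} (opt_blocks k)"
        unfolding opt_blocks_def
        by (rule monotone_on_subset[OF sukp_opt_mono[OF fam_blocks]]) (use w in auto)
      show "Dist (X i) j \<le> Dist (block W \<zeta> \<eta> (X i) (k i)) j" if "j \<in> {1..w}" for j
        using Dist_block_0[OF eta(1) zeta W_pos supp[OF w(3)], of j] that w k0[OF w(3)]
          le_approx_entry[OF eta(1) zeta]
        by simp
    qed
    finally show "opt_blocks k w \<le> c i + expect_rest (X i) (opt_blocks k) w" using w k0 by simp
  qed (simp add: opt_blocks_def)
  also have "(\<Sum>p<n. c p * (2 ^ k p - 1)) = 0" using k0 by simp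
  then have "sukp_opt n W c X w = sukp_opt n W c X w + (\<Sum>p<n. c p * (2 ^ k p - 1))" by simp
  finally show ?case .
next
  case (Suc s)
  have "\<exists>p<n. k p \<noteq> 0"
  proof (rule ccontr)
    assume "\<not> (\<exists>p<n. k p \<noteq> 0)"
    then have "(\<Sum>p<n. k p) = 0" by simp
    then show False using Suc.hyps(2) by linarith
  qed
  then obtain p where p: "p < n" "0 < k p" by auto
  define l where "l = k(p := k p - 1)"
  let ?B = "\<lambda>q. block W \<zeta> \<eta> (X q) (l q)"
  have "(\<Sum>q<n. k q) = Suc (\<Sum>q<n. l q)"
    using p by (simp add: sum.remove[of _ p] l_def)
  then have IH: "opt_blocks l w \<le> sukp_opt n W c X w + (\<Sum>q<n. c q * (2 ^ l q - 1))"
    using Suc by simp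
  have kp: "k p = Suc (l p)" using p by (simp add: l_def)
  have lq: "l q = k q" if "q \<noteq> p" for q using that by (simp add: l_def)
  \<comment> \<open>The family is written as an update at \<open>p\<close>, so that
    \<open>sukp_opt_pairs_le\<close> applies with unit cost \<open>c p * 2 ^ l p\<close>.\<close>
  have c_eq: "(\<lambda>q. c q * 2 ^ k q) = (\<lambda>q. c q * 2 ^ l q)(p := 2 * (c p * 2 ^ l p))"
    by (rule ext) (auto simp: kp lq)
  have Y_eq: "(\<lambda>q. block W \<zeta> \<eta> (X q) (k q)) = ?B(p := block W \<zeta> \<eta> (X p) (Suc (l p)))"
    by (rule ext) (auto simp: kp lq simp del: block.simps)
  have "opt_blocks k w \<le> opt_blocks l w + c p * 2 ^ l p"
    unfolding opt_blocks_def c_eq Y_eq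
  proof (rule sukp_opt_pairs_le[OF fam_blocks _ p(1) _ assms])
    show "item_family n ((\<lambda>q. c q * 2 ^ l q)(p := 2 * (c p * 2 ^ l p)))
        (?B(p := block W \<zeta> \<eta> (X p) (Suc (l p))))"
      unfolding c_eq [symmetric] Y_eq [symmetric] by (rule fam_blocks)
    show "Dist (indep_sum (?B p) (?B p)) j \<le> Dist (block W \<zeta> \<eta> (X p) (Suc (l p))) j"
      if "j \<in> {1..W}" for j
      unfolding Dist_block_Suc[OF eta(1) zeta W_pos supp[OF p(1)] that]
      by (rule le_approx_entry[OF eta(1) zeta])
  qed
  moreover have "(\<Sum>q<n. c q * (2 ^ k q - 1)) = (\<Sum>q<n. c q * (2 ^ l q - 1)) + c p * 2 ^ l p"
  proof -
    have "(\<Sum>q\<in>{..<n} - {p}. c q * (2 ^ k q - 1)) = (\<Sum>q\<in>{..<n} - {p}. c q * (2 ^ l q - 1))"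
      by (intro sum.cong) (auto simp: lq)
    then show ?thesis using p kp by (simp add: sum.remove[of _ p] algebra_simps)
  qed
  ultimately show ?case using IH by simp
qed

end

lemma sukp_opt_cong:
  assumes "\<And>i. i < n \<Longrightarrow> c i = d i" "\<And>i. i < n \<Longrightarrow> X i = Y i"
  shows "sukp_opt n W c X w = sukp_opt n W d Y w"
proof (induction w rule: less_induct)
  case (less w)
  have "(\<Sum>k=1..W. pmf (X i) k * sukp_opt n W c X (w - k))
      = (\<Sum>k=1..W. pmf (Y i) k * sukp_opt n W d Y (w - k))" if "w \<noteq> 0" "i < n" for i
    using that assms(2) by (intro sum.cong) (auto simp: less)
  then show ?case
    using assms(1) by (subst (1 2) sukp_opt.simps) (auto intro!: arg_cong[where f = Min] image_cong)
qed

lemma log2_ge_1: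
  assumes "2 \<le> W"
  shows "1 \<le> log 2 (real W)"
  using assms by (simp add: le_log_iff)

lemma eta_par_bounds:
  assumes "2 \<le> W" "0 < \<epsilon>" "\<epsilon> < 1"
  shows "0 < eta_par W \<epsilon>" "eta_par W \<epsilon> < 1 / 10" "eta_par W \<epsilon> * log 2 (real W) = \<epsilon> / 10"
  using log2_ge_1[OF assms(1)] assms(2,3) by (auto simp: eta_par_def field_simps)

lemma zeta_par_bounds:
  assumes "2 \<le> W" "0 < \<epsilon>" "\<epsilon> < 1"
  shows "0 \<le> zeta_par W \<epsilon>" "(1 + eta_par W \<epsilon>) powr (- zeta_par W \<epsilon>) = eta_par W \<epsilon> / real W"
proof -
  note eta = eta_par_bounds[OF assms]
  have "1 \<le> real W / eta_par W \<epsilon>" using eta assms by simp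
  then show "0 \<le> zeta_par W \<epsilon>" using eta by (simp add: zeta_par_def)
  show "(1 + eta_par W \<epsilon>) powr (- zeta_par W \<epsilon>) = eta_par W \<epsilon> / real W"
    using eta assms by (simp add: zeta_par_def powr_minus)
qed

section \<open>Error budget for the concrete parameters\<close>

locale sukp_instance =
  fixes n W :: nat and c :: "nat \<Rightarrow> real" and X :: "nat \<Rightarrow> nat pmf" and \<epsilon> :: real
  assumes inst: "min_sukp n W c X" and eps: "0 < \<epsilon>" "\<epsilon> < 1"
begin

lemma W_ge_2: "2 \<le> W" and n_ge_1: "1 \<le> n" and c_pos: "p < n \<Longrightarrow> 0 < c p"
  and supp: "p < n \<Longrightarrow> set_pmf (X p) \<subseteq> {1..W}"
  using inst by (auto simp: min_sukp_def)

sublocale block_params n W c X "eta_par W \<epsilon>" "zeta_par W \<epsilon>"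
  using eta_par_bounds[OF W_ge_2 eps] zeta_par_bounds[OF W_ge_2 eps] inst
  by unfold_locales auto

abbreviation "T \<equiv> T_par n W c X"
abbreviation "\<eta> \<equiv> eta_par W \<epsilon>"
abbreviation "\<zeta> \<equiv> zeta_par W \<epsilon>"
abbreviation "\<delta> \<equiv> delta_par n \<epsilon>"
abbreviation "OPT \<equiv> sukp_opt n W c X W"

definition exponent :: "nat \<Rightarrow> nat" where
  "exponent p = block_exponent (theta_par n \<epsilon> * T) (c p)"

lemma T_pos: "0 < T"
  by (rule T_par_bounds[OF inst])

lemma theta_T_pos: "0 < theta_par n \<epsilon> * T"
  using T_pos eps n_ge_1 by (simp add: theta_par_def)

lemmas exponent_bounds = block_exponent_bounds[OF theta_T_pos c_pos, folded exponent_def]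

text \<open>A doubled type satisfies c p * 2 ^ k \<le> 2 \<theta> T \<le> \<theta> W c p, and
  \<theta> \<le> 1 / 2. The added 1 counts the rounding before the first doubling.\<close>

lemma exponent_le_log:
  assumes "p < n"
  shows "real (exponent p) + 1 \<le> log 2 (real W)"
proof (cases "exponent p = 0")
  case True
  then show ?thesis using log2_ge_1[OF W_ge_2] by simp
next
  case False
  then have "c p * 2 ^ exponent p \<le> 2 * (theta_par n \<epsilon> * T)" using exponent_bounds(4)[OF assms] by simp
  also have "\<dots> \<le> 2 * (theta_par n \<epsilon> * (real W / 2 * c p))"
    using T_par_bounds(4)[OF inst assms] eps by (intro mult_left_mono) (auto simp: theta_par_def)
  finally have "2 ^ exponent p \<le> theta_par n \<epsilon> * real W" using c_pos[OF assms] by (simp add: field_simps)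
  also have "\<dots> \<le> 1 / 2 * real W"
    using eps n_ge_1 by (intro mult_right_mono) (auto simp: theta_par_def divide_simps)
  finally have "2 ^ (exponent p + 1) \<le> real W" by simp
  then show ?thesis using W_ge_2 by (simp add: le_log_iff powr_add powr_realpow)
qed

lemma opt_blocks_upper: "opt_blocks exponent W \<le> (1 + \<epsilon> / 5) * OPT"
proof -
  have "opt_blocks exponent W \<le> OPT + (\<Sum>p<n. c p * (2 ^ exponent p - 1))" by (rule opt_blocks_le) simp
  also have "(\<Sum>p<n. c p * (2 ^ exponent p - 1)) \<le> (\<Sum>p<n. 2 * (theta_par n \<epsilon> * T))"
    using exponent_bounds(3) by (intro sum_mono) auto
  also have "\<dots> = \<epsilon> / 5 * T" using n_ge_1 by (simp add: theta_par_def)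
  also have "\<dots> \<le> \<epsilon> / 5 * OPT" using T_par_bounds(2)[OF inst] eps by (intro mult_left_mono) auto
  finally show ?thesis by (simp add: distrib_right)
qed

lemma opt_blocks_lower: "(1 - \<epsilon>) * OPT \<le> opt_blocks exponent W"
proof -
  define m where "m = Max (exponent ` {..<n})"
  have le: "exponent p \<le> m" if "p < n" for p unfolding m_def using that by (intro Max_ge) auto
  have "m \<in> exponent ` {..<n}" unfolding m_def using n_ge_1 by (intro Max_in) (auto simp: lessThan_empty_iff)
  then have m: "real (Suc m) \<le> log 2 (real W)" using exponent_le_log by fastforce
  have "opt_blocks (\<lambda>p. min m (exponent p)) W = opt_blocks exponent W"
    unfolding opt_blocks_def using le by (intro sukp_opt_cong) auto
  then have "OPT \<le> ((1 + \<eta>) / (1 - \<eta>)) ^ Suc m * opt_blocks exponent W"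
    using opt_le_opt_blocks[of W m exponent] by simp
  then have "((1 - \<eta>) / (1 + \<eta>)) ^ Suc m * OPT
      \<le> ((1 - \<eta>) / (1 + \<eta>)) ^ Suc m * (((1 + \<eta>) / (1 - \<eta>)) ^ Suc m * opt_blocks exponent W)"
    using eta by (intro mult_left_mono) auto
  also have "\<dots> = opt_blocks exponent W"
    using eta by (simp add: mult.assoc [symmetric] power_mult_distrib [symmetric] del: power_Suc)
  finally have 1: "((1 - \<eta>) / (1 + \<eta>)) ^ Suc m * OPT \<le> opt_blocks exponent W" .
  have "\<eta> * real (Suc m) \<le> \<eta> * log 2 (real W)" using m eta by (intro mult_left_mono) auto
  also have "\<dots> = \<epsilon> / 10" by (rule eta_par_bounds[OF W_ge_2 eps])
  \<comment> \<open>The total loss is at most 2 * \<epsilon> / 10. Bernoulli's inequality then turns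
    the sum of the losses into the product of the factors.\<close>
  finally have "1 - \<epsilon> \<le> 1 + real (Suc m) * (- 2 * \<eta>)" using eps by (simp add: algebra_simps)
  also have "\<dots> \<le> (1 + (- 2 * \<eta>)) ^ Suc m"
    using eta_par_bounds(2)[OF W_ge_2 eps] by (intro Bernoulli_inequality) auto
  also have "\<dots> \<le> ((1 - \<eta>) / (1 + \<eta>)) ^ Suc m"
    using eta_par_bounds(1,2)[OF W_ge_2 eps] by (intro power_mono) (auto simp: field_simps)
  finally have "(1 - \<epsilon>) * OPT \<le> ((1 - \<eta>) / (1 + \<eta>)) ^ Suc m * OPT"
    using sukp_opt_nonneg[OF fam, of W] by (intro mult_right_mono) auto
  with 1 show ?thesis by simp
qed

lemma delta_T_bounds: "0 < \<delta> * T" "\<delta> * T \<le> \<epsilon> / 100 * OPT"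
proof -
  show "0 < \<delta> * T" using T_pos eps n_ge_1 by (simp add: delta_par_def)
  have "\<delta> \<le> \<epsilon> / 100"
    using eps n_ge_1 mult_mono[of \<epsilon> 1 1 "real n"] by (simp add: delta_par_def power2_eq_square field_simps)
  then have "\<delta> * T \<le> \<epsilon> / 100 * T" using T_pos by (intro mult_right_mono) auto
  also have "\<dots> \<le> \<epsilon> / 100 * OPT" using T_par_bounds(2)[OF inst] eps by (intro mult_left_mono) auto
  finally show "\<delta> * T \<le> \<epsilon> / 100 * OPT" .
qed

text \<open>\<delta> = \<epsilon> / 10 * \<theta>, so the DP analysis applies with \<gamma> =
  \<epsilon> / 10.\<close>

lemma delta_T_le_cost:
  assumes "p < n"
  shows "\<delta> * T \<le> \<epsilon> / 10 * (c p * 2 ^ exponent p)"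
proof -
  have "\<delta> * T = \<epsilon> / 10 * (theta_par n \<epsilon> * T)"
    by (simp add: delta_par_def theta_par_def power2_eq_square)
  also have "\<dots> \<le> \<epsilon> / 10 * (c p * 2 ^ exponent p)"
    using exponent_bounds(2)[OF assms] eps by (intro mult_left_mono) auto
  finally show ?thesis .
qed

lemma rounded_opt_le: "(1 + \<epsilon> / 10) * opt_blocks exponent W \<le> (1 + \<epsilon> / 3) * OPT"
proof -
  have "(1 + \<epsilon> / 10) * opt_blocks exponent W \<le> (1 + \<epsilon> / 10) * ((1 + \<epsilon> / 5) * OPT)"
    using opt_blocks_upper eps by (intro mult_left_mono) auto
  also have "\<dots> = (1 + \<epsilon> / 10) * (1 + \<epsilon> / 5) * OPT" by simp
  \<comment> \<open>The product is 1 + 3 \<epsilon> / 10 + \<epsilon>^2 / 50, and \<epsilon>^2 \<le>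
    \<epsilon>.\<close>
  also have "(1 + \<epsilon> / 10) * (1 + \<epsilon> / 5) \<le> 1 + \<epsilon> / 3"
    using eps mult_mono[of \<epsilon> 1 \<epsilon> \<epsilon>] by (simp add: field_simps)
  finally show ?thesis
    using sukp_opt_nonneg[OF fam, of W] by (simp add: mult_right_mono)
qed

lemma sukp_alg_approx:
  assumes "sukp_alg K n W c X \<epsilon> = Some v"
  shows "(1 - \<epsilon>) * OPT \<le> v" "v \<le> (1 + \<epsilon>) * OPT"
proof -
  have out: "dp_output n W (\<lambda>p. c p * 2 ^ exponent p) (\<lambda>p. block W \<zeta> \<eta> (X p) (exponent p))
      (\<delta> * T) (dp_rounds K n \<epsilon>) = Some v"
    using assms by (simp add: sukp_alg_def Let_def exponent_def [abs_def])
  note b = dp_output_bounds[OF fam_blocks delta_T_bounds(1) delta_T_le_cost W_pos out, folded opt_blocks_def]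
  show "(1 - \<epsilon>) * OPT \<le> v" using opt_blocks_lower b(1) by simp
  have "v \<le> (1 + \<epsilon> / 3) * OPT + \<epsilon> / 100 * OPT"
    using b(2) rounded_opt_le delta_T_bounds(2) by linarith
  also have "\<dots> \<le> (1 + \<epsilon>) * OPT"
    using eps sukp_opt_nonneg[OF fam, of W] by (simp add: distrib_right mult_right_mono)
  finally show "v \<le> (1 + \<epsilon>) * OPT" .
qed

lemma sukp_alg_output:
  assumes "6 \<le> K"
  shows "\<exists>v. sukp_alg K n W c X \<epsilon> = Some v"
proof -
  \<comment> \<open>6 = 3 / 2 * 4: a bound on 1 + \<epsilon> / 3 times the bound on OPT / T.\<close>
  have "(1 + \<epsilon> / 3) * OPT \<le> 3 / 2 * (4 * T)"
    using eps T_par_bounds(3)[OF inst] sukp_opt_nonneg[OF fam, of W] by (intro mult_mono) auto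
  also have "\<dots> \<le> K / \<delta> * (\<delta> * T)"
    using assms delta_T_bounds(1) T_pos by (simp add: zero_less_mult_iff)
  also have "\<dots> \<le> real (dp_rounds K n \<epsilon>) * (\<delta> * T)"
    using delta_T_bounds(1) real_nat_ceiling_ge[of "K / \<delta>"]
    by (intro mult_right_mono) (auto simp: dp_rounds_def)
  finally have "(1 + \<epsilon> / 10) * opt_blocks exponent W \<le> real (dp_rounds K n \<epsilon>) * (\<delta> * T)"
    using rounded_opt_le by linarith
  note dp_output_exists[OF fam_blocks delta_T_bounds(1) delta_T_le_cost W_pos this[unfolded opt_blocks_def]]
  then show ?thesis by (simp add: sukp_alg_def Let_def exponent_def [abs_def])
qed

end

section \<open>Timed subroutines\<close>

lemma cost_charge [simp]: "cost (charge k x) = k"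
  by (simp add: charge_def)

lemma cost_bind_tm [simp]: "cost (bind_tm m f) = cost m + cost (f (val m))"
  by (simp add: bind_tm_def)

lemma val_query [simp]: "val (query D i j) = D i j" and cost_query [simp]: "cost (query D i j) = 1"
  by (simp_all add: query_def)

lemma val_sum_tm [simp]: "val (sum_tm f k) = (\<Sum>i<k. val (f i))"
  by (induction k) auto

lemma cost_sum_tm:
  assumes "\<And>i. i < k \<Longrightarrow> cost (f i) \<le> B"
  shows "cost (sum_tm f k) \<le> 1 + k * (B + 2)"
  using assms
proof (induction k)
  case (Suc k)
  have "cost (sum_tm f k) \<le> 1 + k * (B + 2)" by (rule Suc.IH) (simp add: Suc.prems)
  then show ?case using Suc.prems[of k] by simp
qed simp

lemma val_min_tm [simp]: "val (min_tm f k) = Min ((\<lambda>i. val (f i)) ` {..k})"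
proof (induction k)
  case (Suc k)
  have "Min ((\<lambda>i. val (f i)) ` {..Suc k}) = min (val (f (Suc k))) (Min ((\<lambda>i. val (f i)) ` {..k}))"
    unfolding atMost_Suc image_insert by (rule Min_insert) auto
  then show ?case using Suc by (simp add: min.commute)
qed simp

lemma cost_min_tm:
  assumes "\<And>i. i \<le> k \<Longrightarrow> cost (f i) \<le> B"
  shows "cost (min_tm f k) \<le> Suc k * (B + 2)"
  using assms
proof (induction k)
  case (Suc k)
  have "cost (min_tm f k) \<le> Suc k * (B + 2)" by (rule Suc.IH) (simp add: Suc.prems)
  then show ?case using Suc.prems[of "Suc k"] by simp
qed (use trans_le_add1 in auto)

lemma val_map_tm [simp]: "val (map_tm f xs) = map (\<lambda>x. val (f x)) xs"
  by (induction xs) auto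

lemma cost_map_tm:
  assumes "\<And>x. x \<in> set xs \<Longrightarrow> cost (f x) \<le> B"
  shows "cost (map_tm f xs) \<le> 1 + length xs * (B + 2)"
  using assms
proof (induction xs)
  case (Cons x xs)
  have "cost (map_tm f xs) \<le> 1 + length xs * (B + 2)" by (rule Cons.IH) (simp add: Cons.prems)
  then show ?case using Cons.prems[of x] by simp
qed simp

text \<open>The alternative that the result is \<open>lo\<close> reflects that \<open>P lo\<close>
  is never evaluated.\<close>

lemma bsearch_tm_correct:
  assumes "lo < hi" "\<And>x y. lo < x \<Longrightarrow> x \<le> y \<Longrightarrow> y < hi \<Longrightarrow> val (P y) \<Longrightarrow> val (P x)"
  shows "val (bsearch_tm P lo hi) < hi \<and>
    (val (bsearch_tm P lo hi) = lo \<or> val (P (val (bsearch_tm P lo hi)))) \<and>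
    (\<forall>x. val (bsearch_tm P lo hi) < x \<longrightarrow> x < hi \<longrightarrow> \<not> val (P x))"
  using assms
proof (induction "hi - lo" arbitrary: lo hi rule: less_induct)
  case less
  show ?case
  proof (cases "hi \<le> lo + 1")
    case True
    then show ?thesis using less.prems by (auto simp: bsearch_tm.simps [of P lo hi])
  next
    case False
    define m where "m = (lo + hi) div 2"
    have m: "lo < m" "m < hi" using False by (auto simp: m_def)
    show ?thesis
    proof (cases "val (P m)")
      case True
      then have eq: "val (bsearch_tm P lo hi) = val (bsearch_tm P m hi)"
        using False by (simp add: bsearch_tm.simps [of P lo hi] m_def [symmetric])
      have "hi - m < hi - lo" using m by simp
      note IH = less.hyps[OF this m(2)]
      have "val (bsearch_tm P m hi) < hi \<and>
          (val (bsearch_tm P m hi) = m \<or> val (P (val (bsearch_tm P m hi)))) \<and>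
          (\<forall>x. val (bsearch_tm P m hi) < x \<longrightarrow> x < hi \<longrightarrow> \<not> val (P x))"
        by (rule IH) (meson less.prems(2) m(1) less_trans)
      then show ?thesis using True unfolding eq by metis
    next
      case np: False
      then have eq: "val (bsearch_tm P lo hi) = val (bsearch_tm P lo m)"
        using False by (simp add: bsearch_tm.simps [of P lo hi] m_def [symmetric])
      have "m - lo < hi - lo" using m by simp
      note IH = less.hyps[OF this m(1)]
      have "val (bsearch_tm P lo m) < m \<and>
          (val (bsearch_tm P lo m) = lo \<or> val (P (val (bsearch_tm P lo m)))) \<and>
          (\<forall>x. val (bsearch_tm P lo m) < x \<longrightarrow> x < m \<longrightarrow> \<not> val (P x))"
        by (rule IH) (meson less.prems(2) m(2) less_trans)
      moreover have "\<not> val (P x)" if "m \<le> x" "x < hi" for x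
        using less.prems(2)[OF m(1) that] np by blast
      ultimately show ?thesis using m unfolding eq by (metis less_trans not_le)
    qed
  qed
qed

lemma cost_bsearch_tm:
  assumes "\<And>x. lo < x \<Longrightarrow> x < hi \<Longrightarrow> cost (P x) \<le> B" "hi - lo \<le> 2 ^ k"
  shows "cost (bsearch_tm P lo hi) \<le> k * (B + 4) + 2"
  using assms
proof (induction k arbitrary: lo hi)
  case 0
  then show ?case by (simp add: bsearch_tm.simps [of P lo hi])
next
  case (Suc k)
  show ?case
  proof (cases "hi \<le> lo + 1")
    case True
    then show ?thesis by (simp add: bsearch_tm.simps [of P lo hi])
  next
    case False
    define m where "m = (lo + hi) div 2"
    have m: "lo < m" "m < hi" "hi - m \<le> 2 ^ k" "m - lo \<le> 2 ^ k"
      using False Suc.prems(2) by (auto simp: m_def)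
    have P: "cost (P m) \<le> B" using Suc.prems(1) m by simp
    have 1: "cost (bsearch_tm P m hi) \<le> k * (B + 4) + 2"
      by (rule Suc.IH) (use Suc.prems(1) m in auto)
    have 2: "cost (bsearch_tm P lo m) \<le> k * (B + 4) + 2"
      by (rule Suc.IH) (use Suc.prems(1) m in auto)
    show ?thesis
      using False P 1 2 by (simp add: bsearch_tm.simps [of P lo hi] m_def [symmetric])
  qed
qed

section \<open>Expectations over plateau lists\<close>

text \<open>The function \<open>G\<close> denoted by the second list of \<open>expect_tm\<close>.
  The first breakpoint is never tested: the first value extends to all larger arguments.\<close>

fun step_fun :: "(nat \<times> real) list \<Rightarrow> nat \<Rightarrow> real" where
  "step_fun [] z = 0"
| "step_fun [(b, v)] z = v"
| "step_fun ((b, v) # (b', v') # g) z = (if z \<le> b' then step_fun ((b', v') # g) z else v)"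

text \<open>A step passed over for the atom at \<open>x\<close> is irrelevant for all later atoms
  \<open>y \<ge> x\<close>, because \<open>m - y \<le> m - x\<close>; so no backtracking is
  required.\<close>

lemma val_expect_tm:
  assumes "sorted (map fst as)"
  shows "val (expect_tm m as g) = (\<Sum>(x, p)\<leftarrow>as. p * step_fun g (m - x))"
  using assms
proof (induction m as g rule: expect_tm.induct)
  case (1 m x p as b v b' v' g)
  show ?case
  proof (cases "m \<le> x + b'")
    case True
    have eq: "step_fun ((b, v) # (b', v') # g) (m - y) = step_fun ((b', v') # g) (m - y)"
      if "(y, q) \<in> set ((x, p) # as)" for y q
    proof -
      have "x \<le> y" using "1.prems" that by force
      then have "m - y \<le> b'" using True by linarith
      then show ?thesis by (simp only: step_fun.simps if_True)
    qed
    have "(\<Sum>(x, p)\<leftarrow>(x, p) # as. p * step_fun ((b, v) # (b', v') # g) (m - x))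
        = (\<Sum>(x, p)\<leftarrow>(x, p) # as. p * step_fun ((b', v') # g) (m - x))"
      by (intro arg_cong[where f = sum_list] map_cong refl, clarify) (simp only: eq)
    then show ?thesis using True "1.IH"(1)[of True] "1.prems" by simp
  next
    case False
    then have "\<not> m - x \<le> b'" by linarith
    then have "step_fun ((b, v) # (b', v') # g) (m - x) = v" by (simp only: step_fun.simps if_False)
    then show ?thesis using False "1.IH"(2)[of False] "1.prems" by (simp del: step_fun.simps)
  qed
qed (auto simp: sum_list_0 case_prod_unfold)

lemma cost_expect_tm: "cost (expect_tm m as g) \<le> 8 * (length as + length g) + 1"
proof (induction m as g rule: expect_tm.induct)
  case (1 m x p as b v b' v' g)
  show ?case
  proof (cases "m \<le> x + b'")
    case True
    then show ?thesis using "1.IH"(1)[of True] by simp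
  next
    case False
    then show ?thesis using "1.IH"(2)[of False] by simp
  qed
qed auto

lemma step_fun_append_le:
  assumes "z \<le> b0" "\<And>b v. (b, v) \<in> set g \<Longrightarrow> b0 \<le> b"
  shows "step_fun (g @ [(b0, v0)]) z = v0"
  using assms
proof (induction g z rule: step_fun.induct)
  case (3 b v b' v' g z)
  then have "z \<le> b'" using order_trans by (metis list.set_intros)
  then show ?case using 3 by (auto simp del: append_Cons simp: append_Cons)
qed auto

lemma step_fun_append_gr:
  assumes "b0 < z" "g \<noteq> []"
  shows "step_fun (g @ [(b0, v0)]) z = step_fun g z"
  using assms by (induction g z rule: step_fun.induct) auto

section \<open>Plateau lists of non-increasing arrays\<close>

fun plateaus :: "nat \<Rightarrow> (nat \<Rightarrow> real) \<Rightarrow> nat \<Rightarrow> (nat \<times> real) list \<Rightarrow> bool" where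
  "plateaus W A j [] \<longleftrightarrow> W < j"
| "plateaus W A j ((b, v) # ps) \<longleftrightarrow>
     j \<le> b \<and> b \<le> W \<and> (\<forall>i\<in>{j..b}. A i = v) \<and> (\<forall>i\<in>{b<..W}. A i < v) \<and> plateaus W A (b + 1) ps"

lemma plateaus_cong:
  assumes "\<And>i. i \<in> {j..W} \<Longrightarrow> A i = A' i"
  shows "plateaus W A j ps \<longleftrightarrow> plateaus W A' j ps"
  using assms
proof (induction ps arbitrary: j)
  case (Cons bv ps)
  obtain b v where bv: "bv = (b, v)" by (cases bv)
  have "plateaus W A (b + 1) ps \<longleftrightarrow> plateaus W A' (b + 1) ps" if "j \<le> b"
    by (rule Cons.IH) (use Cons.prems that in auto)
  then show ?case using Cons.prems unfolding bv by auto
qed simp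

lemma plateaus_bounds: "plateaus W A j ps \<Longrightarrow> (b, v) \<in> set ps \<Longrightarrow> j \<le> b \<and> b \<le> W"
proof (induction ps arbitrary: j)
  case (Cons bv ps)
  then show ?case by (cases bv) (fastforce dest: Cons.IH)
qed simp

lemma plateaus_sorted: "plateaus W A j ps \<Longrightarrow> sorted (map fst ps)"
proof (induction ps arbitrary: j)
  case (Cons bv ps)
  obtain b v where bv: "bv = (b, v)" by (cases bv)
  have pl: "plateaus W A (b + 1) ps" using Cons.prems bv by simp
  have "b \<le> x" if "x \<in> set (map fst ps)" for x
    using that plateaus_bounds[OF pl] by fastforce
  then show ?case using Cons.IH[OF pl] bv by simp
qed simp

lemma plateaus_length:
  assumes "plateaus W A j ps"
  shows "length ps \<le> card (A ` {j..W})"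
  using assms
proof (induction ps arbitrary: j)
  case (Cons bv ps)
  obtain b v where bv: "bv = (b, v)" by (cases bv)
  have pl: "plateaus W A (b + 1) ps" and v: "A j = v" "\<forall>i\<in>{b<..W}. A i < v" "j \<le> b" "b \<le> W"
    using Cons.prems bv by auto
  have "v \<notin> A ` {b + 1..W}" using v(2) by fastforce
  then have "Suc (card (A ` {b + 1..W})) = card (insert v (A ` {b + 1..W}))" by simp
  also have "\<dots> \<le> card (A ` {j..W})" using v by (intro card_mono) auto
  finally show ?case using Cons.IH[OF pl] bv by simp
qed simp

text \<open>Used with \<open>b0 = 0\<close> and \<open>v0 = 1\<close>, where the reversed list
  denotes a tail function with value 1 at 0; a general first entry is kept for the
  induction.\<close>

lemma step_fun_plateaus:
  assumes "plateaus W A (b0 + 1) ps" "z \<le> W"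
  shows "step_fun (rev ((b0, v0) # ps)) z = (if z \<le> b0 then v0 else A z)"
  using assms
proof (induction ps arbitrary: b0 v0)
  case (Cons bv ps)
  obtain b v where bv: "bv = (b, v)" by (cases bv)
  have *: "b0 \<le> b'" if "(b', v') \<in> set (rev (bv # ps))" for b' v'
    using plateaus_bounds[OF Cons.prems(1), of b' v'] that by simp
  show ?case
  proof (cases "z \<le> b0")
    case True
    then show ?thesis using step_fun_append_le[of z b0 "rev (bv # ps)" v0] * by simp
  next
    case False
    have pl: "plateaus W A (b + 1) ps" and v: "\<forall>i\<in>{b0 + 1..b}. A i = v"
      using Cons.prems bv by auto
    have "step_fun (rev ((b0, v0) # bv # ps)) z = step_fun (rev (bv # ps)) z"
      using step_fun_append_gr[of b0 z "rev (bv # ps)" v0] False by simp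
    also have "\<dots> = (if z \<le> b then v else A z)"
      unfolding bv by (rule Cons.IH[OF pl Cons.prems(2)])
    finally show ?thesis using v False by auto
  qed
qed auto

lemma map_fst_atoms_tm: "map fst (val (atoms_tm ps)) = map fst ps"
  by (induction ps rule: atoms_tm.induct) auto

lemma length_atoms_tm: "length (val (atoms_tm ps)) = length ps"
  using map_fst_atoms_tm[of ps] by (metis length_map)

lemma cost_atoms_tm: "cost (atoms_tm ps) \<le> 4 * length ps + 1"
  by (induction ps rule: atoms_tm.induct) auto

lemma sum_plateau:
  fixes A h :: "nat \<Rightarrow> real"
  assumes "j \<le> b" "\<forall>i\<in>{j..b}. A i = v"
  shows "(\<Sum>x=j..b. (A x - A (Suc x)) * h x) = (v - A (Suc b)) * h b"
proof -
  have "(\<Sum>x=j..b. (A x - A (Suc x)) * h x) = (\<Sum>x\<in>{b}. (A x - A (Suc x)) * h x)"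
    using assms by (intro sum.mono_neutral_right) auto
  then show ?thesis using assms by simp
qed

text \<open>The array drops only at plateau ends, so all other differences vanish. The condition at
  \<open>Suc W\<close> makes the last plateau value the mass of the last atom.\<close>

lemma sum_atoms_tm:
  assumes "plateaus W A j ps" "A (Suc W) = 0"
  shows "(\<Sum>(x, p)\<leftarrow>val (atoms_tm ps). p * h x) = (\<Sum>x=j..W. (A x - A (Suc x)) * h x)"
  using assms(1)
proof (induction ps arbitrary: j rule: atoms_tm.induct)
  case (2 b v)
  then have "b = W" by auto
  then show ?case using 2 assms(2) sum_plateau[of j b A v h] by auto
next
  case (3 b v b' v' ps)
  then have pl: "plateaus W A (b + 1) ((b', v') # ps)" and v: "j \<le> b" "\<forall>i\<in>{j..b}. A i = v"
    and v': "A (Suc b) = v'" "b \<le> W"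
    by auto
  have split: "{j..W} = {j..b} \<union> {b + 1..W}" using v v' by auto
  have "(\<Sum>x=j..W. (A x - A (Suc x)) * h x)
      = (\<Sum>x=j..b. (A x - A (Suc x)) * h x) + (\<Sum>x=b+1..W. (A x - A (Suc x)) * h x)"
    unfolding split by (rule sum.union_disjoint) auto
  then show ?case using "3.IH"[OF pl] sum_plateau[OF v, of h] v' by simp
qed auto

lemma sum_atoms_pmf:
  assumes "plateaus W (Dist p) 1 ps" "set_pmf p \<subseteq> {1..W}"
  shows "(\<Sum>(x, q)\<leftarrow>val (atoms_tm ps). q * h x) = (\<Sum>x=1..W. pmf p x * h x)"
proof -
  have "set_pmf p \<subseteq> {..<Suc W}" using assms(2) by auto
  then show ?thesis
    using sum_atoms_tm[OF assms(1), of h] by (simp add: Dist_eq_0 flip: pmf_eq_Dist)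
qed

lemma Dist_indep_sum:
  assumes "set_pmf p \<subseteq> {1..W}" "finite (set_pmf q)"
  shows "Dist (indep_sum p q) m = (\<Sum>x=1..W. pmf p x * Dist q (m - x))"
proof -
  \<comment> \<open>A tail is the expectation of the indicator of remaining weight 0, since
    \<open>m - k = 0\<close> iff \<open>m \<le> k\<close>; the convolution formula is thus a case of
    \<open>expect_rest_indep_sum\<close>.\<close>
  have Dist_expect_rest: "Dist r m = expect_rest r (\<lambda>z. indicator {0} z) m" for r and m :: nat
  proof -
    have "indicator {0} (m - k) = (indicator {m..} k :: real)" for k by (auto simp: indicator_def)
    then show ?thesis by (simp add: Dist_def expect_rest_def)
  qed
  have fin: "finite (set_pmf p)" using assms(1) finite_subset by blast
  have "Dist (indep_sum p q) m = expect_rest p (Dist q) m"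
    unfolding Dist_expect_rest [abs_def] by (rule expect_rest_indep_sum[OF fin assms(2)])
  also have "\<dots> = (\<Sum>x=1..W. pmf p x * Dist q (m - x))"
    unfolding expect_rest_def using assms(1)
    by (subst integral_measure_pmf_real[of "{1..W}"]) (auto simp: mult.commute)
  finally show ?thesis .
qed

section \<open>Timed computation of the blocks\<close>

text \<open>Each plateau costs one entry, \<open>k\<close> probes of a binary search and list
  overhead: 17 = 11 + 2 + 4 and 16 = 12 + 4. Hence the cost is stated through the length of the
  output.\<close>

lemma compress_tm_correct:
  assumes eta: "0 < \<eta>" and zeta: "0 \<le> \<zeta>"
    and a: "\<And>j. 1 \<le> j \<Longrightarrow> j \<le> W \<Longrightarrow> val (a j) = A j"
    and anti: "\<And>i j. 1 \<le> i \<Longrightarrow> i \<le> j \<Longrightarrow> j \<le> W \<Longrightarrow> A j \<le> A i"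
    and cost_a: "\<And>j. cost (a j) \<le> B" and k: "W \<le> 2 ^ k"
  shows "1 \<le> j \<Longrightarrow> plateaus W (\<lambda>i. approx_entry \<zeta> \<eta> (A i)) j (val (compress_tm W \<zeta> \<eta> a j)) \<and>
    cost (compress_tm W \<zeta> \<eta> a j)
      \<le> 2 + length (val (compress_tm W \<zeta> \<eta> a j)) * (B + 17 + k * (B + 16))"
proof (induction "W + 1 - j" arbitrary: j rule: less_induct)
  case less
  let ?A = "\<lambda>i. approx_entry \<zeta> \<eta> (A i)"
  show ?case
  proof (cases "W < j")
    case True
    then show ?thesis by (simp add: compress_tm.simps [of W _ _ _ j])
  next
    case False
    define P where "P m = bind_tm (a m) (\<lambda>y. bind_tm (approx_entry_tm \<zeta> \<eta> y)
      (\<lambda>u. charge 1 (u = ?A j)))" for m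
    define b where "b = val (bsearch_tm P j (W + 1))"
    define ps where "ps = val (compress_tm W \<zeta> \<eta> a (b + 1))"
    have P: "val (P m) \<longleftrightarrow> ?A m = ?A j" if "j \<le> m" "m \<le> W" for m
      using that less.prems by (simp add: P_def approx_entry_tm_def a)
    have anti': "?A m' \<le> ?A m" if "1 \<le> m" "m \<le> m'" "m' \<le> W" for m m'
      using that by (intro approx_entry_mono[OF eta zeta] anti)
    \<comment> \<open>The entries do not increase, so agreement with the first entry at
      \<open>y\<close> forces agreement at every earlier index.\<close>
    have down: "val (P x)" if "j < x" "x \<le> y" "y < W + 1" "val (P y)" for x y
      using P[of x] P[of y] that anti'[of j x] anti'[of x y] less.prems by simp
    have "b < W + 1 \<and> (b = j \<or> val (P b)) \<and> (\<forall>x. b < x \<longrightarrow> x < W + 1 \<longrightarrow> \<not> val (P x))"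
      unfolding b_def using False down by (intro bsearch_tm_correct) auto
    then have b: "b \<le> W" "b = j \<or> val (P b)" "\<And>x. b < x \<Longrightarrow> x \<le> W \<Longrightarrow> \<not> val (P x)" by auto
    have jb: "j \<le> b" unfolding b_def by (rule bsearch_tm_ge)
    have eq: "?A i = ?A j" if "j \<le> i" "i \<le> b" for i
      using anti'[of j i] anti'[of i b] b P[of b] jb less.prems that by fastforce
    have lt: "?A i < ?A j" if "b < i" "i \<le> W" for i
      using b(3)[OF that] P[of i] anti'[of j i] jb less.prems that by fastforce
    have val: "val (compress_tm W \<zeta> \<eta> a j) = (b, ?A j) # ps"
      using False less.prems
      by (simp add: compress_tm.simps [of W _ _ _ j] approx_entry_tm_def a ps_def b_def P_def [abs_def])
    have cost: "cost (compress_tm W \<zeta> \<eta> a j)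
        = cost (a j) + 11 + cost (bsearch_tm P j (W + 1)) + cost (compress_tm W \<zeta> \<eta> a (b + 1)) + 4"
      using False less.prems
      by (simp add: compress_tm.simps [of W _ _ _ j] approx_entry_tm_def a b_def P_def [abs_def])
    have costP: "cost (bsearch_tm P j (W + 1)) \<le> k * ((B + 12) + 4) + 2"
    proof (rule cost_bsearch_tm)
      show "cost (P x) \<le> B + 12" for x using cost_a[of x] by (simp add: P_def approx_entry_tm_def)
      show "W + 1 - j \<le> 2 ^ k" using k less.prems by simp
    qed
    have IH: "plateaus W ?A (b + 1) ps \<and>
        cost (compress_tm W \<zeta> \<eta> a (b + 1)) \<le> 2 + length ps * (B + 17 + k * (B + 16))"
      unfolding ps_def using jb False by (intro less.hyps) auto
    have "\<forall>i\<in>{j..b}. ?A i = ?A j" "\<forall>i\<in>{b<..W}. ?A i < ?A j"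
      using eq lt by (meson atLeastAtMost_iff greaterThanAtMost_iff)+
    then have "plateaus W ?A j ((b, ?A j) # ps)" using IH b(1) jb by (simp only: plateaus.simps)
    moreover have "k * (B + 12 + 4) = k * (B + 16)" by simp
    then have "cost (compress_tm W \<zeta> \<eta> a j)
        \<le> (B + 17 + k * (B + 16)) + (2 + length ps * (B + 17 + k * (B + 16)))"
      unfolding cost using costP cost_a[of j] IH by linarith
    ultimately show ?thesis unfolding val by (simp del: plateaus.simps)
  qed
qed

lemma cdf_oracle_eq_Dist: "1 - cdf_oracle X i (j - 1) = Dist (X i) j" if "1 \<le> j"
proof -
  have "{..j - 1} = UNIV - {j..}" using that by auto
  then have "cdf_oracle X i (j - 1) = measure_pmf.prob (X i) (space (measure_pmf (X i)) - {j..})"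
    by (simp add: cdf_oracle_def)
  also have "\<dots> = 1 - Dist (X i) j"
    unfolding Dist_def by (rule measure_pmf.prob_compl) simp
  finally show ?thesis by simp
qed

text \<open>With the products taken as atoms, linear arithmetic can absorb all lower monomials into
  \<open>Z * k * Z\<close>.\<close>

lemma product_bounds:
  fixes Z k :: nat
  assumes "2 \<le> Z" "1 \<le> k"
  shows "2 \<le> Z * k" "Z \<le> Z * k" "2 * (Z * k) \<le> Z * k * Z" "Z * Z \<le> Z * k * Z"
  using mult_le_mono[OF assms] mult_le_mono[OF order_refl assms(2), of Z]
    mult_le_mono[OF order_refl assms(1), of "Z * k"] mult_le_mono[OF order_refl assms(2), of "Z * Z"]
  by (simp_all add: mult_ac)

context block_params
begin

definition plateau_bound :: nat where
  "plateau_bound = nat \<lfloor>\<zeta>\<rfloor> + 2"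

lemma Dist_block_approx:
  assumes "p < n"
  obtains q where "\<And>j. j \<in> {1..W} \<Longrightarrow> Dist (block W \<zeta> \<eta> (X p) i) j = approx_entry \<zeta> \<eta> (Dist q j)"
  using Dist_block_0[OF eta(1) zeta W_pos supp[OF assms]]
    Dist_block_Suc[OF eta(1) zeta W_pos supp[OF assms]]
  by (cases i) blast+

lemma length_plateaus_block:
  assumes "p < n" "plateaus W (Dist (block W \<zeta> \<eta> (X p) i)) 1 ps"
  shows "length ps \<le> plateau_bound"
proof -
  obtain q where q: "\<And>j. j \<in> {1..W} \<Longrightarrow>
      Dist (block W \<zeta> \<eta> (X p) i) j = approx_entry \<zeta> \<eta> (Dist q j)"
    using Dist_block_approx assms(1) by blast
  have "length ps \<le> card (Dist (block W \<zeta> \<eta> (X p) i) ` {1..W})" by (rule plateaus_length[OF assms(2)])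
  also have "\<dots> \<le> card (approx_entry \<zeta> \<eta> ` {..1})"
  proof (rule card_mono)
    show "finite (approx_entry \<zeta> \<eta> ` {..1})" by (rule approx_entry_values[OF eta(1) zeta])
    show "Dist (block W \<zeta> \<eta> (X p) i) ` {1..W} \<subseteq> approx_entry \<zeta> \<eta> ` {..1}"
    proof
      fix y assume "y \<in> Dist (block W \<zeta> \<eta> (X p) i) ` {1..W}"
      then obtain j where "y = approx_entry \<zeta> \<eta> (Dist q j)" using q by auto
      then show "y \<in> approx_entry \<zeta> \<eta> ` {..1}" using Dist_le_1 by auto
    qed
  qed
  also have "\<dots> \<le> plateau_bound"
  proof -
    have "real (card (approx_entry \<zeta> \<eta> ` {..1})) \<le> \<zeta> + 2"
      by (rule approx_entry_values[OF eta(1) zeta])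
    then show ?thesis unfolding plateau_bound_def using zeta by linarith
  qed
  finally show ?thesis .
qed

lemma compress_tm_block:
  assumes p: "p < n"
    and a: "\<And>j. 1 \<le> j \<Longrightarrow> j \<le> W \<Longrightarrow> val (a j) = Dist q j"
    and q: "\<And>j. j \<in> {1..W} \<Longrightarrow> Dist (block W \<zeta> \<eta> (X p) i) j = approx_entry \<zeta> \<eta> (Dist q j)"
    and cost_a: "\<And>j. cost (a j) \<le> B" and k: "W \<le> 2 ^ k"
  shows "plateaus W (Dist (block W \<zeta> \<eta> (X p) i)) 1 (val (compress_tm W \<zeta> \<eta> a 1))"
    "cost (compress_tm W \<zeta> \<eta> a 1) \<le> 2 + plateau_bound * (B + 17 + k * (B + 16))"
proof -
  have *: "plateaus W (\<lambda>i. approx_entry \<zeta> \<eta> (Dist q i)) 1 (val (compress_tm W \<zeta> \<eta> a 1)) \<and>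
      cost (compress_tm W \<zeta> \<eta> a 1)
        \<le> 2 + length (val (compress_tm W \<zeta> \<eta> a 1)) * (B + 17 + k * (B + 16))"
    using a cost_a k by (intro compress_tm_correct[OF eta(1) zeta] Dist_antimono) auto
  then show pl: "plateaus W (Dist (block W \<zeta> \<eta> (X p) i)) 1 (val (compress_tm W \<zeta> \<eta> a 1))"
    using q by (subst plateaus_cong) auto
  have "length (val (compress_tm W \<zeta> \<eta> a 1)) * (B + 17 + k * (B + 16))
      \<le> plateau_bound * (B + 17 + k * (B + 16))"
    by (intro mult_le_mono1 length_plateaus_block[OF p pl])
  with * show "cost (compress_tm W \<zeta> \<eta> a 1) \<le> 2 + plateau_bound * (B + 17 + k * (B + 16))"
    by linarith
qed

text \<open>Value and cost are proved together, because the cost of a doubling depends on the length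
  of the preceding list. One level evaluates O(Z * k) entries at O(Z) each, where Z is
  \<open>plateau_bound\<close>.\<close>

lemma block_tm_correct:
  assumes p: "p < n" and k: "W \<le> 2 ^ k" "1 \<le> k"
  shows "plateaus W (Dist (block W \<zeta> \<eta> (X p) i)) 1 (val (block_tm W \<zeta> \<eta> (cdf_oracle X) p i)) \<and>
    cost (block_tm W \<zeta> \<eta> (cdf_oracle X) p i) \<le> Suc i * (93 * plateau_bound ^ 2 * k)"
proof (induction i)
  have Z: "2 \<le> plateau_bound" by (simp add: plateau_bound_def)
  case 0
  define a where "a j = bind_tm (query (cdf_oracle X) p (j - 1)) (\<lambda>x. charge 2 (1 - x))" for j
  have val_a: "val (a j) = Dist (X p) j" if "1 \<le> j" "j \<le> W" for j
    using cdf_oracle_eq_Dist[OF that(1)] by (simp add: a_def)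
  have cost_a: "cost (a j) \<le> 3" for j by (simp add: a_def)
  note c = compress_tm_block[OF p val_a Dist_block_0[OF eta(1) zeta W_pos supp[OF p]] cost_a k(1)]
  have "2 + plateau_bound * (3 + 17 + k * (3 + 16)) \<le> Suc 0 * (93 * plateau_bound ^ 2 * k)"
  proof -
    have "2 + plateau_bound * (3 + 17 + k * (3 + 16)) = 2 + 20 * plateau_bound + 19 * (plateau_bound * k)"
      by (simp add: algebra_simps)
    also have "\<dots> \<le> 93 * (plateau_bound * k * plateau_bound)"
      using product_bounds[OF Z k(2)] by linarith
    finally show ?thesis by (simp add: power2_eq_square mult_ac)
  qed
  then show ?case using c by (simp add: a_def [abs_def] del: block.simps)
next
  case (Suc i)
  define Z where "Z = plateau_bound"
  define ps where "ps = val (block_tm W \<zeta> \<eta> (cdf_oracle X) p i)"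
  define as where "as = val (atoms_tm ps)"
  define g where "g = rev ((0, 1) # ps)"
  let ?B = "block W \<zeta> \<eta> (X p) i"
  have pl: "plateaus W (Dist ?B) 1 ps" using Suc by (simp add: ps_def)
  have len: "length ps \<le> Z" unfolding Z_def by (rule length_plateaus_block[OF p pl])
  have Z: "2 \<le> Z" by (simp add: plateau_bound_def Z_def)
  have val: "val (expect_tm m as g) = Dist (indep_sum ?B ?B) m" if "m \<le> W" for m
  proof -
    have "sorted (map fst as)" using plateaus_sorted[OF pl] by (simp add: as_def map_fst_atoms_tm)
    then have "val (expect_tm m as g) = (\<Sum>(x, p)\<leftarrow>as. p * step_fun g (m - x))"
      by (rule val_expect_tm)
    also have "\<dots> = (\<Sum>x=1..W. pmf ?B x * step_fun g (m - x))"
      unfolding as_def by (rule sum_atoms_pmf[OF pl set_block'[OF p]])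
    also have "\<dots> = (\<Sum>x=1..W. pmf ?B x * Dist ?B (m - x))"
    proof (rule sum.cong)
      fix x
      have "step_fun g (m - x) = Dist ?B (m - x)"
        unfolding g_def using step_fun_plateaus[of W "Dist ?B" 0 ps "m - x" 1] pl that by simp
      then show "pmf ?B x * step_fun g (m - x) = pmf ?B x * Dist ?B (m - x)" by simp
    qed simp
    also have "\<dots> = Dist (indep_sum ?B ?B) m"
      by (rule Dist_indep_sum[OF set_block'[OF p] finite_block[OF p], symmetric])
    finally show ?thesis .
  qed
  \<comment> \<open>There are at most \<open>Z\<close> atoms and \<open>Z + 1\<close> steps, the
    extra one being \<open>(0, 1)\<close>: 8 * (2 * Z + 1) + 1.\<close>
  have cost: "cost (expect_tm m as g) \<le> 16 * Z + 9" for m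
    using cost_expect_tm[of m as g] len by (simp add: as_def g_def length_atoms_tm)
  note c = compress_tm_block[OF p val Dist_block_Suc[OF eta(1) zeta W_pos supp[OF p]] cost k(1)]
  have "cost (block_tm W \<zeta> \<eta> (cdf_oracle X) p (Suc i))
      = cost (block_tm W \<zeta> \<eta> (cdf_oracle X) p i) + cost (atoms_tm ps) + (length ps + 1)
        + cost (compress_tm W \<zeta> \<eta> (\<lambda>m. expect_tm m as g) 1) + 1"
    by (simp add: double_tm_def ps_def as_def g_def)
  also have "\<dots> \<le> Suc i * (93 * Z ^ 2 * k) + (4 * Z + 1) + (Z + 1)
      + (2 + Z * (16 * Z + 9 + 17 + k * (16 * Z + 9 + 16))) + 1"
    using Suc c(2) cost_atoms_tm[of ps] len by (simp add: Z_def)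
  also have "\<dots> \<le> Suc i * (93 * Z ^ 2 * k) + 93 * Z ^ 2 * k"
  proof -
    have "(4 * Z + 1) + (Z + 1) + (2 + Z * (16 * Z + 9 + 17 + k * (16 * Z + 9 + 16))) + 1
        = 5 + 31 * Z + 16 * (Z * Z) + 16 * (Z * k * Z) + 25 * (Z * k)"
      by (simp add: algebra_simps)
    \<comment> \<open>93 is the sum of the coefficients 5 + 31 + 16 + 16 + 25.\<close>
    also have "\<dots> \<le> 93 * (Z * k * Z)" using product_bounds[OF Z k(2)] by linarith
    finally show ?thesis by (simp add: power2_eq_square mult_ac)
  qed
  finally have "cost (block_tm W \<zeta> \<eta> (cdf_oracle X) p (Suc i)) \<le> Suc (Suc i) * (93 * plateau_bound ^ 2 * k)"
    by (simp add: Z_def)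
  moreover have "val (block_tm W \<zeta> \<eta> (cdf_oracle X) p (Suc i)) = val (compress_tm W \<zeta> \<eta> (\<lambda>m. expect_tm m as g) 1)"
    by (simp add: double_tm_def ps_def as_def g_def)
  ultimately show ?case using c(1) by simp
qed

end

section \<open>The timed Subroutine DP\<close>

definition dp_history :: "(nat \<Rightarrow> nat) \<Rightarrow> real \<Rightarrow> nat \<Rightarrow> (nat \<times> real) list" where
  "dp_history f u i = map (\<lambda>j. (f j, real j * u)) (rev [0..<i])"

lemma dp_history_Suc: "dp_history f u (Suc i) = (f i, real i * u) # dp_history f u i"
  by (simp add: dp_history_def)

text \<open>The thresholds of the earlier rounds with their values, below a top step of value
  \<open>i * u\<close>, already denote the rank function; so the history list serves directly as
  input of \<open>expect_tm\<close>.\<close>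

lemma step_fun_dp_history:
  assumes "\<And>j k. j \<le> k \<Longrightarrow> f j \<le> f k"
  shows "step_fun ((b, real i * u) # dp_history f u i) z = real (rank f i z) * u"
proof (induction i arbitrary: b)
  case 0
  then show ?case by (simp add: dp_history_def rank_def)
next
  case (Suc i)
  show ?case
  proof (cases "z \<le> f i")
    case True
    then show ?thesis using Suc by (simp add: dp_history_Suc rank_Suc)
  next
    case False
    then have "\<not> rank f (Suc i) z \<le> i"
      using rank_le_iff[of "Suc i" f i z] assms by simp
    then have "rank f (Suc i) z = Suc i" using rank_le[of f "Suc i" z] by simp
    then show ?thesis using False by (simp add: dp_history_Suc)
  qed
qed

lemma val_feasible_tm:
  assumes "\<And>c as. (c, as) \<in> set ts \<Longrightarrow> sorted (map fst as)"
  shows "val (feasible_tm v m g ts) \<longleftrightarrow>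
    (\<exists>(c, as)\<in>set ts. c + (\<Sum>(x, p)\<leftarrow>as. p * step_fun g (m - x)) \<le> v)"
  using assms
proof (induction v m g ts rule: feasible_tm.induct)
  case (2 v m g c as ts)
  have "sorted (map fst as)" using "2.prems" by auto
  note val = val_expect_tm[OF this]
  show ?case
  proof (cases "c + (\<Sum>(x, p)\<leftarrow>as. p * step_fun g (m - x)) \<le> v")
    case True
    then show ?thesis by (simp add: val)
  next
    case False
    then have "val (feasible_tm v m g ts) \<longleftrightarrow>
        (\<exists>(c, as)\<in>set ts. c + (\<Sum>(x, p)\<leftarrow>as. p * step_fun g (m - x)) \<le> v)"
      using "2.prems" by (intro "2.IH") (auto simp: val)
    then show ?thesis using False by (simp add: val)
  qed
qed simp

lemma cost_feasible_tm:
  assumes "\<And>c as. (c, as) \<in> set ts \<Longrightarrow> length as \<le> Z"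
  shows "cost (feasible_tm v m g ts) \<le> length ts * (8 * (Z + length g) + 5) + 1"
  using assms
proof (induction v m g ts rule: feasible_tm.induct)
  case (2 v m g c as ts)
  have "length as \<le> Z" using "2.prems" by auto
  then have e: "cost (expect_tm m as g) \<le> 8 * (Z + length g) + 1"
    using cost_expect_tm[of m as g] by simp
  show ?case
  proof (cases "c + val (expect_tm m as g) \<le> v")
    case True
    then show ?thesis using e by simp
  next
    case False
    then have "cost (feasible_tm v m g ts) \<le> length ts * (8 * (Z + length g) + 5) + 1"
      using "2.prems" by (intro "2.IH") auto
    then show ?thesis using False e by simp
  qed
qed simp

locale dp_instance =
  fixes n W :: nat and c :: "nat \<Rightarrow> real" and Y :: "nat \<Rightarrow> nat pmf" and u :: real
    and ts :: "(real \<times> (nat \<times> real) list) list"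
    and pl :: "nat \<Rightarrow> (nat \<times> real) list" and Z :: nat
  assumes fam: "item_family n c Y" and u: "0 < u" and supp: "\<And>p. p < n \<Longrightarrow> set_pmf (Y p) \<subseteq> {1..W}"
    and ts: "ts = map (\<lambda>p. (c p, val (atoms_tm (pl p)))) [0..<n]"
    and pl: "\<And>p. p < n \<Longrightarrow> plateaus W (Dist (Y p)) 1 (pl p) \<and> length (pl p) \<le> Z"
begin

abbreviation "F \<equiv> dp_f n W c Y u"

lemma val_feasible:
  assumes "m \<le> W" "1 \<le> i"
  shows "val (feasible_tm (real i * u) m ((W, real i * u) # dp_history F u i) ts)
    \<longleftrightarrow> dp_admissible n W c Y u i m"
proof -
  let ?g = "(W, real i * u) # dp_history F u i"
  have eq: "(\<Sum>(x, q)\<leftarrow>val (atoms_tm (pl p)). q * step_fun ?g (m - x))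
      = expect_rest (Y p) (\<lambda>x. real (rank F i x) * u) m" if "p < n" for p
  proof -
    have "0 \<notin> set_pmf (Y p)" using supp[OF that] by auto
    then have "(\<Sum>x=1..W. pmf (Y p) x * (real (rank F i (m - x)) * u))
        = expect_rest (Y p) (\<lambda>x. real (rank F i x) * u) m"
      using assms by (intro expect_rest_sum) auto
    then show ?thesis
      using sum_atoms_pmf[of W "Y p" "pl p" "\<lambda>x. step_fun ?g (m - x)"] pl[OF that] supp[OF that]
        step_fun_dp_history[of F, OF dp_f_mono[OF fam u]]
      by simp
  qed
  have "sorted (map fst as)" if das: "(d, as) \<in> set ts" for d as
  proof -
    obtain p where "p < n" "as = val (atoms_tm (pl p))" using das by (auto simp: ts)
    then show ?thesis using plateaus_sorted[of W "Dist (Y p)" 1 "pl p"] pl by (simp add: map_fst_atoms_tm)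
  qed
  then show ?thesis
    by (subst val_feasible_tm) (auto simp: ts dp_admissible_def[OF fam u] eq)
qed

text \<open>Starting at 0 without a test there reproduces the convention that an empty maximum is
  0.\<close>

lemma val_bsearch_feasible:
  assumes "1 \<le> i"
  shows "val (bsearch_tm (\<lambda>m. feasible_tm (real i * u) m ((W, real i * u) # dp_history F u i) ts) 0 (W + 1))
    = F i"
proof -
  let ?P = "\<lambda>m. feasible_tm (real i * u) m ((W, real i * u) # dp_history F u i) ts"
  let ?r = "val (bsearch_tm ?P 0 (W + 1))"
  have P: "val (?P m) \<longleftrightarrow> m \<le> F i" if "1 \<le> m" "m \<le> W" for m
    using val_feasible[OF that(2) assms] le_dp_f_iff[OF fam u assms that] by simp
  have "?r < W + 1 \<and> (?r = 0 \<or> val (?P ?r)) \<and> (\<forall>x. ?r < x \<longrightarrow> x < W + 1 \<longrightarrow> \<not> val (?P x))"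
    by (rule bsearch_tm_correct) (use P in auto)
  then have r: "?r \<le> W" "?r = 0 \<or> val (?P ?r)" "\<And>x. ?r < x \<Longrightarrow> x \<le> W \<Longrightarrow> \<not> val (?P x)" by auto
  have "F i \<in> insert 0 {w \<in> {0..W}. dp_admissible n W c Y u i w}"
    unfolding dp_f_eq[OF fam u assms] by (intro Max_in) auto
  then have F: "F i \<le> W" by auto
  have "?r \<le> F i" using r(1,2) P[of ?r] by (cases "?r = 0") auto
  moreover have "F i \<le> ?r"
  proof (rule ccontr)
    assume "\<not> F i \<le> ?r"
    then have "?r < F i" "1 \<le> F i" by linarith+
    then show False using r(3)[OF _ F] P[OF _ F] by blast
  qed
  ultimately show ?thesis by simp
qed

lemma dp_tm_correct:
  assumes "1 \<le> i"
  shows "val (dp_tm W ts u r i (dp_history F u i)) =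
    (if \<exists>j\<in>{i..<i + r}. W \<le> F j then Some (real (LEAST j. j \<in> {i..<i + r} \<and> W \<le> F j) * u) else None)"
  using assms
proof (induction r arbitrary: i)
  case (Suc r)
  note val = val_bsearch_feasible[OF Suc.prems, folded Suc_eq_plus1]
  show ?case
  proof (cases "W \<le> F i")
    case True
    have "(LEAST j. j \<in> {i..<i + Suc r} \<and> W \<le> F j) = i"
      by (rule Least_equality) (use True in auto)
    moreover have "\<exists>j\<in>{i..<i + Suc r}. W \<le> F j" using True by auto
    ultimately show ?thesis using True by (simp add: val)
  next
    case False
    have eq: "(j \<in> {i..<i + Suc r} \<and> W \<le> F j) \<longleftrightarrow> (j \<in> {Suc i..<Suc i + r} \<and> W \<le> F j)" for j
      using False by (cases "j = i") auto
    have "val (dp_tm W ts u (Suc r) i (dp_history F u i))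
        = val (dp_tm W ts u r (Suc i) (dp_history F u (Suc i)))"
      using False by (simp add: val dp_history_Suc)
    also have "\<dots> = (if \<exists>j\<in>{Suc i..<Suc i + r}. W \<le> F j
        then Some (real (LEAST j. j \<in> {Suc i..<Suc i + r} \<and> W \<le> F j) * u) else None)"
      by (rule Suc.IH) simp
    finally show ?thesis unfolding Bex_def eq .
  qed
qed simp

text \<open>\<open>M\<close> bounds the length of the step list in all remaining rounds, which gives
  one cost bound for every round.\<close>

lemma cost_dp_tm:
  assumes "1 \<le> i" "W + 1 \<le> 2 ^ k" "i + r \<le> M"
  shows "cost (dp_tm W ts u r i (dp_history F u i)) \<le> r * (k * (n * (8 * (Z + M) + 5) + 5) + 8) + 1"
  using assms(1,3)
proof (induction r arbitrary: i)
  case (Suc r)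
  let ?B = "n * (8 * (Z + M) + 5) + 1"
  define Q where "Q = k * (n * (8 * (Z + M) + 5) + 5)"
  let ?P = "\<lambda>m. feasible_tm (real i * u) m ((W, real i * u) # dp_history F u i) ts"
  note val = val_bsearch_feasible[OF Suc.prems(1), folded Suc_eq_plus1]
  have "cost (?P m) \<le> ?B" for m
  proof -
    have "cost (?P m) \<le> length ts * (8 * (Z + length ((W, real i * u) # dp_history F u i)) + 5) + 1"
      by (rule cost_feasible_tm) (use pl in \<open>auto simp: ts length_atoms_tm\<close>)
    also have "\<dots> \<le> ?B"
      using Suc.prems(2) by (simp add: ts dp_history_def)
    finally show ?thesis .
  qed
  then have "cost (bsearch_tm ?P 0 (W + 1)) \<le> k * (?B + 4) + 2"
    by (rule cost_bsearch_tm) (use assms(2) in auto)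
  then have bs: "cost (bsearch_tm ?P 0 (Suc W)) \<le> Q + 2"
    by (simp add: Q_def add.commute)
  show ?case
  proof (cases "W \<le> F i")
    case True
    then show ?thesis using bs unfolding Q_def [symmetric] by (simp add: val)
  next
    case False
    have IH: "cost (dp_tm W ts u r (Suc i) (dp_history F u (Suc i))) \<le> r * (Q + 8) + 1"
      unfolding Q_def by (rule Suc.IH) (use Suc.prems in auto)
    have "cost (dp_tm W ts u (Suc r) i (dp_history F u i))
        = 6 + cost (bsearch_tm ?P 0 (Suc W)) + cost (dp_tm W ts u r (Suc i) (dp_history F u (Suc i)))"
      using False by (simp add: val dp_history_Suc)
    also have "\<dots> \<le> 6 + (Q + 2) + (r * (Q + 8) + 1)" using IH bs by linarith
    finally show ?thesis unfolding Q_def [symmetric] by simp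
  qed
qed simp

end

section \<open>The timed algorithm\<close>

text \<open>Atoms are grouped by the dyadic interval of their weight; the mass of a group is a
  difference of two oracle values, the last interval being cut at \<open>W\<close>.\<close>

lemma val_rounded_mean_tm:
  assumes W: "1 \<le> W" and supp: "set_pmf (X i) \<subseteq> {1..W}"
  shows "val (rounded_mean_tm W (cdf_oracle X) i) = rounded_mean W (X i)"
proof -
  define m where "m = nat \<lfloor>log 2 (real W)\<rfloor> + 1"
  define l where "l j = nat \<lfloor>log 2 (real j)\<rfloor>" for j :: nat
  have l_iff: "l j = k \<longleftrightarrow> 2 ^ k \<le> j \<and> j < 2 ^ (k + 1)" if "1 \<le> j" for j k
  proof -
    have "0 \<le> \<lfloor>log 2 (real j)\<rfloor>" using that by simp
    then have "l j = k \<longleftrightarrow> \<lfloor>log 2 (real j)\<rfloor> = int k" by (auto simp: l_def)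
    then show ?thesis using floor_log_nat_eq_powr_iff[of 2 j k] that by simp
  qed
  have powi: "(2 :: real) powi \<lfloor>log 2 (real j)\<rfloor> = 2 ^ l j" if "1 \<le> j" for j
    using that by (simp add: l_def power_int_def)
  have l_le: "l j < m" if "1 \<le> j" "j \<le> W" for j
  proof -
    have "log 2 (real j) \<le> log 2 (real W)" using that by simp
    then have "\<lfloor>log 2 (real j)\<rfloor> \<le> \<lfloor>log 2 (real W)\<rfloor>" by (rule floor_mono)
    then show ?thesis by (simp add: l_def m_def nat_mono less_Suc_eq_le)
  qed
  have Wm: "2 ^ k \<le> W" if "k < m" for k
  proof -
    have "k \<le> l W" using that by (simp add: m_def l_def)
    then have "(2::nat) ^ k \<le> 2 ^ l W" by (intro power_increasing) auto
    also have "\<dots> \<le> W" using l_iff[OF W, of "l W"] by simp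
    finally show ?thesis .
  qed
  have block: "cdf_oracle X i (min (2 ^ (k + 1) - 1) W) - cdf_oracle X i (2 ^ k - 1)
      = (\<Sum>j | j \<in> {1..W} \<and> l j = k. pmf (X i) j)" if "k < m" for k
  proof -
    let ?b = "min (2 ^ (k + 1) - 1) W"
    have pos: "(1::nat) \<le> 2 ^ k" by simp
    have sub: "{..2 ^ k - 1} \<subseteq> {..?b}" using Wm[OF that] by auto
    have "cdf_oracle X i ?b - cdf_oracle X i (2 ^ k - 1)
        = measure_pmf.prob (X i) ({..?b} - {..2 ^ k - 1})"
      unfolding cdf_oracle_def using sub by (intro measure_pmf.finite_measure_Diff [symmetric]) auto
    also have "{..?b} - {..2 ^ k - 1} = {j. j \<in> {1..W} \<and> l j = k}"
    proof (rule set_eqI)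
      fix j
      have "j \<in> {..?b} - {..2 ^ k - 1} \<longleftrightarrow> 2 ^ k \<le> j \<and> j < 2 ^ (k + 1) \<and> j \<le> W"
        using pos by (auto simp: not_le)
      also have "\<dots> \<longleftrightarrow> j \<in> {1..W} \<and> l j = k"
        using pos l_iff[of j k] by (cases "1 \<le> j") auto
      finally show "j \<in> {..?b} - {..2 ^ k - 1} \<longleftrightarrow> j \<in> {j. j \<in> {1..W} \<and> l j = k}" by simp
    qed
    also have "measure_pmf.prob (X i) \<dots> = (\<Sum>j | j \<in> {1..W} \<and> l j = k. pmf (X i) j)"
      by (rule measure_measure_pmf_finite) simp
    finally show ?thesis .
  qed
  have "val (rounded_mean_tm W (cdf_oracle X) i)
      = (\<Sum>k<m. 2 ^ k * (cdf_oracle X i (min (2 ^ (k + 1) - 1) W) - cdf_oracle X i (2 ^ k - 1)))"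
    by (simp add: rounded_mean_tm_def m_def)
  also have "\<dots> = (\<Sum>k<m. \<Sum>j | j \<in> {1..W} \<and> l j = k. pmf (X i) j * 2 ^ l j)"
  proof (rule sum.cong)
    fix k assume k: "k \<in> {..<m}"
    have "(\<Sum>j | j \<in> {1..W} \<and> l j = k. pmf (X i) j * 2 ^ l j)
        = (\<Sum>j | j \<in> {1..W} \<and> l j = k. pmf (X i) j * 2 ^ k)"
      by (rule sum.cong) auto
    then show "2 ^ k * (cdf_oracle X i (min (2 ^ (k + 1) - 1) W) - cdf_oracle X i (2 ^ k - 1))
        = (\<Sum>j | j \<in> {1..W} \<and> l j = k. pmf (X i) j * 2 ^ l j)"
      using block[of k] k by (simp add: sum_distrib_right [symmetric] del: One_nat_def)
  qed simp
  also have "\<dots> = (\<Sum>j\<in>{1..W}. pmf (X i) j * 2 ^ l j)"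
    by (rule sum.group) (use l_le in auto)
  also have "\<dots> = rounded_mean W (X i)"
    unfolding rounded_mean_def by (rule sum.cong) (simp_all add: powi)
  finally show ?thesis .
qed

lemma cost_rounded_mean_tm:
  "cost (rounded_mean_tm W D i) \<le> 13 * (nat \<lfloor>log 2 (real W)\<rfloor> + 1) + 4"
proof -
  have "cost (rounded_mean_tm W D i) \<le> 3 + (1 + (nat \<lfloor>log 2 (real W)\<rfloor> + 1) * (11 + 2))"
    unfolding rounded_mean_tm_def cost_bind_tm val_charge cost_charge
    by (intro add_left_mono cost_sum_tm) simp
  then show ?thesis by simp
qed

context sukp_instance
begin

abbreviation "c' \<equiv> \<lambda>p. c p * 2 ^ exponent p"
abbreviation "Y \<equiv> \<lambda>p. block W \<zeta> \<eta> (X p) (exponent p)"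

definition block_plateaus :: "nat \<Rightarrow> (nat \<times> real) list" where
  "block_plateaus p = val (block_tm W \<zeta> \<eta> (cdf_oracle X) p (exponent p))"

definition block_atoms :: "(real \<times> (nat \<times> real) list) list" where
  "block_atoms = map (\<lambda>p. (c' p, val (atoms_tm (block_plateaus p)))) [0..<n]"

text \<open>The value claim of \<open>block_tm_correct\<close> does not mention its exponent, so any
  admissible one, such as \<open>W\<close>, yields it.\<close>

lemma W_le_power: "W \<le> 2 ^ W"
  by (simp add: less_imp_le)

lemma plateaus_block: "p < n \<Longrightarrow> plateaus W (Dist (Y p)) 1 (block_plateaus p)"
  using block_tm_correct[OF _ W_le_power W_pos] unfolding block_plateaus_def by blast

sublocale dp: dp_instance n W c' Y "\<delta> * T" block_atoms block_plateaus plateau_bound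
proof
  show "item_family n c' Y" by (rule fam_blocks)
  show "0 < \<delta> * T" by (rule delta_T_bounds)
  show "set_pmf (Y p) \<subseteq> {1..W}" if "p < n" for p by (rule set_block'[OF that])
  show "plateaus W (Dist (Y p)) 1 (block_plateaus p) \<and> length (block_plateaus p) \<le> plateau_bound"
    if "p < n" for p
    using plateaus_block[OF that] length_plateaus_block[OF that] by blast
qed (rule block_atoms_def)

definition T_tm :: "real tm" where
  "T_tm = min_tm (\<lambda>i. bind_tm (rounded_mean_tm W (cdf_oracle X) i) (\<lambda>e. charge 2 (c i / e))) (n - 1)"

definition atoms_tm_of :: "nat \<Rightarrow> (real \<times> (nat \<times> real) list) tm" where
  "atoms_tm_of p = bind_tm (charge 6 (exponent p)) (\<lambda>e. bind_tm (block_tm W \<zeta> \<eta> (cdf_oracle X) p e)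
     (\<lambda>ps. bind_tm (atoms_tm ps) (\<lambda>as. charge 3 (c p * 2 ^ e, as))))"

lemma T_tm_val: "real W / 2 * val T_tm = T"
proof -
  have eq: "{..n - 1} = {..<n}" using n_ge_1 by auto
  have "(\<lambda>i. val (bind_tm (rounded_mean_tm W (cdf_oracle X) i) (\<lambda>e. charge 2 (c i / e)))) ` {..<n}
      = (\<lambda>i. c i / rounded_mean W (X i)) ` {..<n}"
    using val_rounded_mean_tm[where X = X, OF W_pos supp] by (intro image_cong) auto
  then show ?thesis unfolding T_tm_def val_min_tm eq by (simp add: T_par_def)
qed

lemma T_tm_cost: "cost T_tm \<le> n * (13 * (nat \<lfloor>log 2 (real W)\<rfloor> + 1) + 4 + 2 + 2)"
proof -
  have "cost T_tm \<le> Suc (n - 1) * (13 * (nat \<lfloor>log 2 (real W)\<rfloor> + 1) + 4 + 2 + 2)"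
    unfolding T_tm_def
    by (rule cost_min_tm) (use cost_rounded_mean_tm[of W "cdf_oracle X"] in simp)
  then show ?thesis using n_ge_1 by simp
qed

lemma atoms_tm_of_val: "val (map_tm atoms_tm_of [0..<n]) = block_atoms"
  by (simp add: atoms_tm_of_def block_atoms_def block_plateaus_def)

lemma atoms_tm_of_cost:
  assumes kk: "W \<le> 2 ^ kk" "1 \<le> kk"
  shows "cost (map_tm atoms_tm_of [0..<n])
    \<le> 1 + n * ((6 + (nat \<lfloor>log 2 (real W)\<rfloor> + 1) * (93 * plateau_bound ^ 2 * kk)
        + (4 * plateau_bound + 1) + 3) + 2)"
proof -
  have "cost (atoms_tm_of p)
      \<le> 6 + (nat \<lfloor>log 2 (real W)\<rfloor> + 1) * (93 * plateau_bound ^ 2 * kk) + (4 * plateau_bound + 1) + 3"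
    if p: "p < n" for p
  proof -
    have "Suc (exponent p) \<le> nat \<lfloor>log 2 (real W)\<rfloor> + 1" using exponent_le_log[OF p] by linarith
    then have "Suc (exponent p) * (93 * plateau_bound ^ 2 * kk)
        \<le> (nat \<lfloor>log 2 (real W)\<rfloor> + 1) * (93 * plateau_bound ^ 2 * kk)"
      by (rule mult_le_mono1)
    moreover have "cost (block_tm W \<zeta> \<eta> (cdf_oracle X) p (exponent p)) \<le> Suc (exponent p) * (93 * plateau_bound ^ 2 * kk)"
      using block_tm_correct[OF p kk] by blast
    moreover have "cost (atoms_tm (block_plateaus p)) \<le> 4 * plateau_bound + 1"
      using cost_atoms_tm[of "block_plateaus p"] dp.pl[OF p] by linarith
    moreover have "cost (atoms_tm_of p) = 6 + cost (block_tm W \<zeta> \<eta> (cdf_oracle X) p (exponent p))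
        + cost (atoms_tm (block_plateaus p)) + 3"
      by (simp add: atoms_tm_of_def block_plateaus_def)
    ultimately show ?thesis by linarith
  qed
  then have "cost (map_tm atoms_tm_of [0..<n])
      \<le> 1 + length [0..<n] * ((6 + (nat \<lfloor>log 2 (real W)\<rfloor> + 1) * (93 * plateau_bound ^ 2 * kk)
        + (4 * plateau_bound + 1) + 3) + 2)"
    by (intro cost_map_tm) auto
  then show ?thesis by simp
qed

text \<open>19 = 2 + 2 + 3 + 3 + 9 pays for \<open>T\<close> and the four parameters, 8 = 1 + 6 + 1
  for the unit, the number of rounds and the initial list.\<close>

lemma sukp_alg_tm_eq:
  "val (sukp_alg_tm K n W c (cdf_oracle X) \<epsilon>)
    = val (dp_tm W block_atoms (\<delta> * T) (dp_rounds K n \<epsilon>) 1 [(0, 0)])" (is ?val)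
  "cost (sukp_alg_tm K n W c (cdf_oracle X) \<epsilon>)
    = 1 + cost T_tm + 19 + (n + 1) + cost (map_tm atoms_tm_of [0..<n]) + 8
      + cost (dp_tm W block_atoms (\<delta> * T) (dp_rounds K n \<epsilon>) 1 [(0, 0)])" (is ?cost)
proof -
  let ?T = "real W / 2 * val T_tm"
  let ?atoms = "\<lambda>p. bind_tm (charge 6 (nat \<lceil>log 2 (theta_par n \<epsilon> * T / c p)\<rceil>))
     (\<lambda>e. bind_tm (block_tm W \<zeta> \<eta> (cdf_oracle X) p e)
     (\<lambda>ps. bind_tm (atoms_tm ps) (\<lambda>as. charge 3 (c p * 2 ^ e, as))))"
  \<comment> \<open>The ceiling expression equals \<open>exponent p\<close> only for actual types,
    so the list elements must be available.\<close>
  have map_tm_cong: "map_tm f xs = map_tm g xs" if "\<And>x. x \<in> set xs \<Longrightarrow> f x = g x"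
    for f g :: "nat \<Rightarrow> (real \<times> (nat \<times> real) list) tm" and xs
    using that by (induction xs) auto
  have atoms: "map_tm ?atoms [0..<n] = map_tm atoms_tm_of [0..<n]"
    by (rule map_tm_cong) (simp add: atoms_tm_of_def exponent_bounds(1))
  have "sukp_alg_tm K n W c (cdf_oracle X) \<epsilon> =
    bind_tm (charge 1 (n - 1)) (\<lambda>l. bind_tm T_tm (\<lambda>q. bind_tm (charge 2 T) (\<lambda>T'.
    bind_tm (charge 2 (theta_par n \<epsilon>)) (\<lambda>_. bind_tm (charge 3 \<delta>) (\<lambda>_. bind_tm (charge 3 \<eta>) (\<lambda>_.
    bind_tm (charge 9 \<zeta>) (\<lambda>_. bind_tm (charge (n + 1) [0..<n]) (\<lambda>_.
    bind_tm (map_tm atoms_tm_of [0..<n]) (\<lambda>ts. bind_tm (charge 1 (\<delta> * T)) (\<lambda>u.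
    bind_tm (charge 6 (dp_rounds K n \<epsilon>)) (\<lambda>N. bind_tm (charge 1 [(0, 0)]) (\<lambda>fs.
    dp_tm W ts u N 1 fs))))))))))))"
    unfolding sukp_alg_tm_def atoms [symmetric] T_tm_val [symmetric] unfolding T_tm_def
    by (simp add: bind_tm_def)
  then show ?val ?cost by (simp_all add: atoms_tm_of_val del: val_map_tm)
qed

lemma dp_history_1: "dp_history dp.F u 1 = [(0, 0)]"
  by (simp add: dp_history_def dp_f_0[OF fam_blocks delta_T_bounds(1)])

lemma val_sukp_alg_tm: "val (sukp_alg_tm K n W c (cdf_oracle X) \<epsilon>) = sukp_alg K n W c X \<epsilon>"
proof -
  have F: "dp.F i = dp_hist n W c' Y (\<delta> * T) i i" for i
    by (rule dp_f_def[OF fam_blocks delta_T_bounds(1)])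
  have eq: "{1..<1 + N} = {1..N}" for N :: nat by auto
  have "val (sukp_alg_tm K n W c (cdf_oracle X) \<epsilon>) = dp_output n W c' Y (\<delta> * T) (dp_rounds K n \<epsilon>)"
    unfolding sukp_alg_tm_eq dp_history_1 [of "\<delta> * T", symmetric] dp.dp_tm_correct[OF order_refl]
      dp_output_def Let_def F eq Bex_def by (rule refl)
  then show ?thesis by (simp add: sukp_alg_def Let_def exponent_def [abs_def])
qed

lemma cost_sukp_alg_tm:
  assumes kk: "W + 1 \<le> 2 ^ kk" "1 \<le> kk" and N: "N = dp_rounds K n \<epsilon>" and m: "m = nat \<lfloor>log 2 (real W)\<rfloor> + 1"
  shows "cost (sukp_alg_tm K n W c (cdf_oracle X) \<epsilon>)
    \<le> n * (13 * m + 8) + (n * (m * (93 * plateau_bound ^ 2 * kk) + 4 * plateau_bound + 12) + n + 31)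
      + N * (kk * (n * (8 * (plateau_bound + (N + 1)) + 5) + 5) + 8)"
proof -
  have "W \<le> 2 ^ kk" using kk by simp
  from atoms_tm_of_cost[OF this kk(2), folded m]
  have atoms: "cost (map_tm atoms_tm_of [0..<n]) \<le> 1 + n * (m * (93 * plateau_bound ^ 2 * kk) + 4 * plateau_bound + 12)"
    by (simp add: add_ac)
  have T: "cost T_tm \<le> n * (13 * m + 8)" using T_tm_cost[folded m] by (simp add: add_ac)
  have "cost (dp_tm W block_atoms (\<delta> * T) N 1 [(0, 0)])
      \<le> N * (kk * (n * (8 * (plateau_bound + (N + 1)) + 5) + 5) + 8) + 1"
    using dp.cost_dp_tm[of 1 kk N "N + 1"] kk unfolding dp_history_1 by simp
  then show ?thesis
    unfolding sukp_alg_tm_eq N [symmetric] using atoms T by linarith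
qed

end

section \<open>The running time bound\<close>

lemma ln_2_le_1: "ln (2 :: real) \<le> 1"
  using ln_le_minus_one[of "2 :: real"] by simp

text \<open>The logarithm of 1 / \<epsilon> enters as 2 * ln s \<le> 2 * (s - 1). The numerator is
  then at most 10 * L * s, and the denominator at least \<eta> / 2 with 1 / \<eta> = 10 * L *
  s^2.\<close>

lemma zeta_par_le:
  assumes W: "2 \<le> W" and s: "1 < s" "\<epsilon> = 1 / s\<^sup>2"
  shows "zeta_par W \<epsilon> \<le> 200 * (log 2 (real W))\<^sup>2 * s ^ 3"
proof -
  define L where "L = log 2 (real W)"
  have L: "1 \<le> L" unfolding L_def by (rule log2_ge_1[OF W])
  have eps: "0 < \<epsilon>" "\<epsilon> < 1" using s by (auto simp: power2_eq_square less_1_mult)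
  note eta = eta_par_bounds[OF W eps]
  have inv: "1 / eta_par W \<epsilon> = 10 * L * s\<^sup>2" using s L by (simp add: eta_par_def L_def)
  have "real W / eta_par W \<epsilon> = real W * (1 / eta_par W \<epsilon>)" by simp
  also have "\<dots> = real W * 10 * L * s\<^sup>2" unfolding inv by simp
  finally have "ln (real W / eta_par W \<epsilon>) = ln (real W) + ln 10 + ln L + 2 * ln s"
    using W L s by (simp add: ln_mult ln_realpow)
  also have "\<dots> \<le> L + 9 + (L - 1) + 2 * (s - 1)"
  proof -
    have "ln (real W) = L * ln 2" by (simp add: L_def log_def)
    also have "\<dots> \<le> L * 1" using L ln_2_le_1 by (intro mult_left_mono) auto
    finally have "ln (real W) \<le> L" by simp
    moreover have "ln (10 :: real) \<le> 9" using ln_le_minus_one[of "10 :: real"] by simp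
    moreover have "ln L \<le> L - 1" "ln s \<le> s - 1" using L s by (auto intro: ln_le_minus_one)
    ultimately show ?thesis by (intro add_mono mult_left_mono) auto
  qed
  also have "\<dots> \<le> 10 * (L * s)"
  proof -
    have "1 * s \<le> L * s" "L * 1 \<le> L * s" using L s by (auto intro: mult_right_mono mult_left_mono)
    then have "2 * L + 2 * s + 6 \<le> 10 * (L * s)" using L by linarith
    then show ?thesis by (simp add: algebra_simps)
  qed
  finally have num: "ln (real W / eta_par W \<epsilon>) \<le> 10 * (L * s)" .
  have "eta_par W \<epsilon> - (eta_par W \<epsilon>)\<^sup>2 \<le> ln (1 + eta_par W \<epsilon>)"
    using eta by (intro ln_one_plus_pos_lower_bound) auto
  moreover have "(eta_par W \<epsilon>)\<^sup>2 \<le> 1 / 10 * eta_par W \<epsilon>"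
    using eta unfolding power2_eq_square by (intro mult_right_mono) auto
  ultimately have den: "eta_par W \<epsilon> / 2 \<le> ln (1 + eta_par W \<epsilon>)" using eta by simp
  have "zeta_par W \<epsilon> = ln (real W / eta_par W \<epsilon>) / ln (1 + eta_par W \<epsilon>)"
    by (simp add: zeta_par_def log_def)
  also have "\<dots> \<le> 10 * (L * s) / (eta_par W \<epsilon> / 2)"
    using num den eta L s by (intro frac_le) auto
  also have "\<dots> = 20 * (L * s) * (1 / eta_par W \<epsilon>)" by simp
  also have "\<dots> = 200 * L\<^sup>2 * s ^ 3" unfolding inv by (simp add: power2_eq_square power3_eq_cube)
  finally show ?thesis by (simp add: L_def)
qed

text \<open>\<open>P\<close> comes from the blocks, m * Z^2 * kk per type, and \<open>Q\<close> from
  the quadratic history cost N^2 of the DP. The product N * Z contributes the mixed monomial n^2 *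
  L^3 * s^7.\<close>

lemma total_cost_arith:
  fixes n L s A m kk Z N :: real
  assumes n: "1 \<le> n" and L: "1 \<le> L" and s: "1 \<le> s" and A: "1 \<le> A"
    and m: "0 \<le> m" "m \<le> 2 * L" and kk: "0 \<le> kk" "kk \<le> 3 * L"
    and Z: "2 \<le> Z" "Z \<le> 202 * L\<^sup>2 * s ^ 3" and N: "0 \<le> N" "N \<le> A * n * s ^ 4"
  defines "P \<equiv> n * L ^ 6 * s ^ 6" and "Q \<equiv> n ^ 3 * L * s ^ 8"
  shows "n * (13 * m + 8) + (n * (m * (93 * Z\<^sup>2 * kk) + 4 * Z + 12) + n + 31)
      + N * (kk * (n * (8 * (Z + (N + 1)) + 5) + 5) + 8)
    \<le> (558 * 202\<^sup>2 + 886 + (63 * A * 202 + 63 * A * A + 8 * A)) * (P + Q)"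
proof -
  have P: "n * L ^ a * s ^ b \<le> P" if "a \<le> 6" "b \<le> 6" for a b
    unfolding P_def using n L s that by (intro mult_mono power_increasing) auto
  have nP: "n \<le> P" using P[of 0 0] by simp
  have nn: "0 \<le> n" "0 \<le> L" "0 \<le> s" "0 \<le> A" "0 \<le> Z" "0 \<le> P" "0 \<le> Q" "1 \<le> P"
    using n L s A Z nP by (simp_all add: Q_def)
  have "n * (13 * m + 8) \<le> n * (34 * L)" using n L m by (intro mult_left_mono) auto
  also have "\<dots> \<le> 34 * P" using P[of 1 0] by simp
  finally have t1: "n * (13 * m + 8) \<le> 34 * P" .
  have "n * (m * (93 * Z\<^sup>2 * kk)) \<le> n * (2 * L * (93 * (202 * L\<^sup>2 * s ^ 3)\<^sup>2 * (3 * L)))"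
    using m Z(2) kk nn by (intro mult_left_mono mult_mono power_mono) auto
  also have "\<dots> = 558 * 202\<^sup>2 * P"
    by (simp add: P_def power_mult_distrib eval_nat_numeral)
  finally have t2: "n * (m * (93 * Z\<^sup>2 * kk)) \<le> 558 * 202\<^sup>2 * P" .
  have "n * (4 * Z + 12) \<le> n * (808 * L\<^sup>2 * s ^ 3 + 12)" using n Z by (intro mult_left_mono) auto
  also have "\<dots> = 808 * (n * L ^ 2 * s ^ 3) + 12 * n" by (simp add: algebra_simps)
  also have "\<dots> \<le> 820 * P" using P[of 2 3] P[of 0 0] by simp
  finally have t3: "n * (4 * Z + 12) \<le> 820 * P" .
  have "n * (8 * (Z + (N + 1)) + 5) + 5 \<le> n * (8 * (Z + (N + 1)) + 10)"
    using n by (simp add: algebra_simps)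
  \<comment> \<open>The constant 8 + 10 is at most 9 * Z, as Z \<ge> 2.\<close>
  also have "\<dots> \<le> n * (21 * (Z + N))" using n Z N by (intro mult_left_mono) auto
  finally have "N * (kk * (n * (8 * (Z + (N + 1)) + 5) + 5) + 8) \<le> N * (kk * (n * (21 * (Z + N))) + 8)"
    using N kk by (intro mult_left_mono add_right_mono) auto
  also have "\<dots> = N * (kk * (n * (21 * (Z + N)))) + 8 * N" by (simp add: algebra_simps)
  also have "N * (kk * (n * (21 * (Z + N))))
      \<le> (A * n * s ^ 4) * ((3 * L) * (n * (21 * (202 * L\<^sup>2 * s ^ 3 + A * n * s ^ 4))))"
    using N kk Z nn by (intro mult_mono mult_left_mono add_mono) auto
  also have "\<dots> = 63 * A * 202 * (n\<^sup>2 * L ^ 3 * s ^ 7) + 63 * A * A * Q"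
    by (simp add: Q_def algebra_simps eval_nat_numeral)
  also have "n\<^sup>2 * L ^ 3 * s ^ 7 \<le> P + Q"
  proof -
    \<comment> \<open>The mixed monomial is n * L * s^6 times (n * s) * L^2. The square of n * s
      leads to \<open>Q\<close>; the other square L^4, raised to L^5, leads to
      \<open>P\<close>.\<close>
    have "2 * ((n * s) * L\<^sup>2) \<le> (n * s)\<^sup>2 + (L\<^sup>2)\<^sup>2"
      using sum_squares_bound[of "n * s" "L\<^sup>2"] by (simp add: mult.assoc)
    moreover have "L ^ 4 \<le> L ^ 5" using L by (intro power_increasing) auto
    moreover have "0 \<le> (n * s) * L\<^sup>2" using nn by simp
    ultimately have "(n * s) * L\<^sup>2 \<le> (n * s)\<^sup>2 + L ^ 5" by (simp flip: power_mult)
    then have "(n * L * s ^ 6) * ((n * s) * L\<^sup>2) \<le> (n * L * s ^ 6) * ((n * s)\<^sup>2 + L ^ 5)"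
      using nn by (intro mult_left_mono) auto
    then show ?thesis by (simp add: P_def Q_def algebra_simps eval_nat_numeral)
  qed
  also have "8 * N \<le> 8 * A * P"
  proof -
    have "N \<le> A * (n * L ^ 0 * s ^ 4)" using N by simp
    also have "\<dots> \<le> A * P" using A by (intro mult_left_mono P) auto
    finally show ?thesis by simp
  qed
  finally have t4: "N * (kk * (n * (8 * (Z + (N + 1)) + 5) + 5) + 8)
      \<le> 63 * A * 202 * (P + Q) + 63 * A * A * Q + 8 * A * P"
    using A by (simp add: mult_left_mono)
  have "63 * A * A * Q + 8 * A * P \<le> (63 * A * A + 8 * A) * (P + Q)"
    using nn by (simp add: algebra_simps)
  with t4 have t4': "N * (kk * (n * (8 * (Z + (N + 1)) + 5) + 5) + 8)
      \<le> (63 * A * 202 + 63 * A * A + 8 * A) * (P + Q)"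
    by (simp add: algebra_simps)
  have "n * (m * (93 * Z\<^sup>2 * kk) + 4 * Z + 12) = n * (m * (93 * Z\<^sup>2 * kk)) + n * (4 * Z + 12)"
    by (simp add: algebra_simps)
  with t2 t3 have t5: "n * (m * (93 * Z\<^sup>2 * kk) + 4 * Z + 12) \<le> 558 * 202\<^sup>2 * P + 820 * P"
    by (simp only: add_mono)
  have "n * (13 * m + 8) + (n * (m * (93 * Z\<^sup>2 * kk) + 4 * Z + 12) + n + 31)
      \<le> 34 * P + ((558 * 202\<^sup>2 * P + 820 * P) + P + 31 * P)"
    using nn by (intro add_mono t1 t5 nP) simp
  also have "\<dots> = (558 * 202\<^sup>2 + 886) * P" by simp
  also have "\<dots> \<le> (558 * 202\<^sup>2 + 886) * (P + Q)" using nn by (intro mult_left_mono) auto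
  finally show ?thesis unfolding distrib_right [of "558 * 202\<^sup>2 + 886"] by (rule add_mono) (rule t4')
qed

lemma sukp_alg_tm_running_time:
  assumes "1 \<le> K"
  shows "\<exists>C>0. \<forall>n W c X \<epsilon>. min_sukp n W c X \<and> 0 < \<epsilon> \<and> \<epsilon> < 1 \<longrightarrow>
    real (cost (sukp_alg_tm K n W c (cdf_oracle X) \<epsilon>))
      \<le> C * (real n * log 2 (real W) ^ 6 / \<epsilon> ^ 3 + real n ^ 3 * log 2 (real W) / \<epsilon> ^ 4)"
proof -
  \<comment> \<open>K / \<delta> = 100 * K * n * s^4; the ceiling and the extra round add at most 2,
    hence 102.\<close>
  define A where "A = 102 * K"
  define C where "C = 558 * 202\<^sup>2 + 886 + (63 * A * 202 + 63 * A * A + 8 * A)"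
  have A: "1 \<le> A" using assms by (simp add: A_def)
  then have C: "0 < C" by (simp add: C_def add_pos_pos)
  moreover have "real (cost (sukp_alg_tm K n W c (cdf_oracle X) \<epsilon>))
      \<le> C * (real n * log 2 (real W) ^ 6 / \<epsilon> ^ 3 + real n ^ 3 * log 2 (real W) / \<epsilon> ^ 4)"
    if inst: "min_sukp n W c X" and eps: "0 < \<epsilon>" "\<epsilon> < 1" for n W c X \<epsilon>
  proof -
    interpret sukp_instance n W c X \<epsilon> by unfold_locales (use inst eps in auto)
    define L where "L = log 2 (real W)"
    define s where "s = 1 / sqrt \<epsilon>"
    \<comment> \<open>One more than needed for \<open>W\<close>, because the DP searches the
      \<open>W + 1\<close> values from 0 to \<open>W\<close>.\<close>
    define kk where "kk = nat \<lceil>L\<rceil> + 1"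
    define m where "m = nat \<lfloor>log 2 (real W)\<rfloor> + 1"
    define N where "N = dp_rounds K n \<epsilon>"
    define Z where "Z = plateau_bound"
    have L: "1 \<le> L" unfolding L_def by (rule log2_ge_1[OF W_ge_2])
    have s: "1 < s" "\<epsilon> = 1 / s\<^sup>2" using eps by (auto simp: s_def power_divide)
    have n: "1 \<le> real n" using n_ge_1 by simp
    have kk: "W + 1 \<le> 2 ^ kk" "1 \<le> kk" "real kk \<le> 3 * L"
    proof -
      have "real W = 2 powr L" using W_ge_2 by (simp add: L_def)
      also have "\<dots> \<le> 2 powr real (nat \<lceil>L\<rceil>)" by (intro powr_mono real_nat_ceiling_ge) auto
      also have "\<dots> = real (2 ^ nat \<lceil>L\<rceil>)" by (simp add: powr_realpow)
      finally have "W \<le> 2 ^ nat \<lceil>L\<rceil>" by (simp only: of_nat_le_iff)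
      moreover have "(1 :: nat) \<le> 2 ^ nat \<lceil>L\<rceil>" by simp
      ultimately show "W + 1 \<le> 2 ^ kk" unfolding kk_def power_add power_one_right by linarith
      show "1 \<le> kk" by (simp add: kk_def)
      show "real kk \<le> 3 * L" using L unfolding kk_def by linarith
    qed
    have m: "real m \<le> 2 * L" using L unfolding m_def L_def by linarith
    have Z: "2 \<le> real Z" "real Z \<le> 202 * L\<^sup>2 * s ^ 3"
    proof -
      show "2 \<le> real Z" by (simp add: Z_def plateau_bound_def)
      have "1 * 1 \<le> L\<^sup>2 * s ^ 3" using L s by (intro mult_mono one_le_power) auto
      moreover have "real Z \<le> \<zeta> + 2" unfolding Z_def plateau_bound_def using zeta by linarith
      moreover have "\<zeta> \<le> 200 * L\<^sup>2 * s ^ 3" unfolding L_def by (rule zeta_par_le[OF W_ge_2 s])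
      ultimately show "real Z \<le> 202 * L\<^sup>2 * s ^ 3" by linarith
    qed
    have N: "real N \<le> A * real n * s ^ 4"
    proof -
      have e2: "\<epsilon>\<^sup>2 = 1 / s ^ 4" unfolding s(2) by (simp add: power_divide flip: power_mult)
      have e: "K / \<delta> = 100 * K * (real n * s ^ 4)"
        unfolding delta_par_def e2 using s n by simp
      have "1 * 1 \<le> real n * s ^ 4" using n s by (intro mult_mono one_le_power) auto
      then have 1: "1 * 1 \<le> K * (real n * s ^ 4)" using assms by (intro mult_mono) auto
      then have "real N \<le> K / \<delta> + 2" unfolding N_def dp_rounds_def e by linarith
      also have "\<dots> \<le> 102 * (K * (real n * s ^ 4))" using 1 unfolding e by linarith
      finally show ?thesis by (simp add: A_def mult_ac)
    qed
    have "real (cost (sukp_alg_tm K n W c (cdf_oracle X) \<epsilon>))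
        \<le> real (n * (13 * m + 8) + (n * (m * (93 * Z ^ 2 * kk) + 4 * Z + 12) + n + 31)
          + N * (kk * (n * (8 * (Z + (N + 1)) + 5) + 5) + 8))"
      unfolding of_nat_le_iff Z_def by (rule cost_sukp_alg_tm[OF kk(1,2) N_def m_def])
    also have "\<dots> = real n * (13 * real m + 8)
        + (real n * (real m * (93 * (real Z)\<^sup>2 * real kk) + 4 * real Z + 12) + real n + 31)
        + real N * (real kk * (real n * (8 * (real Z + (real N + 1)) + 5) + 5) + 8)"
      by simp
    also have "\<dots> \<le> C * (real n * L ^ 6 * s ^ 6 + real n ^ 3 * L * s ^ 8)"
      unfolding C_def using n L s A m kk Z N by (intro total_cost_arith) auto
    also have "real n * L ^ 6 * s ^ 6 = real n * L ^ 6 / \<epsilon> ^ 3"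
      using s by (simp add: power_divide flip: power_mult)
    also have "real n ^ 3 * L * s ^ 8 = real n ^ 3 * L / \<epsilon> ^ 4"
      using s by (simp add: power_divide flip: power_mult)
    finally show ?thesis by (simp add: L_def)
  qed
  ultimately show ?thesis by blast
qed

lemma is_fptas_sukp_alg_tm:
  assumes "6 \<le> K"
  shows "is_fptas (sukp_alg_tm K)"
  unfolding is_fptas_def
proof (intro conjI allI impI)
  fix n W c X and \<epsilon> :: real assume "min_sukp n W c X \<and> 0 < \<epsilon> \<and> \<epsilon> < 1"
  then interpret sukp_instance n W c X \<epsilon> by unfold_locales auto
  obtain v where v: "sukp_alg K n W c X \<epsilon> = Some v" using sukp_alg_output[OF assms] by blast
  then show "\<exists>v. val (sukp_alg_tm K n W c (cdf_oracle X) \<epsilon>) = Some v \<and>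
      (1 - \<epsilon>) * sukp_opt n W c X W \<le> v \<and> v \<le> (1 + \<epsilon>) * sukp_opt n W c X W"
    unfolding val_sukp_alg_tm using sukp_alg_approx[OF v] by blast
next
  obtain C where C: "0 < C" "\<And>n W c X \<epsilon>. min_sukp n W c X \<Longrightarrow> 0 < \<epsilon> \<Longrightarrow> \<epsilon> < 1 \<Longrightarrow>
    real (cost (sukp_alg_tm K n W c (cdf_oracle X) \<epsilon>))
      \<le> C * (real n * log 2 (real W) ^ 6 / \<epsilon> ^ 3 + real n ^ 3 * log 2 (real W) / \<epsilon> ^ 4)"
    using sukp_alg_tm_running_time[of K] assms by (meson order_trans one_le_numeral)
  have "real (cost (sukp_alg_tm K n W c (cdf_oracle X) \<epsilon>))
      \<le> 2 * C * real n ^ 3 * log 2 (real W) ^ 6 * (1 / \<epsilon>) ^ 4"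
    if inst: "min_sukp n W c X" "0 < \<epsilon>" "\<epsilon> < 1" for n W c X \<epsilon>
  proof -
    have n: "1 \<le> real n" and L: "1 \<le> log 2 (real W)" and e: "1 \<le> 1 / \<epsilon>"
      using inst log2_ge_1 by (auto simp: min_sukp_def)
    \<comment> \<open>One monomial above both terms of the bound, as all three bases are at least
      1.\<close>
    define M where "M = real n ^ 3 * log 2 (real W) ^ 6 * (1 / \<epsilon>) ^ 4"
    have "real n ^ 1 * log 2 (real W) ^ 6 * (1 / \<epsilon>) ^ 3 \<le> M"
      unfolding M_def using n L e inst(2) by (intro mult_mono power_increasing) auto
    moreover have "real n ^ 3 * log 2 (real W) ^ 1 * (1 / \<epsilon>) ^ 4 \<le> M"
      unfolding M_def using n L e inst(2) by (intro mult_mono power_increasing) auto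
    ultimately have "real n * log 2 (real W) ^ 6 / \<epsilon> ^ 3 + real n ^ 3 * log 2 (real W) / \<epsilon> ^ 4 \<le> 2 * M"
      unfolding mult_2 by (intro add_mono) (simp_all add: power_divide)
    then have "C * (real n * log 2 (real W) ^ 6 / \<epsilon> ^ 3 + real n ^ 3 * log 2 (real W) / \<epsilon> ^ 4)
        \<le> C * (2 * M)"
      using C(1) by (intro mult_left_mono) auto
    with C(2)[OF inst] have "real (cost (sukp_alg_tm K n W c (cdf_oracle X) \<epsilon>)) \<le> C * (2 * M)"
      by (rule order_trans)
    then show ?thesis by (simp add: M_def mult_ac)
  qed
  then show "\<exists>C d1 d2 d3. \<forall>n W c X \<epsilon>. min_sukp n W c X \<and> 0 < \<epsilon> \<and> \<epsilon> < 1 \<longrightarrow>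
    real (cost (sukp_alg_tm K n W c (cdf_oracle X) \<epsilon>))
      \<le> C * real n ^ d1 * log 2 (real W) ^ d2 * (1 / \<epsilon>) ^ d3"
    by blast
qed

text \<open>The round limit decides only whether an output exists. The accuracy of an output
  concerns the first round that succeeds, and is therefore the same for every
  \<open>K\<close>.\<close>

theorem theorem4:
  fixes K :: real
  assumes "K \<ge> 1"
  shows
    "(\<forall>n W c X \<epsilon>. min_sukp n W c X \<and> 0 < \<epsilon> \<and> \<epsilon> < 1 \<longrightarrow>
        val (sukp_alg_tm K n W c (cdf_oracle X) \<epsilon>) = sukp_alg K n W c X \<epsilon> \<and>
        (\<forall>v. sukp_alg K n W c X \<epsilon> = Some v \<longrightarrow>
           (1 - \<epsilon>) * sukp_opt n W c X W \<le> v \<and> v \<le> (1 + \<epsilon>) * sukp_opt n W c X W)) \<and>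
     (K \<ge> 6 \<longrightarrow> is_fptas (sukp_alg_tm K)) \<and>
     (\<exists>C>0. \<forall>n W c X \<epsilon>. min_sukp n W c X \<and> 0 < \<epsilon> \<and> \<epsilon> < 1 \<longrightarrow>
        real (cost (sukp_alg_tm K n W c (cdf_oracle X) \<epsilon>))
          \<le> C * (real n * log 2 (real W) ^ 6 / \<epsilon> ^ 3 + real n ^ 3 * log 2 (real W) / \<epsilon> ^ 4))"
proof (intro conjI allI impI)
  fix n W c X and \<epsilon> :: real assume "min_sukp n W c X \<and> 0 < \<epsilon> \<and> \<epsilon> < 1"
  then interpret sukp_instance n W c X \<epsilon> by unfold_locales auto
  show "val (sukp_alg_tm K n W c (cdf_oracle X) \<epsilon>) = sukp_alg K n W c X \<epsilon>"
    by (rule val_sukp_alg_tm)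
  show "(1 - \<epsilon>) * sukp_opt n W c X W \<le> v" "v \<le> (1 + \<epsilon>) * sukp_opt n W c X W"
    if "sukp_alg K n W c X \<epsilon> = Some v" for v
    using sukp_alg_approx[OF that] by blast+
qed (use is_fptas_sukp_alg_tm sukp_alg_tm_running_time[OF assms] in blast)+

end
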